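(* Let $W$ be a Lévy white noise in $\mathcal{D}'(\mathbb{R})$, with characteristic functional $\widehat{\mathscr{P}}_W$, characteristic exponent $\Psi$ and Lévy measure $\nu$. Then the following conditions are equivalent. 1. The Lévy white noise $W$ is tempered, i.e. $W\in\mathcal{S}'(\mathbb{R})$ almost surely. 2. The characteristic functional $\widehat{\mathscr{P}}_W$ is continuous over $\mathcal{D}(\mathbb{R})$ for the topology induced by $\mathcal{S}(\mathbb{R})$. 3. There exist $C>0$ and $\epsilon>0$ such that, for any $\xi\in\mathbb{R}$, $|\Psi(\xi)|\le C\left(|\xi|^\epsilon+|\xi|^2\right)$. 4. For any $\varphi\in\mathcal{D}(\mathbb{R})$, the random sequence $X_{W,\varphi}=\left(\langle W,\varphi(\cdot-n)\rangle\right)_{n\in\mathbb{Z}}$ belongs to $\mathcal{S}'(\mathbb{Z})$ almost surely. 5. There exists $\epsilon>0$ such that $\int_{|t|\ge 1}|t|^\epsilon\,\nu(\mathrm{d}t)<\infty$. 6. There exists $\epsilon>0$ such that, for any $\varphi\in\mathcal{D}(\mathbb{R})$, $\mathbb{E}[|\langle W,\varphi\rangle|^\epsilon]<\infty$. 7. There exist $\epsilon>0$ and $\varphi\in\mathcal{D}(\mathbb{R})\setminus\{0\}$ such that $\mathbb{E}[|\langle W,\varphi\rangle|^\epsilon]<\infty$. Moreover, if these conditions are not satisfied, then $W\notin\mathcal{S}'(\mathbb{R})$ almost surely.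
   Context: All random objects are defined on a fixed probability space $(\Omega,\mathcal{F},\mathscr{P})$. $\mathcal{D}(\mathbb{R})$ is the space of real, compactly supported, infinitely smooth functions on $\mathbb{R}$ with its usual inductive limit topology, and $\mathcal{D}'(\mathbb{R})$ is its topological dual (generalized functions). $\mathcal{S}(\mathbb{R})$ is the Schwartz space, a Fréchet space for the semi-norms $\|\varphi\|_{\infty,\alpha,\beta}=\sup_{x\in\mathbb{R}}|x|^\alpha|\mathrm{D}^\beta\varphi(x)|$, $\alpha\ge 0$, $\beta\in\mathbb{N}$; its topological dual $\mathcal{S}'(\mathbb{R})\subset\mathcal{D}'(\mathbb{R})$ is the space of tempered generalized functions. The space of tempered sequences $\mathcal{S}'(\mathbb{Z})$ is the set of real sequences $(u[n])_{n\in\mathbb{Z}}$ for which there is $\alpha\ge 0$ with $\sup_{n\in\mathbb{Z}}(1+|n|)^{-\alpha}|u[n]|<\infty$. A generalized random process $S$ is a random element of $\mathcal{D}'(\mathbb{R})$, where $\mathcal{D}'(\mathbb{R})$ is endowed with its cylindrical $\sigma$-field, generated by the sets $\{f\in\mathcal{D}'(\mathbb{R}):\langle f,\varphi\rangle<a\}$ with $\varphi\in\mathcal{D}(\mathbb{R})$, $a\in\mathbb{R}$. Its characteristic functional is $\widehat{\mathscr{P}}_S(\varphi)=\mathbb{E}[\mathrm{e}^{\mathrm{i}\langle S,\varphi\rangle}]$, $\varphi\in\mathcal{D}(\mathbb{R})$. A characteristic exponent is a function $\Psi:\mathbb{R}\to\mathbb{C}$ of the form $$\Psi(\xi)=\mathrm{i}\mu\xi-\frac{\sigma^2\xi^2}{2}+\int_{\mathbb{R}\setminus\{0\}}\left(\mathrm{e}^{\mathrm{i}\xi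 t}-1-\mathrm{i}\xi t\,\mathbf{1}_{|t|<1}\right)\nu(\mathrm{d}t),$$ with $\mu\in\mathbb{R}$, $\sigma^2\ge 0$, and $\nu$ a Lévy measure, i.e. a Radon measure on $\mathbb{R}\setminus\{0\}$ with $\int_{\mathbb{R}\setminus\{0\}}\inf(1,t^2)\,\nu(\mathrm{d}t)<\infty$. A Lévy white noise is a generalized random process $W$ in $\mathcal{D}'(\mathbb{R})$ whose characteristic functional is $\widehat{\mathscr{P}}_W(\varphi)=\exp\left(\int_{\mathbb{R}}\Psi(\varphi(x))\,\mathrm{d}x\right)$ for all $\varphi\in\mathcal{D}(\mathbb{R})$, where $\Psi$ is a characteristic exponent; $\Psi$ and the associated $\nu$ are called the characteristic exponent and the Lévy measure of $W$. *)

theory Defs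
  imports "HOL-Probability.Probability"
begin

section \<open>Test functions, Schwartz functions and their duals\<close>

definition smooth :: "(real \<Rightarrow> real) \<Rightarrow> bool" where
  "smooth f \<longleftrightarrow> (\<forall>k x. (deriv ^^ k) f field_differentiable at x)"

definition test_functions :: "(real \<Rightarrow> real) set" where
  "test_functions = {\<phi>. smooth \<phi> \<and> compact (closure {x. \<phi> x \<noteq> 0})}"

definition test_functions_on :: "real set \<Rightarrow> (real \<Rightarrow> real) set" where
  "test_functions_on K = {\<phi> \<in> test_functions. {x. \<phi> x \<noteq> 0} \<subseteq> K}"

definition seminorm_topology ::
    "(real \<Rightarrow> real) set \<Rightarrow> ((real \<Rightarrow> real) \<Rightarrow> real) set \<Rightarrow> (real \<Rightarrow> real) topology" where
  "seminorm_topology V P =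
     topology_generated_by
       {{\<psi> \<in> V. p (\<lambda>x. \<psi> x - \<phi> x) < r} | p \<phi> r. p \<in> P \<and> \<phi> \<in> V \<and> 0 < r}"

(* The case distinction is needed because 0 powr 0 = 0 in the library, whereas the weight for
   exponent 0 is constantly 1. *)
definition schwartz_weight :: "real \<Rightarrow> real \<Rightarrow> real" where
  "schwartz_weight \<alpha> x = (if \<alpha> = 0 then 1 else \<bar>x\<bar> powr \<alpha>)"

definition schwartz_seminorm :: "real \<Rightarrow> nat \<Rightarrow> (real \<Rightarrow> real) \<Rightarrow> real" where
  "schwartz_seminorm \<alpha> \<beta> \<phi> = (SUP x. schwartz_weight \<alpha> x * \<bar>(deriv ^^ \<beta>) \<phi> x\<bar>)"

definition schwartz_functions :: "(real \<Rightarrow> real) set" where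
  "schwartz_functions =
     {\<phi>. smooth \<phi> \<and>
         (\<forall>\<alpha>\<ge>0. \<forall>\<beta>. bdd_above (range (\<lambda>x. schwartz_weight \<alpha> x * \<bar>(deriv ^^ \<beta>) \<phi> x\<bar>)))}"

definition schwartz_topology :: "(real \<Rightarrow> real) topology" where
  "schwartz_topology =
     seminorm_topology schwartz_functions {schwartz_seminorm \<alpha> \<beta> | \<alpha> \<beta>. 0 \<le> \<alpha>}"

(* The Frechet topology of uniform convergence of all derivatives. *)
definition test_topology_on :: "real set \<Rightarrow> (real \<Rightarrow> real) topology" where
  "test_topology_on K =
     seminorm_topology (test_functions_on K) {schwartz_seminorm 0 \<beta> | \<beta>. True}"

definition absolutely_convex :: "(real \<Rightarrow> real) set \<Rightarrow> bool" where
  "absolutely_convex V \<longleftrightarrow>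
     (\<forall>\<phi>\<in>V. \<forall>\<psi>\<in>V. \<forall>a b. \<bar>a\<bar> + \<bar>b\<bar> \<le> 1 \<longrightarrow> (\<lambda>x. a * \<phi> x + b * \<psi> x) \<in> V)"

(* The locally convex inductive limit of the spaces test_functions_on K: a base consists of the
   translates of those absolutely convex sets that have an open trace on each of these spaces
   (Rudin, Functional Analysis, Definition 6.3). *)
definition test_topology :: "(real \<Rightarrow> real) topology" where
  "test_topology =
     topology_generated_by
       {(\<lambda>\<psi> x. \<phi> x + \<psi> x) ` V | \<phi> V.
          \<phi> \<in> test_functions \<and> V \<subseteq> test_functions \<and> absolutely_convex V \<and>
          (\<forall>K. compact K \<longrightarrow>
             openin (test_topology_on K) (V \<inter> test_functions_on K))}"

(* Functionals are extensional, i.e. undefined outside the underlying space, so that two of them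
   are equal iff they agree on that space. *)
definition continuous_dual :: "(real \<Rightarrow> real) topology \<Rightarrow> ((real \<Rightarrow> real) \<Rightarrow> real) set" where
  "continuous_dual T =
     {u \<in> extensional (topspace T).
        (\<forall>\<phi>\<in>topspace T. \<forall>\<psi>\<in>topspace T. \<forall>a b.
           u (\<lambda>x. a * \<phi> x + b * \<psi> x) = a * u \<phi> + b * u \<psi>) \<and>
        continuous_map T euclideanreal u}"

definition generalized_functions :: "((real \<Rightarrow> real) \<Rightarrow> real) set" where
  "generalized_functions = continuous_dual test_topology"

(* The space of tempered generalized functions, embedded into generalized_functions by
   restriction of functionals. *)
definition tempered_generalized_functions :: "((real \<Rightarrow> real) \<Rightarrow> real) set" where
  "tempered_generalized_functions =
     (\<lambda>v. restrict v test_functions) ` continuous_dual schwartz_topology"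

definition tempered_sequences :: "(int \<Rightarrow> real) set" where
  "tempered_sequences =
     {u. \<exists>\<alpha>\<ge>0. bdd_above (range (\<lambda>n. (1 + \<bar>real_of_int n\<bar>) powr (- \<alpha>) * \<bar>u n\<bar>))}"

section \<open>Generalized random processes\<close>

definition cylindrical_algebra :: "((real \<Rightarrow> real) \<Rightarrow> real) measure" where
  "cylindrical_algebra =
     sigma generalized_functions
       {{f \<in> generalized_functions. f \<phi> < a} | \<phi> a. \<phi> \<in> test_functions}"

definition generalized_random_process ::
    "'w measure \<Rightarrow> ('w \<Rightarrow> (real \<Rightarrow> real) \<Rightarrow> real) \<Rightarrow> bool" where
  "generalized_random_process M S \<longleftrightarrow> S \<in> M \<rightarrow>\<^sub>M cylindrical_algebra"

definition characteristic_functional ::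
    "'w measure \<Rightarrow> ('w \<Rightarrow> (real \<Rightarrow> real) \<Rightarrow> real) \<Rightarrow> (real \<Rightarrow> real) \<Rightarrow> complex" where
  "characteristic_functional M S \<phi> = (LINT \<omega>|M. iexp (S \<omega> \<phi>))"

section \<open>Levy white noises\<close>

definition radon_measure_on :: "real set \<Rightarrow> real measure \<Rightarrow> bool" where
  "radon_measure_on X \<nu> \<longleftrightarrow>
     sets \<nu> = sets (restrict_space borel X) \<and>
     (\<forall>K. compact K \<and> K \<subseteq> X \<longrightarrow> emeasure \<nu> K < \<infinity>) \<and>
     (\<forall>A\<in>sets \<nu>. emeasure \<nu> A = (SUP K\<in>{K. compact K \<and> K \<subseteq> A}. emeasure \<nu> K))"

definition levy_measure :: "real measure \<Rightarrow> bool" where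
  "levy_measure \<nu> \<longleftrightarrow>
     radon_measure_on (UNIV - {0}) \<nu> \<and> (\<integral>\<^sup>+ t. ennreal (min 1 (t\<^sup>2)) \<partial>\<nu>) < \<infinity>"

definition levy_khintchine :: "real \<Rightarrow> real \<Rightarrow> real measure \<Rightarrow> real \<Rightarrow> complex" where
  "levy_khintchine \<mu> \<sigma> \<nu> \<xi> =
     \<i> * of_real (\<mu> * \<xi>) - of_real (\<sigma>\<^sup>2 * \<xi>\<^sup>2 / 2) +
     (LINT t|\<nu>. iexp (\<xi> * t) - 1 - \<i> * of_real (\<xi> * t * indicator {t. \<bar>t\<bar> < 1} t))"

definition characteristic_exponent :: "(real \<Rightarrow> complex) \<Rightarrow> real measure \<Rightarrow> bool" where
  "characteristic_exponent \<Psi> \<nu> \<longleftrightarrow>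
     levy_measure \<nu> \<and> (\<exists>\<mu> \<sigma>. \<Psi> = levy_khintchine \<mu> \<sigma> \<nu>)"

definition levy_white_noise ::
    "'w measure \<Rightarrow> ('w \<Rightarrow> (real \<Rightarrow> real) \<Rightarrow> real) \<Rightarrow> (real \<Rightarrow> complex) \<Rightarrow> real measure \<Rightarrow> bool" where
  "levy_white_noise M W \<Psi> \<nu> \<longleftrightarrow>
     generalized_random_process M W \<and> characteristic_exponent \<Psi> \<nu> \<and>
     (\<forall>\<phi>\<in>test_functions.
        characteristic_functional M W \<phi> = exp (LINT x|lborel. \<Psi> (\<phi> x)))"

section \<open>The underlying sets of the topologies\<close>

lemma smooth_higher_deriv_lincomb:
  assumes "smooth f" "smooth g"
  shows "(deriv ^^ k) (\<lambda>x. a * f x + b * g x) = (\<lambda>x. a * (deriv ^^ k) f x + b * (deriv ^^ k) g x)"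
proof (induction k)
  case (Suc k)
  have d: "(deriv ^^ k) f field_differentiable at x" "(deriv ^^ k) g field_differentiable at x" for x
    using assms by (auto simp: smooth_def)
  show ?case
    by (rule ext, unfold funpow.simps comp_def Suc.IH, rule DERIV_imp_deriv,
        intro DERIV_add DERIV_cmult)
       (use d in \<open>auto simp: DERIV_deriv_iff_field_differentiable\<close>)
qed simp

lemma smooth_lincomb:
  assumes "smooth f" "smooth g"
  shows "smooth (\<lambda>x. a * f x + b * g x)"
  using assms
  by (auto simp: smooth_def smooth_higher_deriv_lincomb[OF assms]
           intro!: field_differentiable_add field_differentiable_mult)

lemma test_functions_lincomb:
  assumes "f \<in> test_functions" "g \<in> test_functions"
  shows "(\<lambda>x. a * f x + b * g x) \<in> test_functions"
proof -
  have "closure {x. a * f x + b * g x \<noteq> 0} \<subseteq> closure ({x. f x \<noteq> 0} \<union> {x. g x \<noteq> 0})"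
    by (intro closure_mono) auto
  moreover have "compact (closure ({x. f x \<noteq> 0} \<union> {x. g x \<noteq> 0}))"
    using assms by (auto simp: test_functions_def closure_Un)
  ultimately have "compact (closure {x. a * f x + b * g x \<noteq> 0})"
    by (metis (no_types, lifting) closed_closure compact_Int_closed inf.absorb2)
  then show ?thesis
    using assms by (simp add: test_functions_def smooth_lincomb)
qed

lemma higher_deriv_zero: "(deriv ^^ k) (\<lambda>x. 0::real) = (\<lambda>x. 0)"
  by (induction k) auto

lemma schwartz_seminorm_zero: "schwartz_seminorm \<alpha> \<beta> (\<lambda>x. 0) = 0"
  by (simp add: schwartz_seminorm_def higher_deriv_zero)

lemma topspace_seminorm_topology:
  assumes "P \<noteq> {}" "\<And>p. p \<in> P \<Longrightarrow> p (\<lambda>x. 0) = 0"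
  shows "topspace (seminorm_topology V P) = V"
proof -
  obtain p where p: "p \<in> P" using assms(1) by auto
  have "\<phi> \<in> \<Union> {{\<psi> \<in> V. p (\<lambda>x. \<psi> x - \<phi> x) < r} | p \<phi> r. p \<in> P \<and> \<phi> \<in> V \<and> 0 < r}" if "\<phi> \<in> V" for \<phi>
    using that p assms(2)[OF p]
    by (intro UnionI[of "{\<psi> \<in> V. p (\<lambda>x. \<psi> x - \<phi> x) < 1}"]) (auto intro!: exI[of _ p] exI[of _ \<phi>] exI[of _ "1::real"])
  then show ?thesis
    unfolding seminorm_topology_def topology_generated_by_topspace by blast
qed

lemma topspace_schwartz_topology: "topspace schwartz_topology = schwartz_functions"
  unfolding schwartz_topology_def
  by (rule topspace_seminorm_topology) (auto simp: schwartz_seminorm_zero)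

lemma topspace_test_topology_on: "topspace (test_topology_on K) = test_functions_on K"
  unfolding test_topology_on_def
  by (rule topspace_seminorm_topology) (auto simp: schwartz_seminorm_zero)

lemma topspace_test_topology: "topspace test_topology = test_functions"
proof
  show "topspace test_topology \<subseteq> test_functions"
  proof
    fix f assume "f \<in> topspace test_topology"
    then obtain \<phi> \<psi> where "\<phi> \<in> test_functions" "\<psi> \<in> test_functions" "f = (\<lambda>x. \<phi> x + \<psi> x)"
      unfolding test_topology_def topology_generated_by_topspace by auto
    then show "f \<in> test_functions"
      using test_functions_lincomb[of \<phi> \<psi> 1 1] by simp
  qed
next
  show "test_functions \<subseteq> topspace test_topology"
  proof
    fix \<phi> assume \<phi>: "\<phi> \<in> test_functions"
    have zero: "(\<lambda>x. 0) \<in> test_functions"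
      using test_functions_lincomb[OF \<phi> \<phi>, of 0 0] by simp
    have "openin (test_topology_on K) (test_functions \<inter> test_functions_on K)" for K
      using openin_topspace[of "test_topology_on K"]
      by (simp add: topspace_test_topology_on Int_absorb1 test_functions_on_def)
    moreover have "absolutely_convex test_functions"
      by (simp add: absolutely_convex_def test_functions_lincomb)
    moreover have "\<phi> \<in> (\<lambda>\<psi> x. \<phi> x + \<psi> x) ` test_functions"
      using zero by (intro image_eqI[of _ _ "\<lambda>x. 0"]) auto
    ultimately show "\<phi> \<in> topspace test_topology"
      unfolding test_topology_def topology_generated_by_topspace
      using \<phi> by blast
  qed
qed

end

theory Submission
  imports Defs
begin

text \<open>
  Let \<open>u \<phi> = - Re (\<integral> \<Psi> (\<phi> x) dx)\<close>, so that the characteristic functional has modulus \<open>exp (- u \<phi>)\<close>. All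
  conditions of the theorem are compared with the fractional moment of the Levy measure.

  A fractional moment bounds the characteristic exponent by \<open>C * (\<bar>\<xi>\<bar> powr \<epsilon> + \<bar>\<xi>\<bar>\<^sup>2)\<close>
  (\<open>\<Psi>_bound_if_fractional_moment\<close>). This growth bound makes the characteristic functional continuous for the
  Schwartz topology (\<open>cf_continuous_if_bound\<close>) and gives fractional moments of the noise that are uniform over
  test functions with bounded values and supports of bounded length (\<open>noise_moment_bound_if_growth\<close>). The
  uniform moments yield temperedness without any appeal to a Minlos theorem: almost surely the noise grows at
  most polynomially along the functions \<open>cos (k x)\<close> and \<open>sin (k x)\<close> cut off near an integer \<open>n\<close>, jointly in \<open>k\<close>
  and \<open>n\<close> (\<open>AE_polynomial_growth_pairs\<close>). A test function is cut into pieces by a partition of unity and each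
  piece is expanded into a Fourier series; its coefficients decrease rapidly in \<open>k\<close> and, for a Schwartz
  function, also in \<open>n\<close>. Hence a generalized function with such polynomial bounds extends to the Schwartz
  space (\<open>tempered_if_trig_bounds\<close>).

  Conversely, every condition forces \<open>u (\<xi> \<phi>) \<le> D * \<xi> powr \<eta>\<close> for some nonzero test function \<open>\<phi>\<close> and small \<open>\<xi>\<close>,
  and this implies a fractional moment of the Levy measure, since \<open>1 - cos\<close> is bounded below on dyadic shells
  (\<open>fractional_moment_if_exponent_small\<close>). For a moment of the noise the estimate of \<open>u\<close> is immediate. Continuity
  at 0 and growth along translates are exploited by the same device: \<open>u\<close> is additive over functions with
  disjoint supports and invariant under translation, so \<open>N\<close> disjoint copies of \<open>\<xi> \<phi>\<close> have exponent
  \<open>N * u (\<xi> \<phi>)\<close>, whereas Schwartz seminorms and polynomial bounds grow only polynomially with the number of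
  copies. If \<open>\<xi>\<close> is a small enough negative power of \<open>N\<close>, the \<open>N\<close> copies remain under control and
  \<open>u (\<xi> \<phi>)\<close> is at most a multiple of \<open>1 / N\<close>.

  For the translates this argument needs only that the polynomial growth has positive probability
  (\<open>fractional_moment_if_translates_tempered\<close>). Therefore, if the Levy measure has no fractional moment, the
  sequence of values on the translates of one bump is almost surely not tempered, and neither is the noise,
  because a tempered generalized function grows polynomially along translates (\<open>tempered_translates\<close>).
\<close>

section \<open>Smooth functions and test functions\<close>

text \<open>Closure properties of \<^const>\<open>smooth\<close> are proved by induction on the order of differentiability,
  generalising over the function, because the derivative of a product is no longer a product.\<close>

definition differentiable_upto :: "nat \<Rightarrow> (real \<Rightarrow> real) \<Rightarrow> bool" where
  "differentiable_upto n f \<longleftrightarrow> (\<forall>k<n. \<forall>x. (deriv ^^ k) f field_differentiable at x)"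

lemma smooth_iff_differentiable_upto: "smooth f \<longleftrightarrow> (\<forall>n. differentiable_upto n f)"
  unfolding smooth_def differentiable_upto_def by blast

lemma differentiable_upto_0: "differentiable_upto 0 f"
  by (simp add: differentiable_upto_def)

lemma differentiable_upto_Suc:
  "differentiable_upto (Suc n) f \<longleftrightarrow> (\<forall>x. f field_differentiable at x) \<and> differentiable_upto n (deriv f)"
  by (simp add: differentiable_upto_def All_less_Suc2 funpow_Suc_right del: funpow.simps(2))

lemma differentiable_upto_SucD: "differentiable_upto (Suc n) f \<Longrightarrow> differentiable_upto n f"
  by (simp add: differentiable_upto_def)

lemma differentiable_upto_SucI:
  assumes "\<And>x. (f has_real_derivative g x) (at x)" "differentiable_upto n g"
  shows "differentiable_upto (Suc n) f"
proof -
  have "deriv f = g" using assms(1) by (intro ext DERIV_imp_deriv)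
  then show ?thesis
    using assms by (auto simp: differentiable_upto_Suc field_differentiable_def)
qed

lemma differentiable_upto_SucE:
  assumes "differentiable_upto (Suc n) f"
  obtains g where "\<And>x. (f has_real_derivative g x) (at x)" "differentiable_upto n g"
  using assms unfolding differentiable_upto_Suc
  by (metis DERIV_deriv_iff_field_differentiable)

lemma differentiable_upto_add:
  "differentiable_upto n f \<Longrightarrow> differentiable_upto n g \<Longrightarrow> differentiable_upto n (\<lambda>x. f x + g x)"
proof (induction n arbitrary: f g)
  case (Suc n)
  obtain f' where f: "\<And>x. (f has_real_derivative f' x) (at x)" "differentiable_upto n f'"
    using Suc.prems(1) by (rule differentiable_upto_SucE) blast
  obtain g' where g: "\<And>x. (g has_real_derivative g' x) (at x)" "differentiable_upto n g'"
    using Suc.prems(2) by (rule differentiable_upto_SucE) blast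
  show ?case
    by (rule differentiable_upto_SucI[OF DERIV_add[OF f(1) g(1)] Suc.IH[OF f(2) g(2)]])
qed (rule differentiable_upto_0)

lemma differentiable_upto_cmult: "differentiable_upto n f \<Longrightarrow> differentiable_upto n (\<lambda>x. c * f x)"
proof (induction n arbitrary: f)
  case (Suc n)
  obtain f' where f: "\<And>x. (f has_real_derivative f' x) (at x)" "differentiable_upto n f'"
    using Suc.prems(1) by (rule differentiable_upto_SucE) blast
  show ?case
    by (rule differentiable_upto_SucI[OF DERIV_cmult[OF f(1)] Suc.IH[OF f(2)]])
qed (rule differentiable_upto_0)

lemma differentiable_upto_mult:
  "differentiable_upto n f \<Longrightarrow> differentiable_upto n g \<Longrightarrow> differentiable_upto n (\<lambda>x. f x * g x)"
proof (induction n arbitrary: f g)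
  case (Suc n)
  obtain f' where f: "\<And>x. (f has_real_derivative f' x) (at x)" "differentiable_upto n f'"
    using Suc.prems(1) by (rule differentiable_upto_SucE) blast
  obtain g' where g: "\<And>x. (g has_real_derivative g' x) (at x)" "differentiable_upto n g'"
    using Suc.prems(2) by (rule differentiable_upto_SucE) blast
  note low = differentiable_upto_SucD[OF Suc.prems(1)] differentiable_upto_SucD[OF Suc.prems(2)]
  show ?case
    by (rule differentiable_upto_SucI[OF DERIV_mult[OF f(1) g(1)]])
       (intro differentiable_upto_add Suc.IH f(2) g(2) low)
qed (rule differentiable_upto_0)

lemma differentiable_upto_affine:
  "differentiable_upto n f \<Longrightarrow> differentiable_upto n (\<lambda>x. f (a * x + b))"
proof (induction n arbitrary: f)
  case (Suc n)
  obtain f' where f: "\<And>x. (f has_real_derivative f' x) (at x)" "differentiable_upto n f'"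
    using Suc.prems(1) by (rule differentiable_upto_SucE) blast
  have "((\<lambda>x. f (a * x + b)) has_real_derivative a * f' (a * x + b)) (at x)" for x
  proof -
    have "((\<lambda>x. a * x + b) has_real_derivative a) (at x)"
      by (auto intro!: derivative_eq_intros)
    from DERIV_chain2[OF f(1) this] show ?thesis by (simp add: mult.commute)
  qed
  then show ?case
    by (rule differentiable_upto_SucI) (intro differentiable_upto_cmult Suc.IH f(2))
qed (rule differentiable_upto_0)

lemma differentiable_upto_trig: "differentiable_upto n (\<lambda>x. a * cos x + b * sin x)"
proof (induction n arbitrary: a b)
  case (Suc n)
  have "((\<lambda>x. a * cos x + b * sin x) has_real_derivative b * cos x + (- a) * sin x) (at x)" for x
    by (auto intro!: derivative_eq_intros)
  then show ?case by (rule differentiable_upto_SucI) (rule Suc.IH)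
qed (rule differentiable_upto_0)

lemma smooth_mult: "smooth f \<Longrightarrow> smooth g \<Longrightarrow> smooth (\<lambda>x. f x * g x)"
  by (simp add: smooth_iff_differentiable_upto differentiable_upto_mult)

lemma smooth_affine: "smooth f \<Longrightarrow> smooth (\<lambda>x. f (a * x + b))"
  by (simp add: smooth_iff_differentiable_upto differentiable_upto_affine)

lemma smooth_shift: "smooth f \<Longrightarrow> smooth (\<lambda>x. f (x - b))"
  using smooth_affine[of f 1 "- b"] by simp

lemma smooth_cos: "smooth (\<lambda>x. cos (a * x))" and smooth_sin: "smooth (\<lambda>x. sin (a * x))"
  using differentiable_upto_trig[of _ 1 0] differentiable_upto_trig[of _ 0 1]
    differentiable_upto_affine[of _ cos a 0] differentiable_upto_affine[of _ sin a 0]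
  by (auto simp: smooth_iff_differentiable_upto)

lemma smooth_DERIV: "smooth f \<Longrightarrow> ((deriv ^^ k) f has_real_derivative (deriv ^^ Suc k) f x) (at x)"
  by (simp add: smooth_def DERIV_deriv_iff_field_differentiable)

lemma smooth_DERIV0: "smooth f \<Longrightarrow> (f has_real_derivative deriv f x) (at x)"
  using smooth_DERIV[of f 0] by simp

lemma smooth_deriv: "smooth f \<Longrightarrow> smooth (deriv f)"
  by (meson differentiable_upto_Suc smooth_iff_differentiable_upto)

lemma smooth_higher_deriv: "smooth f \<Longrightarrow> smooth ((deriv ^^ k) f)"
  by (induction k) (auto intro: smooth_deriv)

lemma smooth_if_deriv:
  assumes "\<And>x. (f has_real_derivative g x) (at x)" "smooth g"
  shows "smooth f"
  using differentiable_upto_SucI[OF assms(1)] assms(2) differentiable_upto_SucD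
  unfolding smooth_iff_differentiable_upto by blast

lemma smooth_continuous: "smooth f \<Longrightarrow> continuous_on A ((deriv ^^ k) f)"
  by (meson smooth_def continuous_at_imp_continuous_on field_differentiable_imp_continuous_at)

lemma smooth_continuous0: "smooth f \<Longrightarrow> continuous_on A f"
  using smooth_continuous[of f A 0] by simp

lemma higher_deriv_Suc_right: "(deriv ^^ Suc k) f = (deriv ^^ k) (deriv f)"
  by (simp add: funpow_Suc_right del: funpow.simps(2))

lemma higher_deriv_cmult: "smooth f \<Longrightarrow> (deriv ^^ k) (\<lambda>x. a * f x) = (\<lambda>x. a * (deriv ^^ k) f x)"
  using smooth_higher_deriv_lincomb[of f f k a 0] by simp

lemma higher_deriv_diff:
  "smooth f \<Longrightarrow> smooth g \<Longrightarrow> (deriv ^^ k) (\<lambda>x. f x - g x) = (\<lambda>x. (deriv ^^ k) f x - (deriv ^^ k) g x)"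
  using smooth_higher_deriv_lincomb[of f g k 1 "-1"] by simp

lemma higher_deriv_add:
  "smooth f \<Longrightarrow> smooth g \<Longrightarrow> (deriv ^^ k) (\<lambda>x. f x + g x) = (\<lambda>x. (deriv ^^ k) f x + (deriv ^^ k) g x)"
  using smooth_higher_deriv_lincomb[of f g k 1 1] by simp

lemma smooth_add: "smooth f \<Longrightarrow> smooth g \<Longrightarrow> smooth (\<lambda>x. f x + g x)"
  using smooth_lincomb[of f g 1 1] by simp

lemma smooth_diff: "smooth f \<Longrightarrow> smooth g \<Longrightarrow> smooth (\<lambda>x. f x - g x)"
  using smooth_lincomb[of f g 1 "-1"] by simp

lemma smooth_cmult: "smooth f \<Longrightarrow> smooth (\<lambda>x. a * f x)"
  using smooth_lincomb[of f f a 0] by simp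

lemma smooth_zero: "smooth (\<lambda>x. 0)"
  by (simp add: smooth_def higher_deriv_zero)

lemma smooth_sum: "(\<And>i. i \<in> I \<Longrightarrow> smooth (f i)) \<Longrightarrow> smooth (\<lambda>x. \<Sum>i\<in>I. f i x)"
  by (induction I rule: infinite_finite_induct) (auto intro: smooth_zero smooth_add)

lemma higher_deriv_sum:
  "(\<And>i. i \<in> I \<Longrightarrow> smooth (f i)) \<Longrightarrow>
     (deriv ^^ k) (\<lambda>x. \<Sum>i\<in>I. f i x) = (\<lambda>x. \<Sum>i\<in>I. (deriv ^^ k) (f i) x)"
  by (induction I rule: infinite_finite_induct)
     (auto simp: higher_deriv_zero higher_deriv_add smooth_sum)

lemma higher_deriv_shift:
  assumes "smooth f"
  shows "(deriv ^^ k) (\<lambda>x. f (x - b)) = (\<lambda>x. (deriv ^^ k) f (x - b))"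
proof (induction k)
  case (Suc k)
  have "((\<lambda>x. (deriv ^^ k) f (x - b)) has_real_derivative (deriv ^^ Suc k) f (x - b)) (at x)" for x
  proof -
    have "((\<lambda>x. x - b) has_real_derivative 1) (at x)"
      by (auto intro!: derivative_eq_intros)
    from DERIV_chain2[OF smooth_DERIV[OF assms, of k] this] show ?thesis
      by (simp del: funpow.simps(2))
  qed
  then show ?case
    by (auto simp: Suc.IH intro!: ext DERIV_imp_deriv)
qed simp

text \<open>A substitute for the Leibniz formula: every differentiation doubles the number of terms, each of
  which is a product of one derivative of each factor.\<close>

lemma higher_deriv_mult_bound:
  assumes "smooth f" "smooth g"
    and "\<And>i. i \<le> m \<Longrightarrow> \<bar>(deriv ^^ i) f x\<bar> \<le> A" "\<And>i. i \<le> m \<Longrightarrow> \<bar>(deriv ^^ i) g x\<bar> \<le> B"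
  shows "\<bar>(deriv ^^ m) (\<lambda>x. f x * g x) x\<bar> \<le> 2 ^ m * (A * B)"
  using assms
proof (induction m arbitrary: f g)
  case 0
  then have "\<bar>f x\<bar> * \<bar>g x\<bar> \<le> A * B"
    using 0(3)[of 0] 0(4)[of 0] by (intro mult_mono) auto
  then show ?case by (simp add: abs_mult)
next
  case (Suc m)
  note f = Suc.prems(1) and g = Suc.prems(2)
  have "deriv (\<lambda>x. f x * g x) = (\<lambda>x. deriv f x * g x + f x * deriv g x)"
    using DERIV_mult[OF smooth_DERIV0[OF f] smooth_DERIV0[OF g]]
    by (intro ext DERIV_imp_deriv) (simp add: mult.commute)
  then have "(deriv ^^ Suc m) (\<lambda>x. f x * g x) x =
      (deriv ^^ m) (\<lambda>x. deriv f x * g x) x + (deriv ^^ m) (\<lambda>x. f x * deriv g x) x"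
    unfolding higher_deriv_Suc_right
    by (simp add: higher_deriv_add smooth_mult smooth_deriv f g)
  moreover have "\<bar>(deriv ^^ m) (\<lambda>x. deriv f x * g x) x\<bar> \<le> 2 ^ m * (A * B)"
    using Suc.prems(3)[of "Suc _"] Suc.prems(4)
    by (intro Suc.IH smooth_deriv f g) (simp_all add: higher_deriv_Suc_right[symmetric] del: funpow.simps(2))
  moreover have "\<bar>(deriv ^^ m) (\<lambda>x. f x * deriv g x) x\<bar> \<le> 2 ^ m * (A * B)"
    using Suc.prems(3) Suc.prems(4)[of "Suc _"]
    by (intro Suc.IH smooth_deriv f g) (simp_all add: higher_deriv_Suc_right[symmetric] del: funpow.simps(2))
  ultimately show ?case by (simp del: funpow.simps(2))
qed

lemma higher_deriv_zero_outside:
  assumes "closed K" "\<And>x. x \<notin> K \<Longrightarrow> f x = 0" "x \<notin> K"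
  shows "(deriv ^^ k) f x = (0::real)"
  using assms(3)
proof (induction k arbitrary: x)
  case (Suc k)
  have "eventually (\<lambda>y. y \<in> - K) (nhds x)"
    using assms(1) Suc.prems by (intro eventually_nhds_in_open) auto
  then have "eventually (\<lambda>y. (deriv ^^ k) f y = 0) (nhds x)"
    by eventually_elim (use Suc.IH in auto)
  then have "deriv ((deriv ^^ k) f) x = deriv (\<lambda>x. 0) x"
    by (intro deriv_cong_ev) auto
  then show ?case by simp
qed (use assms(2) in auto)

lemma test_functionsI:
  assumes "smooth f" "\<And>x. x \<notin> {a..b} \<Longrightarrow> f x = 0"
  shows "f \<in> test_functions"
proof -
  have "{x. f x \<noteq> 0} \<subseteq> {a..b}" using assms(2) by blast
  then have "closure {x. f x \<noteq> 0} \<subseteq> {a..b}"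
    by (rule closure_minimal) simp
  then have "compact (closure {x. f x \<noteq> 0})"
    by (metis compact_Icc closed_closure compact_Int_closed inf.absorb2)
  then show ?thesis using assms(1) by (simp add: test_functions_def)
qed

lemma test_functions_onI:
  assumes "smooth f" "\<And>x. x \<notin> {a..b} \<Longrightarrow> f x = 0"
  shows "f \<in> test_functions_on {a..b}"
proof -
  have "{x. f x \<noteq> 0} \<subseteq> {a..b}" using assms(2) by blast
  then show ?thesis
    using test_functionsI[OF assms(1), of a b] assms(2) by (simp only: test_functions_on_def) blast
qed

lemma test_functionsE:
  assumes "f \<in> test_functions"
  obtains c where "c > 0" "\<And>x. x \<notin> {-c..c} \<Longrightarrow> f x = 0"
proof -
  have "bounded (closure {x. f x \<noteq> 0})"
    using assms by (auto simp: test_functions_def compact_imp_bounded)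
  then obtain c where c: "c > 0" "\<forall>x\<in>closure {x. f x \<noteq> 0}. norm x \<le> c"
    using bounded_pos by blast
  have "f x = 0" if "x \<notin> {-c..c}" for x
    using c(2) closure_subset[of "{x. f x \<noteq> 0}"] that by force
  then show ?thesis using c(1) that by blast
qed

lemma test_smooth: "f \<in> test_functions \<Longrightarrow> smooth f"
  by (simp add: test_functions_def)

lemma test_functions_zero: "(\<lambda>x. 0) \<in> test_functions"
  by (rule test_functionsI[of _ 0 0]) (auto intro: smooth_zero)

lemma test_functions_cmult: "f \<in> test_functions \<Longrightarrow> (\<lambda>x. a * f x) \<in> test_functions"
  using test_functions_lincomb[of f f a 0] by simp

lemma test_functions_add:
  "f \<in> test_functions \<Longrightarrow> g \<in> test_functions \<Longrightarrow> (\<lambda>x. f x + g x) \<in> test_functions"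
  using test_functions_lincomb[of f g 1 1] by simp

lemma test_functions_diff:
  "f \<in> test_functions \<Longrightarrow> g \<in> test_functions \<Longrightarrow> (\<lambda>x. f x - g x) \<in> test_functions"
  using test_functions_lincomb[of f g 1 "-1"] by simp

lemma test_functions_sum:
  "(\<And>i. i \<in> I \<Longrightarrow> f i \<in> test_functions) \<Longrightarrow> (\<lambda>x. \<Sum>i\<in>I. f i x) \<in> test_functions"
  by (induction I rule: infinite_finite_induct) (auto intro: test_functions_zero test_functions_add)

lemma test_functions_shift:
  assumes "f \<in> test_functions"
  shows "(\<lambda>x. f (x - b)) \<in> test_functions"
proof -
  obtain c where c: "c > 0" "\<And>x. x \<notin> {-c..c} \<Longrightarrow> f x = 0"
    using assms by (rule test_functionsE) blast
  show ?thesis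
    by (rule test_functionsI[of _ "b - c" "b + c"]) (use c(2) smooth_shift[OF test_smooth[OF assms]] in auto)
qed

lemma test_functions_mult:
  assumes "f \<in> test_functions" "smooth g"
  shows "(\<lambda>x. g x * f x) \<in> test_functions"
proof -
  obtain c where c: "c > 0" "\<And>x. x \<notin> {-c..c} \<Longrightarrow> f x = 0"
    using assms(1) by (rule test_functionsE) blast
  show ?thesis
    by (rule test_functionsI[of _ "- c" "c"]) (use c(2) smooth_mult[OF assms(2) test_smooth[OF assms(1)]] in auto)
qed

lemma test_higher_deriv_bounded:
  assumes "f \<in> test_functions"
  obtains B where "B > 0" "\<And>x. \<bar>(deriv ^^ k) f x\<bar> \<le> B"
proof -
  obtain c where c: "c > 0" "\<And>x. x \<notin> {-c..c} \<Longrightarrow> f x = 0"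
    using assms by (rule test_functionsE) blast
  have "compact ((deriv ^^ k) f ` {-c..c})"
    by (intro compact_continuous_image smooth_continuous test_smooth assms compact_Icc)
  then obtain B where B: "B > 0" "\<forall>y\<in>(deriv ^^ k) f ` {-c..c}. norm y \<le> B"
    using compact_imp_bounded bounded_pos by meson
  have "\<bar>(deriv ^^ k) f x\<bar> \<le> B" for x
  proof (cases "x \<in> {-c..c}")
    case False
    then show ?thesis using higher_deriv_zero_outside[of "{-c..c}" f x k] c(2) B(1) by auto
  qed (use B(2) in auto)
  then show ?thesis using B(1) that by blast
qed

lemma test_higher_deriv_bounded_upto:
  assumes "f \<in> test_functions"
  obtains B where "B > 0" "\<And>i x. i \<le> k \<Longrightarrow> \<bar>(deriv ^^ i) f x\<bar> \<le> B"
proof -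
  have "\<forall>i. \<exists>B>0. \<forall>x. \<bar>(deriv ^^ i) f x\<bar> \<le> B"
    using test_higher_deriv_bounded[OF assms] by metis
  then obtain B where B: "\<And>i. B i > 0" "\<And>i x. \<bar>(deriv ^^ i) f x\<bar> \<le> B i" by metis
  have "\<bar>(deriv ^^ i) f x\<bar> \<le> (\<Sum>j\<le>k. B j)" if "i \<le> k" for i x
  proof -
    have "B i \<le> (\<Sum>j\<le>k. B j)"
      using that B(1) by (intro member_le_sum) (auto intro: less_imp_le)
    then show ?thesis using B(2)[of i x] by linarith
  qed
  moreover have "(\<Sum>j\<le>k. B j) > 0" by (intro sum_pos) (auto simp: B)
  ultimately show ?thesis using that by blast
qed

lemma schwartz_weight_nonneg: "0 \<le> schwartz_weight \<alpha> x"
  by (simp add: schwartz_weight_def)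

lemma schwartz_weight_le:
  assumes "\<alpha> \<ge> 0" "\<bar>x\<bar> \<le> c" "1 \<le> c" shows "schwartz_weight \<alpha> x \<le> c powr \<alpha>"
  using assms by (auto simp: schwartz_weight_def powr_mono2)

text \<open>On the support the weight is at most the power of the radius; off the support all derivatives
  vanish.\<close>

lemma test_function_weighted_bound:
  assumes "f \<in> test_functions" "\<alpha> \<ge> 0" "\<And>x. x \<notin> {-c..c} \<Longrightarrow> f x = 0" "1 \<le> c"
    and "\<And>x. \<bar>(deriv ^^ \<beta>) f x\<bar> \<le> B"
  shows "schwartz_weight \<alpha> x * \<bar>(deriv ^^ \<beta>) f x\<bar> \<le> c powr \<alpha> * B"
proof (cases "x \<in> {-c..c}")
  case True
  then show ?thesis using assms by (intro mult_mono schwartz_weight_le) auto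
next
  case False
  have "0 \<le> B" using assms(5)[of 0] by linarith
  then show ?thesis using higher_deriv_zero_outside[of "{-c..c}" f x] assms(3) False by simp
qed

lemma test_functions_subset_schwartz: "test_functions \<subseteq> schwartz_functions"
proof
  fix f assume f: "f \<in> test_functions"
  obtain c where c: "c > 0" "\<And>x. x \<notin> {-c..c} \<Longrightarrow> f x = 0"
    using f by (rule test_functionsE) blast
  have "bdd_above (range (\<lambda>x. schwartz_weight \<alpha> x * \<bar>(deriv ^^ \<beta>) f x\<bar>))" if "\<alpha> \<ge> 0" for \<alpha> \<beta>
  proof -
    obtain B where B: "\<And>x. \<bar>(deriv ^^ \<beta>) f x\<bar> \<le> B"
      using test_higher_deriv_bounded[OF f] by metis
    have "schwartz_weight \<alpha> x * \<bar>(deriv ^^ \<beta>) f x\<bar> \<le> (max c 1) powr \<alpha> * B" for x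
      by (rule test_function_weighted_bound[OF f that _ _ B]) (auto intro!: c(2))
    then show ?thesis by (intro bdd_aboveI) auto
  qed
  then show "f \<in> schwartz_functions"
    using f by (auto simp: schwartz_functions_def test_smooth)
qed

lemma schwartz_smooth: "f \<in> schwartz_functions \<Longrightarrow> smooth f"
  by (simp add: schwartz_functions_def)

lemma schwartz_bdd:
  "f \<in> schwartz_functions \<Longrightarrow> \<alpha> \<ge> 0 \<Longrightarrow>
     bdd_above (range (\<lambda>x. schwartz_weight \<alpha> x * \<bar>(deriv ^^ \<beta>) f x\<bar>))"
  by (simp add: schwartz_functions_def)

lemma schwartz_seminorm_upper:
  "f \<in> schwartz_functions \<Longrightarrow> \<alpha> \<ge> 0 \<Longrightarrow>
     schwartz_weight \<alpha> x * \<bar>(deriv ^^ \<beta>) f x\<bar> \<le> schwartz_seminorm \<alpha> \<beta> f"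
  unfolding schwartz_seminorm_def by (intro cSUP_upper schwartz_bdd) auto

lemma schwartz_seminorm_le:
  "(\<And>x. schwartz_weight \<alpha> x * \<bar>(deriv ^^ \<beta>) f x\<bar> \<le> B) \<Longrightarrow> schwartz_seminorm \<alpha> \<beta> f \<le> B"
  unfolding schwartz_seminorm_def by (intro cSUP_least) auto

lemma schwartz_seminorm_nonneg:
  assumes "f \<in> schwartz_functions" "\<alpha> \<ge> 0" shows "0 \<le> schwartz_seminorm \<alpha> \<beta> f"
  using schwartz_seminorm_upper[OF assms, of 0 \<beta>] schwartz_weight_nonneg[of \<alpha> 0]
  by (meson abs_ge_zero order_trans zero_le_mult_iff)

lemma weighted_deriv_lincomb_le:
  assumes "f \<in> schwartz_functions" "g \<in> schwartz_functions" "\<alpha> \<ge> 0"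
  shows "schwartz_weight \<alpha> x * \<bar>(deriv ^^ \<beta>) (\<lambda>x. a * f x + b * g x) x\<bar> \<le>
    \<bar>a\<bar> * schwartz_seminorm \<alpha> \<beta> f + \<bar>b\<bar> * schwartz_seminorm \<alpha> \<beta> g"
proof -
  have "schwartz_weight \<alpha> x * \<bar>(deriv ^^ \<beta>) (\<lambda>x. a * f x + b * g x) x\<bar> \<le>
    schwartz_weight \<alpha> x * (\<bar>a\<bar> * \<bar>(deriv ^^ \<beta>) f x\<bar> + \<bar>b\<bar> * \<bar>(deriv ^^ \<beta>) g x\<bar>)"
    using assms by (intro mult_left_mono schwartz_weight_nonneg)
      (auto simp: smooth_higher_deriv_lincomb schwartz_smooth simp flip: abs_mult)
  also have "\<dots> = \<bar>a\<bar> * (schwartz_weight \<alpha> x * \<bar>(deriv ^^ \<beta>) f x\<bar>) + \<bar>b\<bar> * (schwartz_weight \<alpha> x * \<bar>(deriv ^^ \<beta>) g x\<bar>)"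
    by (simp add: algebra_simps)
  also have "\<dots> \<le> \<bar>a\<bar> * schwartz_seminorm \<alpha> \<beta> f + \<bar>b\<bar> * schwartz_seminorm \<alpha> \<beta> g"
    by (intro add_mono mult_left_mono schwartz_seminorm_upper assms) auto
  finally show ?thesis .
qed

lemma schwartz_functions_lincomb:
  assumes "f \<in> schwartz_functions" "g \<in> schwartz_functions"
  shows "(\<lambda>x. a * f x + b * g x) \<in> schwartz_functions"
  using weighted_deriv_lincomb_le[OF assms] assms
  by (auto simp: schwartz_functions_def smooth_lincomb intro!: bdd_aboveI2)

lemma schwartz_seminorm_lincomb:
  assumes "f \<in> schwartz_functions" "g \<in> schwartz_functions" "\<alpha> \<ge> 0"
  shows "schwartz_seminorm \<alpha> \<beta> (\<lambda>x. a * f x + b * g x) \<le>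
    \<bar>a\<bar> * schwartz_seminorm \<alpha> \<beta> f + \<bar>b\<bar> * schwartz_seminorm \<alpha> \<beta> g"
  by (intro schwartz_seminorm_le weighted_deriv_lincomb_le assms)

lemma schwartz_functions_diff:
  "f \<in> schwartz_functions \<Longrightarrow> g \<in> schwartz_functions \<Longrightarrow> (\<lambda>x. f x - g x) \<in> schwartz_functions"
  using schwartz_functions_lincomb[of f g 1 "-1"] by simp

lemma schwartz_seminorm_triangle:
  assumes "f \<in> schwartz_functions" "g \<in> schwartz_functions" "h \<in> schwartz_functions" "\<alpha> \<ge> 0"
  shows "schwartz_seminorm \<alpha> \<beta> (\<lambda>x. f x - h x) \<le>
    schwartz_seminorm \<alpha> \<beta> (\<lambda>x. f x - g x) + schwartz_seminorm \<alpha> \<beta> (\<lambda>x. g x - h x)"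
  using schwartz_seminorm_lincomb[OF schwartz_functions_diff[OF assms(1,2)]
    schwartz_functions_diff[OF assms(2,3)] assms(4), of \<beta> 1 1] by simp

subsection \<open>A bump function and a partition of unity\<close>

text \<open>The functions \<open>exp (- 1 / x) / x ^ m\<close>, extended by 0: the derivative of each of them is a linear
  combination of two others, so that smoothness of the whole family follows by one induction.\<close>

definition flat_exp :: "nat \<Rightarrow> real \<Rightarrow> real" where
  "flat_exp m x = (if x > 0 then exp (- (1 / x)) / x ^ m else 0)"

lemma flat_exp_DERIV:
  "(flat_exp m has_real_derivative (- real m * flat_exp (m + 1) x + flat_exp (m + 2) x)) (at x)"
proof -
  consider "x > 0" | "x < 0" | "x = 0" by linarith
  then show ?thesis
  proof cases
    case 1
    have "((\<lambda>x. exp (- (1 / x)) / x ^ m) has_real_derivative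
        (- real m * flat_exp (m + 1) x + flat_exp (m + 2) x)) (at x)"
    proof (rule DERIV_cong)
      show "((\<lambda>x. exp (- (1 / x)) / x ^ m) has_real_derivative
          (exp (- (1 / x)) * (1 / x\<^sup>2) * x ^ m - exp (- (1 / x)) * (real m * x ^ (m - 1))) / (x ^ m * x ^ m)) (at x)"
        by (rule derivative_eq_intros refl | use 1 in \<open>simp add: power2_eq_square\<close>)+
      have "real m * x ^ (m - 1) = real m * x ^ m / x" using 1 by (cases m) auto
      moreover have "(E * (1 / x\<^sup>2) * y - E * (real m * y / x)) / (y * y)
          = - real m * (E / (x * y)) + E / (x * (x * y))" if "y > 0" for E y :: real
        using 1 that by (simp add: field_simps power2_eq_square)
      ultimately show "(exp (- (1 / x)) * (1 / x\<^sup>2) * x ^ m - exp (- (1 / x)) * (real m * x ^ (m - 1))) / (x ^ m * x ^ m)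
          = - real m * flat_exp (m + 1) x + flat_exp (m + 2) x"
        using 1 by (simp add: flat_exp_def)
    qed
    moreover have "eventually (\<lambda>y. y \<in> {0<..}) (nhds x)"
      using 1 by (intro eventually_nhds_in_open) auto
    then have "eventually (\<lambda>y. flat_exp m y = exp (- (1 / y)) / y ^ m) (nhds x)"
      by eventually_elim (auto simp: flat_exp_def)
    ultimately show ?thesis by (subst DERIV_cong_ev) auto
  next
    case 2
    have "eventually (\<lambda>y. y \<in> {..<0}) (nhds x)"
      using 2 by (intro eventually_nhds_in_open) auto
    then have "eventually (\<lambda>y. flat_exp m y = 0) (nhds x)"
      by eventually_elim (auto simp: flat_exp_def)
    then have "(flat_exp m has_real_derivative 0) (at x)"
      by (subst DERIV_cong_ev[OF refl]) auto
    then show ?thesis using 2 by (simp add: flat_exp_def)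
  next
    case 3
    have *: "((\<lambda>y. flat_exp m y / y) \<longlongrightarrow> 0) (at_right 0)"
    proof (rule Lim_transform_eventually)
      show "((\<lambda>y. (inverse y) ^ (Suc m) / exp (inverse y)) \<longlongrightarrow> 0) (at_right (0::real))"
        by (rule filterlim_compose[OF tendsto_power_div_exp_0 filterlim_inverse_at_top_right])
      show "\<forall>\<^sub>F y in at_right 0. inverse y ^ Suc m / exp (inverse y) = flat_exp m y / y"
        using eventually_at_right_less[of "0::real"]
        by eventually_elim (auto simp: flat_exp_def field_simps exp_minus power_inverse inverse_eq_divide)
    qed
    have "((\<lambda>y. flat_exp m y / y) \<longlongrightarrow> 0) (at_left 0)"
      by (rule Lim_transform_eventually[OF tendsto_const])
         (auto simp: flat_exp_def eventually_at_filter)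
    with * have "((\<lambda>y. flat_exp m y / y) \<longlongrightarrow> 0) (at 0)"
      by (simp add: filterlim_split_at)
    then show ?thesis using 3 by (simp add: has_field_derivative_iff flat_exp_def)
  qed
qed

lemma smooth_flat_exp: "smooth (flat_exp m)"
proof -
  have "differentiable_upto n (flat_exp m)" for n
  proof (induction n arbitrary: m)
    case (Suc n)
    show ?case
      by (rule differentiable_upto_SucI[OF flat_exp_DERIV])
         (intro differentiable_upto_add differentiable_upto_cmult Suc.IH)
  qed (rule differentiable_upto_0)
  then show ?thesis by (simp add: smooth_iff_differentiable_upto)
qed

definition bump :: "real \<Rightarrow> real" where
  "bump x = flat_exp 0 x * flat_exp 0 (1 - x)"

lemma bump_smooth: "smooth bump"
  using smooth_mult[OF smooth_flat_exp[of 0] smooth_affine[OF smooth_flat_exp[of 0], of "-1" 1]]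
  by (simp add: bump_def[abs_def])

lemma bump_zero: "x \<notin> {0<..<1} \<Longrightarrow> bump x = 0"
  by (auto simp: bump_def flat_exp_def)

lemma bump_pos: "x \<in> {0<..<1} \<Longrightarrow> bump x > 0"
  by (auto simp: bump_def flat_exp_def)

lemma bump_nonneg: "bump x \<ge> 0"
  by (auto simp: bump_def flat_exp_def)

lemma bump_test: "bump \<in> test_functions"
  by (rule test_functionsI[of _ 0 1]) (auto intro: bump_smooth bump_zero)

text \<open>The primitive of the normalised bump: a smooth step from 0 to 1.\<close>

lemma smooth_step_exists:
  obtains F :: "real \<Rightarrow> real" where "smooth F" "\<And>x. x \<le> 0 \<Longrightarrow> F x = 0" "\<And>x. 1 \<le> x \<Longrightarrow> F x = 1"
    "\<And>x. 0 \<le> F x" "\<And>x. F x \<le> 1"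
proof -
  have "\<exists>G. \<forall>x. (G has_real_derivative bump x) (at x)"
  proof -
    show ?thesis
      using einterval_antiderivative[of "-\<infinity>" "\<infinity>" bump]
        continuous_on_eq_continuous_at[of UNIV bump] smooth_continuous0[OF bump_smooth]
      by (auto simp: has_real_derivative_iff_has_vector_derivative)
  qed
  then obtain G where G: "\<And>x. (G has_real_derivative bump x) (at x)" by blast
  have mono: "G x \<le> G y" if "x \<le> y" for x y
    using DERIV_nonneg_imp_nondecreasing[OF that] G bump_nonneg by blast
  have left: "G x = G 0" if "x \<le> 0" for x
  proof (cases "x = 0")
    case False
    then have "x < 0" using that by simp
    from MVT2[OF this, of G bump] G obtain z where "z < 0" "x < z" "G 0 - G x = (0 - x) * bump z"
      by blast
    then show ?thesis by (simp add: bump_zero)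
  qed simp
  have right: "G x = G 1" if "1 \<le> x" for x
  proof (cases "x = 1")
    case False
    then have "1 < x" using that by simp
    from MVT2[OF this, of G bump] G obtain z where "z > 1" "G x - G 1 = (x - 1) * bump z"
      by blast
    then show ?thesis by (simp add: bump_zero)
  qed simp
  from MVT2[of 0 1 G bump] G obtain z where "0 < z" "z < 1" "G 1 - G 0 = (1 - 0) * bump z"
    using zero_less_one by blast
  then have pos: "G 1 - G 0 > 0" using bump_pos[of z] by simp
  define F where "F x = inverse (G 1 - G 0) * (G x - G 0)" for x
  have "smooth F"
  proof (rule smooth_if_deriv)
    show "(F has_real_derivative inverse (G 1 - G 0) * bump x) (at x)" for x
      unfolding F_def using DERIV_cmult[OF DERIV_diff[OF G DERIV_const[of "G 0"]], of "inverse (G 1 - G 0)" x]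
      by simp
    show "smooth (\<lambda>x. inverse (G 1 - G 0) * bump x)" by (intro smooth_cmult bump_smooth)
  qed
  moreover have "0 \<le> F x" "F x \<le> 1" for x
  proof -
    have "G 0 \<le> G x" using mono[of 0 x] left[of x] by (cases "x \<le> 0") auto
    then show "0 \<le> F x" using pos by (simp add: F_def)
    have "G x \<le> G 1" using mono[of x 1] right[of x] by (cases "x \<le> 1") auto
    then show "F x \<le> 1" using pos by (simp add: F_def field_simps)
  qed
  moreover have "F x = 0" if "x \<le> 0" for x using left[OF that] by (simp add: F_def)
  moreover have "F x = 1" if "1 \<le> x" for x using right[OF that] pos by (simp add: F_def)
  ultimately show ?thesis using that by blast
qed

definition smooth_step :: "real \<Rightarrow> real" where
  "smooth_step = (SOME F. smooth F \<and> (\<forall>x\<le>0. F x = 0) \<and> (\<forall>x\<ge>1. F x = 1) \<and> (\<forall>x. 0 \<le> F x \<and> F x \<le> 1))"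

lemma smooth_step:
  shows smooth_smooth_step: "smooth smooth_step"
    and smooth_step_left: "x \<le> 0 \<Longrightarrow> smooth_step x = 0"
    and smooth_step_right: "1 \<le> x \<Longrightarrow> smooth_step x = 1"
    and smooth_step_range: "0 \<le> smooth_step x" "smooth_step x \<le> 1"
proof -
  have "\<exists>F. smooth F \<and> (\<forall>x\<le>0. F x = 0) \<and> (\<forall>x\<ge>1. F x = 1) \<and> (\<forall>x. 0 \<le> F x \<and> F x \<le> 1)"
    by (rule smooth_step_exists) blast
  from someI_ex[OF this, folded smooth_step_def]
  show "smooth smooth_step" "x \<le> 0 \<Longrightarrow> smooth_step x = 0" "1 \<le> x \<Longrightarrow> smooth_step x = 1"
     "0 \<le> smooth_step x" "smooth_step x \<le> 1" by auto
qed

text \<open>The differences of consecutive translates of the step telescope to 1. The plateau is 1 on the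
  support of the corresponding member of the partition, so multiplying a function supported there by
  the plateau does not change it.\<close>

definition unit_partition :: "int \<Rightarrow> real \<Rightarrow> real" where
  "unit_partition n x = smooth_step (x - n) - smooth_step (x - n - 1)"

definition plateau :: "int \<Rightarrow> real \<Rightarrow> real" where
  "plateau n x = smooth_step (x - n + 1) - smooth_step (x - n - 2)"

lemma unit_partition_zero: "x \<notin> {of_int n..of_int n + 2} \<Longrightarrow> unit_partition n x = 0"
  using smooth_step_left[of "x - n"] smooth_step_left[of "x - n - 1"]
    smooth_step_right[of "x - n"] smooth_step_right[of "x - n - 1"]
  by (auto simp: unit_partition_def)

lemma plateau_zero: "x \<notin> {of_int n - 1..of_int n + 3} \<Longrightarrow> plateau n x = 0"
  using smooth_step_left[of "x - n + 1"] smooth_step_left[of "x - n - 2"]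
    smooth_step_right[of "x - n + 1"] smooth_step_right[of "x - n - 2"]
  by (auto simp: plateau_def)

lemma plateau_one: "x \<in> {of_int n..of_int n + 2} \<Longrightarrow> plateau n x = 1"
  using smooth_step_left[of "x - n - 2"] smooth_step_right[of "x - n + 1"]
  by (auto simp: plateau_def)

lemma plateau_abs_le: "\<bar>plateau n x\<bar> \<le> 1"
  using smooth_step_range[of "x - n + 1"] smooth_step_range[of "x - n - 2"] by (auto simp: plateau_def)

lemma unit_partition_test: "unit_partition n \<in> test_functions"
proof (rule test_functionsI)
  have "smooth (\<lambda>x. smooth_step (x - n) - smooth_step (x - (n + 1)))"
    by (intro smooth_diff smooth_shift smooth_smooth_step)
  then show "smooth (unit_partition n)" by (simp add: unit_partition_def[abs_def] algebra_simps)
qed (rule unit_partition_zero)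

lemma plateau_test: "plateau n \<in> test_functions"
proof (rule test_functionsI)
  have "smooth (\<lambda>x. smooth_step (x - (n - 1)) - smooth_step (x - (n + 2)))"
    by (intro smooth_diff smooth_shift smooth_smooth_step)
  then show "smooth (plateau n)" by (simp add: plateau_def[abs_def] algebra_simps)
qed (rule plateau_zero)

lemma unit_partition_shift: "unit_partition n = (\<lambda>x. unit_partition 0 (x - n))"
  by (simp add: unit_partition_def fun_eq_iff)

lemma unit_partition_sum:
  assumes "\<bar>x\<bar> + 1 \<le> real N"
  shows "(\<Sum>k<N. unit_partition (int k) x + unit_partition (- 1 - int k) x) = 1"
proof -
  have "(\<Sum>k<N. unit_partition (int k) x + unit_partition (- 1 - int k) x)
      = smooth_step (x + real N) - smooth_step (x - real N)"
    by (induction N) (simp_all add: unit_partition_def algebra_simps)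
  also have "\<dots> = 1"
    using assms smooth_step_right[of "x + N"] smooth_step_left[of "x - N"] by (simp add: abs_le_iff)
  finally show ?thesis .
qed

section \<open>Topologies generated by seminorms\<close>

text \<open>Balls are translates of \<open>{\<psi>. p \<psi> < r}\<close>, so the triangle inequality is needed for differences only.\<close>

definition seminorms_on :: "(real \<Rightarrow> real) set \<Rightarrow> ((real \<Rightarrow> real) \<Rightarrow> real) set \<Rightarrow> bool" where
  "seminorms_on V P \<longleftrightarrow> P \<noteq> {} \<and> (\<forall>p\<in>P. p (\<lambda>x. 0) = 0 \<and> (\<forall>f\<in>V. \<forall>g\<in>V. \<forall>h\<in>V.
     p (\<lambda>x. f x - h x) \<le> p (\<lambda>x. f x - g x) + p (\<lambda>x. g x - h x)))"

lemma topspace_seminorms_on: "seminorms_on V P \<Longrightarrow> topspace (seminorm_topology V P) = V"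
  by (rule topspace_seminorm_topology) (auto simp: seminorms_on_def)

lemma openin_seminorm_ball:
  assumes P: "seminorms_on V P" and F: "finite F" "F \<subseteq> P" and "r > 0" "\<phi> \<in> V"
  shows "openin (seminorm_topology V P) {\<psi>\<in>V. \<forall>p\<in>F. p (\<lambda>x. \<psi> x - \<phi> x) < r}"
proof (cases "F = {}")
  case True
  then show ?thesis
    using openin_topspace[of "seminorm_topology V P"] by (simp add: topspace_seminorms_on[OF P])
next
  case False
  have "openin (seminorm_topology V P) {\<psi> \<in> V. p (\<lambda>x. \<psi> x - \<phi> x) < r}" if "p \<in> P" for p
    unfolding seminorm_topology_def
    by (rule topology_generated_by_Basis) (use assms(4,5) that in blast)
  then have "openin (seminorm_topology V P) (\<Inter>p\<in>F. {\<psi> \<in> V. p (\<lambda>x. \<psi> x - \<phi> x) < r})"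
    using F False by (intro openin_Inter) auto
  also have "(\<Inter>p\<in>F. {\<psi> \<in> V. p (\<lambda>x. \<psi> x - \<phi> x) < r}) = {\<psi>\<in>V. \<forall>p\<in>F. p (\<lambda>x. \<psi> x - \<phi> x) < r}"
    using False by auto
  finally show ?thesis .
qed

text \<open>The balls are only a subbase, and intersecting them brings in finitely many seminorms at once.
  Balls around other centres contain balls around each of their points by the triangle inequality.\<close>

lemma openin_seminorm_topology:
  assumes P: "seminorms_on V P"
  shows "openin (seminorm_topology V P) U \<longleftrightarrow> U \<subseteq> V \<and>
    (\<forall>\<phi>\<in>U. \<exists>F r. finite F \<and> F \<subseteq> P \<and> r > 0 \<and> {\<psi>\<in>V. \<forall>p\<in>F. p (\<lambda>x. \<psi> x - \<phi> x) < r} \<subseteq> U)"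
    (is "?open U \<longleftrightarrow> ?char U")
proof -
  have tri: "p (\<lambda>x. f x - h x) \<le> p (\<lambda>x. f x - g x) + p (\<lambda>x. g x - h x)"
    if "p \<in> P" "f \<in> V" "g \<in> V" "h \<in> V" for p f g h
    using P that by (simp add: seminorms_on_def)
  have zero: "p (\<lambda>x. 0) = 0" if "p \<in> P" for p
    using P that by (simp add: seminorms_on_def)
  define N where "N \<phi> U \<longleftrightarrow>
    (\<exists>F r. finite F \<and> F \<subseteq> P \<and> r > 0 \<and> {\<psi>\<in>V. \<forall>p\<in>F. p (\<lambda>x. \<psi> x - \<phi> x) < r} \<subseteq> U)" for \<phi> U
  have NE: thesis if "N \<phi> U"
    "\<And>F r. finite F \<Longrightarrow> F \<subseteq> P \<Longrightarrow> r > 0 \<Longrightarrow> {\<psi>\<in>V. \<forall>p\<in>F. p (\<lambda>x. \<psi> x - \<phi> x) < r} \<subseteq> U \<Longrightarrow> thesis"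
    for \<phi> U thesis
    using that(1) unfolding N_def by (elim exE conjE) (rule that(2))
  have NI: "N \<phi> U" if "finite F" "F \<subseteq> P" "r > 0" "{\<psi>\<in>V. \<forall>p\<in>F. p (\<lambda>x. \<psi> x - \<phi> x) < r} \<subseteq> U" for \<phi> U F r
    unfolding N_def using that by (intro exI[of _ F] exI[of _ r] conjI)
  have "?open U \<longleftrightarrow> U \<subseteq> V \<and> (\<forall>\<phi>\<in>U. N \<phi> U)"
  proof
    assume "?open U"
    then have "generate_topology_on {{\<psi> \<in> V. p (\<lambda>x. \<psi> x - \<phi> x) < r} | p \<phi> r. p \<in> P \<and> \<phi> \<in> V \<and> 0 < r} U"
      by (simp add: seminorm_topology_def openin_topology_generated_by_iff)
    then show "U \<subseteq> V \<and> (\<forall>\<phi>\<in>U. N \<phi> U)"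
    proof induction
      case (Int A B)
      have "N \<phi> (A \<inter> B)" if NA: "N \<phi> A" and NB: "N \<phi> B" for \<phi>
      proof -
        obtain F r where F: "finite F" "F \<subseteq> P" "r > 0" "{\<psi>\<in>V. \<forall>p\<in>F. p (\<lambda>x. \<psi> x - \<phi> x) < r} \<subseteq> A"
          using NA by (rule NE)
        obtain G s where G: "finite G" "G \<subseteq> P" "s > 0" "{\<psi>\<in>V. \<forall>p\<in>G. p (\<lambda>x. \<psi> x - \<phi> x) < s} \<subseteq> B"
          using NB by (rule NE)
        have "{\<psi>\<in>V. \<forall>p\<in>F \<union> G. p (\<lambda>x. \<psi> x - \<phi> x) < min r s} \<subseteq> A \<inter> B"
          using F(4) G(4) by auto
        then show ?thesis
          using F(1-3) G(1-3) by (intro NI[of "F \<union> G" "min r s"]) auto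
      qed
      then show ?case using Int.IH by blast
    next
      case (UN K)
      have "N \<phi> (\<Union>K)" if "k \<in> K" "N \<phi> k" for \<phi> k
        by (rule NE[OF that(2)], rule NI, assumption+) (use that(1) in blast)
      then show ?case using UN.IH by blast
    next
      case (Basis s)
      then obtain p \<phi> r where s: "s = {\<psi> \<in> V. p (\<lambda>x. \<psi> x - \<phi> x) < r}" "p \<in> P" "\<phi> \<in> V" "0 < r" by auto
      have "N \<eta> s" if "\<eta> \<in> s" for \<eta>
      proof -
        define t where "t = r - p (\<lambda>x. \<eta> x - \<phi> x)"
        have "{\<psi>\<in>V. \<forall>p\<in>{p}. p (\<lambda>x. \<psi> x - \<eta> x) < t} \<subseteq> s"
        proof
          fix \<psi> assume "\<psi> \<in> {\<psi>\<in>V. \<forall>p\<in>{p}. p (\<lambda>x. \<psi> x - \<eta> x) < t}"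
          then show "\<psi> \<in> s" using that s tri[of p \<psi> \<eta> \<phi>] by (simp add: t_def)
        qed
        moreover have "t > 0" using that s(1) by (simp add: t_def)
        ultimately show ?thesis using s(2) by (intro NI[of "{p}" t]) auto
      qed
      then show ?case using s(1) by blast
    qed simp
  next
    assume U: "U \<subseteq> V \<and> (\<forall>\<phi>\<in>U. N \<phi> U)"
    have "\<exists>B. ?open B \<and> \<phi> \<in> B \<and> B \<subseteq> U" if "\<phi> \<in> U" for \<phi>
    proof -
      have "N \<phi> U" using U that by blast
      then obtain F r where F: "finite F" "F \<subseteq> P" "r > 0" "{\<psi>\<in>V. \<forall>p\<in>F. p (\<lambda>x. \<psi> x - \<phi> x) < r} \<subseteq> U"
        by (rule NE)
      have \<phi>: "\<phi> \<in> V" using U that by blast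
      have "?open {\<psi>\<in>V. \<forall>p\<in>F. p (\<lambda>x. \<psi> x - \<phi> x) < r}"
        by (rule openin_seminorm_ball[OF P F(1-3) \<phi>])
      moreover have "p (\<lambda>x. \<phi> x - \<phi> x) < r" if "p \<in> F" for p using zero[of p] that F(2,3) by auto
      ultimately show ?thesis using F(4) \<phi> by (intro exI[of _ "{\<psi>\<in>V. \<forall>p\<in>F. p (\<lambda>x. \<psi> x - \<phi> x) < r}"]) simp
    qed
    then show "?open U" by (subst openin_subopen) blast
  qed
  then show ?thesis unfolding N_def .
qed

lemma openin_seminorm_topologyE:
  assumes "seminorms_on V P" "openin (seminorm_topology V P) U" "\<phi> \<in> U"
  obtains F r where "finite F" "F \<subseteq> P" "r > 0" "{\<psi>\<in>V. \<forall>p\<in>F. p (\<lambda>x. \<psi> x - \<phi> x) < r} \<subseteq> U"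
proof -
  have "\<exists>F r. finite F \<and> F \<subseteq> P \<and> r > 0 \<and> {\<psi>\<in>V. \<forall>p\<in>F. p (\<lambda>x. \<psi> x - \<phi> x) < r} \<subseteq> U"
    using assms(2) unfolding openin_seminorm_topology[OF assms(1)]
    by (elim conjE) (erule bspec, rule assms(3))
  then show ?thesis by (elim exE conjE) (rule that)
qed

text \<open>The epsilon-delta form of continuity, in which all later uses of the topologies take place.\<close>

lemma continuous_map_seminorm_subtopology:
  fixes f :: "(real \<Rightarrow> real) \<Rightarrow> 'b::metric_space"
  assumes P: "seminorms_on V P"
    and A: "A \<subseteq> V"
  shows "continuous_map (subtopology (seminorm_topology V P) A) euclidean f \<longleftrightarrow>
    (\<forall>\<phi>\<in>A. \<forall>e>0. \<exists>F r. finite F \<and> F \<subseteq> P \<and> r > 0 \<and>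
       (\<forall>\<psi>\<in>A. (\<forall>p\<in>F. p (\<lambda>x. \<psi> x - \<phi> x) < r) \<longrightarrow> dist (f \<psi>) (f \<phi>) < e))"
    (is "?cont \<longleftrightarrow> ?char")
proof -
  let ?T = "seminorm_topology V P"
  have zero: "p (\<lambda>x. 0) = 0" if "p \<in> P" for p
    using P that by (simp add: seminorms_on_def)
  have top: "topspace (subtopology ?T A) = A"
    using A topspace_seminorms_on[OF P] by auto
  show ?thesis
  proof
    assume ?cont
    show ?char
    proof (intro ballI allI impI)
      fix \<phi> e assume \<phi>: "\<phi> \<in> A" and e: "(e::real) > 0"
      have "openin (subtopology ?T A) {\<psi> \<in> A. f \<psi> \<in> ball (f \<phi>) e}"
        using \<open>?cont\<close> unfolding continuous_map_def top by auto
      then obtain U where U: "openin ?T U" "{\<psi> \<in> A. f \<psi> \<in> ball (f \<phi>) e} = U \<inter> A"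
        unfolding openin_subtopology by blast
      have "\<phi> \<in> U \<inter> A" unfolding U(2)[symmetric] using \<phi> e by simp
      then have "\<phi> \<in> U" by simp
      then obtain F r where F: "finite F" "F \<subseteq> P" "r > 0" "{\<psi>\<in>V. \<forall>p\<in>F. p (\<lambda>x. \<psi> x - \<phi> x) < r} \<subseteq> U"
        by (rule openin_seminorm_topologyE[OF P U(1)])
      then show "\<exists>F r. finite F \<and> F \<subseteq> P \<and> r > 0 \<and>
         (\<forall>\<psi>\<in>A. (\<forall>p\<in>F. p (\<lambda>x. \<psi> x - \<phi> x) < r) \<longrightarrow> dist (f \<psi>) (f \<phi>) < e)"
      proof (intro exI conjI ballI impI)
        fix \<psi> assume "\<psi> \<in> A" "\<forall>p\<in>F. p (\<lambda>x. \<psi> x - \<phi> x) < r"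
        then have "\<psi> \<in> U \<inter> A" using F A by blast
        then show "dist (f \<psi>) (f \<phi>) < e" unfolding U(2)[symmetric] by (simp add: dist_commute)
      qed (use F in auto)
    qed
  next
    assume C: ?char
    have "openin (subtopology ?T A) {\<psi> \<in> A. f \<psi> \<in> B}" if openB: "open B" for B
    proof (subst openin_subopen, rule ballI)
      fix \<phi> assume "\<phi> \<in> {\<psi> \<in> A. f \<psi> \<in> B}"
      then have \<phi>: "\<phi> \<in> A" "f \<phi> \<in> B" by auto
      obtain e where e: "e > 0" "ball (f \<phi>) e \<subseteq> B" by (rule openE[OF openB \<phi>(2)])
      from C[rule_format, OF \<phi>(1) e(1)] obtain F r where F: "finite F" "F \<subseteq> P" "r > 0"
        "\<forall>\<psi>\<in>A. (\<forall>p\<in>F. p (\<lambda>x. \<psi> x - \<phi> x) < r) \<longrightarrow> dist (f \<psi>) (f \<phi>) < e"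
        by (elim exE conjE) (rule that)
      define U where "U = {\<psi>\<in>V. \<forall>p\<in>F. p (\<lambda>x. \<psi> x - \<phi> x) < r}"
      have "openin ?T U"
        unfolding U_def using A \<phi>(1) by (intro openin_seminorm_ball P F(1-3)) auto
      then have "openin (subtopology ?T A) (U \<inter> A)" unfolding openin_subtopology by blast
      moreover have "p (\<lambda>x. \<phi> x - \<phi> x) < r" if "p \<in> F" for p
        using zero[of p] that F(2,3) by auto
      then have "\<phi> \<in> U \<inter> A" using A \<phi>(1) by (auto simp: U_def)
      moreover have "U \<inter> A \<subseteq> {\<psi> \<in> A. f \<psi> \<in> B}"
      proof
        fix \<psi> assume "\<psi> \<in> U \<inter> A"
        then have "\<psi> \<in> A" "dist (f \<psi>) (f \<phi>) < e" using F(4) by (simp_all add: U_def)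
        then have "f \<psi> \<in> ball (f \<phi>) e" by (simp add: dist_commute)
        then show "\<psi> \<in> {\<psi> \<in> A. f \<psi> \<in> B}" using e(2) \<open>\<psi> \<in> A\<close> by blast
      qed
      ultimately show "\<exists>T. openin (subtopology ?T A) T \<and> \<phi> \<in> T \<and> T \<subseteq> {\<psi> \<in> A. f \<psi> \<in> B}"
        by (intro exI[of _ "U \<inter> A"] conjI)
    qed
    then show ?cont unfolding continuous_map_def top by simp
  qed
qed

lemma seminorms_on_schwartz:
  assumes "V \<subseteq> schwartz_functions" "B \<subseteq> {0..} \<times> UNIV" "B \<noteq> {}"
  shows "seminorms_on V (case_prod schwartz_seminorm ` B)"
  unfolding seminorms_on_def
proof (intro conjI ballI)
  fix p f g h
  assume "p \<in> case_prod schwartz_seminorm ` B" "f \<in> V" "g \<in> V" "h \<in> V"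
  then show "p (\<lambda>x. f x - h x) \<le> p (\<lambda>x. f x - g x) + p (\<lambda>x. g x - h x)"
    using assms(1,2) by (auto intro!: schwartz_seminorm_triangle)
qed (use assms(3) in \<open>auto simp: schwartz_seminorm_zero\<close>)

lemma continuous_map_schwartz_iff:
  fixes f :: "(real \<Rightarrow> real) \<Rightarrow> 'b::metric_space"
  assumes "A \<subseteq> schwartz_functions"
  shows "continuous_map (subtopology schwartz_topology A) euclidean f \<longleftrightarrow>
    (\<forall>\<phi>\<in>A. \<forall>e>0. \<exists>F r. finite F \<and> F \<subseteq> {0..} \<times> UNIV \<and> r > 0 \<and>
       (\<forall>\<psi>\<in>A. (\<forall>(\<alpha>, \<beta>)\<in>F. schwartz_seminorm \<alpha> \<beta> (\<lambda>x. \<psi> x - \<phi> x) < r) \<longrightarrow> dist (f \<psi>) (f \<phi>) < e))"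
proof -
  let ?P = "{schwartz_seminorm \<alpha> \<beta> | \<alpha> \<beta>. 0 \<le> \<alpha>}"
  have P: "?P = case_prod schwartz_seminorm ` ({0..} \<times> UNIV)" by auto
  have ex: "(\<exists>F. finite F \<and> F \<subseteq> ?P \<and> Q F) \<longleftrightarrow>
      (\<exists>F. finite F \<and> F \<subseteq> {0..} \<times> UNIV \<and> Q (case_prod schwartz_seminorm ` F))" for Q
    unfolding P by (metis finite_imageI finite_subset_image image_mono)
  have "continuous_map (subtopology schwartz_topology A) euclidean f \<longleftrightarrow>
    (\<forall>\<phi>\<in>A. \<forall>e>0. \<exists>F. finite F \<and> F \<subseteq> ?P \<and> (\<exists>r. r > 0 \<and>
       (\<forall>\<psi>\<in>A. (\<forall>p\<in>F. p (\<lambda>x. \<psi> x - \<phi> x) < r) \<longrightarrow> dist (f \<psi>) (f \<phi>) < e)))"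
    unfolding schwartz_topology_def
  proof (subst continuous_map_seminorm_subtopology[OF _ assms])
    show "seminorms_on schwartz_functions ?P"
      unfolding P by (rule seminorms_on_schwartz) auto
  qed simp
  then show ?thesis unfolding ex by (simp add: split_beta')
qed

section \<open>Generalized functions\<close>

lemma generalized_function_lincomb:
  assumes "T \<in> generalized_functions" "f \<in> test_functions" "g \<in> test_functions"
  shows "T (\<lambda>x. a * f x + b * g x) = a * T f + b * T g"
  using assms by (auto simp: generalized_functions_def continuous_dual_def topspace_test_topology)

lemma generalized_function_cmult:
  "T \<in> generalized_functions \<Longrightarrow> f \<in> test_functions \<Longrightarrow> T (\<lambda>x. a * f x) = a * T f"
  using generalized_function_lincomb[of T f f a 0] by simp

lemma generalized_function_zero: "T \<in> generalized_functions \<Longrightarrow> T (\<lambda>x. 0) = 0"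
  using generalized_function_cmult[OF _ test_functions_zero, of T 0] by simp

lemma generalized_function_add:
  "T \<in> generalized_functions \<Longrightarrow> f \<in> test_functions \<Longrightarrow> g \<in> test_functions \<Longrightarrow>
     T (\<lambda>x. f x + g x) = T f + T g"
  using generalized_function_lincomb[of T f g 1 1] by simp

lemma generalized_function_diff:
  "T \<in> generalized_functions \<Longrightarrow> f \<in> test_functions \<Longrightarrow> g \<in> test_functions \<Longrightarrow>
     T (\<lambda>x. f x - g x) = T f - T g"
  using generalized_function_lincomb[of T f g 1 "-1"] by simp

lemma generalized_function_sum:
  assumes "T \<in> generalized_functions" "\<And>i. i \<in> I \<Longrightarrow> f i \<in> test_functions"
  shows "T (\<lambda>x. \<Sum>i\<in>I. f i x) = (\<Sum>i\<in>I. T (f i))"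
  using assms(2)
proof (induction I rule: infinite_finite_induct)
  case (insert i I)
  have "T (\<lambda>x. f i x + (\<Sum>i\<in>I. f i x)) = T (f i) + T (\<lambda>x. \<Sum>i\<in>I. f i x)"
    using insert.prems by (intro generalized_function_add[OF assms(1)] test_functions_sum) auto
  then show ?case using insert by simp
qed (auto simp: generalized_function_zero assms(1))

text \<open>The inductive limit topology is seen through its traces on the spaces of test functions with a
  fixed compact support, where convergence means uniform convergence of all derivatives.\<close>

lemma eventually_in_test_open:
  assumes "openin test_topology U" "f \<in> U" "compact K"
    and "\<And>j. g j \<in> test_functions_on K" "f \<in> test_functions_on K"
    and lim: "\<And>\<beta>. (\<lambda>j::nat. schwartz_seminorm 0 \<beta> (\<lambda>x. g j x - f x)) \<longlonglongrightarrow> 0"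
  shows "eventually (\<lambda>j. g j \<in> U) sequentially"
proof -
  have g: "g j \<in> test_functions" "f \<in> test_functions" for j
    using assms(4,5) by (auto simp: test_functions_on_def)
  have gz: "x \<in> K" if "g j x \<noteq> 0" for j x using assms(4)[of j] that by (auto simp: test_functions_on_def)
  have fz: "x \<in> K" if "f x \<noteq> 0" for x using assms(5) that by (auto simp: test_functions_on_def)
  have "generate_topology_on {(\<lambda>\<psi> x. \<phi> x + \<psi> x) ` V | \<phi> V.
          \<phi> \<in> test_functions \<and> V \<subseteq> test_functions \<and> absolutely_convex V \<and>
          (\<forall>K. compact K \<longrightarrow> openin (test_topology_on K) (V \<inter> test_functions_on K))} U"
    using assms(1) by (simp add: test_topology_def openin_topology_generated_by_iff)
  then show ?thesis using assms(2)
  proof induction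
    case (Int A B)
    then show ?case by (simp add: eventually_conj)
  next
    case (UN \<K>)
    then obtain k where "k \<in> \<K>" "f \<in> k" by blast
    from UN.IH[OF this] show ?case by eventually_elim (use \<open>k \<in> \<K>\<close> in blast)
  next
    case (Basis s)
    then obtain \<phi> V where V: "s = (\<lambda>\<psi> x. \<phi> x + \<psi> x) ` V" "\<phi> \<in> test_functions" "V \<subseteq> test_functions"
      "\<And>K. compact K \<Longrightarrow> openin (test_topology_on K) (V \<inter> test_functions_on K)" by auto
    obtain v where v: "v \<in> V" "f = (\<lambda>x. \<phi> x + v x)" using Basis.prems V(1) by auto
    \<comment> \<open>The base point of the neighbourhood need not be supported in the given compact set, so the
      trace of \<open>V\<close> on a larger one is used.\<close>
    define K' where "K' = K \<union> closure {x. v x \<noteq> 0}"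
    have "v \<in> test_functions" using v(1) V(3) by blast
    then have "compact (closure {x. v x \<noteq> 0})" unfolding test_functions_def by blast
    then have "compact K'" unfolding K'_def by (rule compact_Un[OF assms(3)])
    have v': "v \<in> test_functions_on K'"
      using v(1) V(3) closure_subset[of "{x. v x \<noteq> 0}"] by (auto simp: K'_def test_functions_on_def)
    have "{schwartz_seminorm 0 \<beta> | \<beta>. True} = case_prod schwartz_seminorm ` ({0} \<times> UNIV)" by auto
    moreover have "test_functions_on K' \<subseteq> schwartz_functions"
      using test_functions_subset_schwartz by (auto simp: test_functions_on_def)
    ultimately have sn: "seminorms_on (test_functions_on K') {schwartz_seminorm 0 \<beta> | \<beta>. True}"
      by (simp only:) (rule seminorms_on_schwartz, auto)
    have "v \<in> V \<inter> test_functions_on K'" using v(1) v' by blast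
    then obtain F r where F: "finite F" "F \<subseteq> {schwartz_seminorm 0 \<beta> | \<beta>. True}" "r > 0"
        "{\<psi>\<in>test_functions_on K'. \<forall>p\<in>F. p (\<lambda>x. \<psi> x - v x) < r} \<subseteq> V \<inter> test_functions_on K'"
      by (rule openin_seminorm_topologyE[OF sn V(4)[OF \<open>compact K'\<close>, unfolded test_topology_on_def]])
    have "eventually (\<lambda>j. \<forall>p\<in>F. p (\<lambda>x. g j x - f x) < r) sequentially"
    proof (rule eventually_ball_finite[OF F(1)], rule ballI)
      fix p assume "p \<in> F"
      then obtain \<beta> where "p = schwartz_seminorm 0 \<beta>" using F(2) by auto
      then show "eventually (\<lambda>j. p (\<lambda>x. g j x - f x) < r) sequentially"
        using order_tendstoD(2)[OF lim F(3)] by auto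
    qed
    then show ?case
    proof eventually_elim
      case (elim j)
      let ?w = "\<lambda>x. v x + (g j x - f x)"
      have "?w \<in> test_functions"
        using g v(1) V(3) by (intro test_functions_add test_functions_diff) auto
      moreover have "x \<in> K'" if "?w x \<noteq> 0" for x
      proof -
        have "v x \<noteq> 0 \<or> g j x \<noteq> 0 \<or> f x \<noteq> 0" using that by auto
        then show ?thesis
          using gz[of j x] fz[of x] closure_subset[of "{x. v x \<noteq> 0}"] unfolding K'_def by blast
      qed
      ultimately have "?w \<in> test_functions_on K'" by (auto simp: test_functions_on_def)
      then have "?w \<in> V" using F(4) elim by auto
      moreover have "g j = (\<lambda>x. \<phi> x + ?w x)" using v(2) by (simp add: fun_eq_iff)
      ultimately show "g j \<in> s" unfolding V(1) by (intro image_eqI[of _ _ ?w])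
    qed
  qed auto
qed

text \<open>The only continuity property of generalized functions that enters the proof: it makes it possible
  to apply them to Fourier series term by term.\<close>

lemma generalized_function_LIMSEQ:
  assumes "T \<in> generalized_functions" "compact K"
    and "\<And>j. g j \<in> test_functions_on K" "f \<in> test_functions_on K"
    and "\<And>\<beta>. (\<lambda>j::nat. schwartz_seminorm 0 \<beta> (\<lambda>x. g j x - f x)) \<longlonglongrightarrow> 0"
  shows "(\<lambda>j. T (g j)) \<longlonglongrightarrow> T f"
proof (rule topological_tendstoI)
  fix S assume S: "open S" "T f \<in> S"
  have cont: "continuous_map test_topology euclideanreal T"
    using assms(1) by (simp add: generalized_functions_def continuous_dual_def)
  have "openin test_topology {\<psi> \<in> test_functions. T \<psi> \<in> S}"
    using cont S(1) unfolding continuous_map_def topspace_test_topology by auto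
  moreover have "f \<in> test_functions" using assms(4) by (simp add: test_functions_on_def)
  ultimately have "eventually (\<lambda>j. g j \<in> {\<psi> \<in> test_functions. T \<psi> \<in> S}) sequentially"
    using S(2) by (intro eventually_in_test_open[OF _ _ assms(2-)]) auto
  then show "eventually (\<lambda>j. T (g j) \<in> S) sequentially" by eventually_elim simp
qed

subsection \<open>Translates under a tempered generalized function\<close>

text \<open>Translation by \<open>n\<close> moves the support to distance about \<open>\<bar>n\<bar>\<close>, and the derivatives stay bounded.\<close>

lemma schwartz_seminorm_shift_le:
  assumes "\<phi> \<in> test_functions" "\<alpha> \<ge> 0"
  obtains C where "C > 0" "\<And>n::int. schwartz_seminorm \<alpha> \<beta> (\<lambda>x. \<phi> (x - of_int n)) \<le> C * (1 + \<bar>of_int n\<bar>) powr \<alpha>"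
proof -
  obtain c where c: "c > 0" "\<And>x. x \<notin> {-c..c} \<Longrightarrow> \<phi> x = 0"
    using assms(1) by (rule test_functionsE) blast
  obtain B where B: "B > 0" "\<And>x. \<bar>(deriv ^^ \<beta>) \<phi> x\<bar> \<le> B"
    using test_higher_deriv_bounded[OF assms(1)] by metis
  have "schwartz_seminorm \<alpha> \<beta> (\<lambda>x. \<phi> (x - of_int n)) \<le> ((c + 1) powr \<alpha> * B) * (1 + \<bar>of_int n\<bar>) powr \<alpha>" for n :: int
  proof (rule schwartz_seminorm_le)
    fix x
    let ?c = "(c + 1) * (1 + \<bar>real_of_int n\<bar>)"
    have "c + \<bar>real_of_int n\<bar> \<le> ?c" using c(1) by (simp add: algebra_simps)
    then have "\<phi> (x - of_int n) = 0" if "x \<notin> {- ?c..?c}" for x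
      using that by (intro c(2)) auto
    moreover have "1 \<le> ?c" using c(1) mult_mono[of 1 "c + 1" 1 "1 + \<bar>real_of_int n\<bar>"] by simp
    moreover have "\<bar>(deriv ^^ \<beta>) (\<lambda>x. \<phi> (x - of_int n)) x\<bar> \<le> B" for x
      using B(2) by (simp add: higher_deriv_shift test_smooth assms(1))
    ultimately have "schwartz_weight \<alpha> x * \<bar>(deriv ^^ \<beta>) (\<lambda>x. \<phi> (x - of_int n)) x\<bar> \<le> ?c powr \<alpha> * B"
      by (intro test_function_weighted_bound[OF test_functions_shift[OF assms(1)] assms(2)]) auto
    then show "schwartz_weight \<alpha> x * \<bar>(deriv ^^ \<beta>) (\<lambda>x. \<phi> (x - of_int n)) x\<bar> \<le>
        ((c + 1) powr \<alpha> * B) * (1 + \<bar>of_int n\<bar>) powr \<alpha>"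
      using c(1) by (simp add: powr_mult mult_ac)
  qed
  moreover have "(c + 1) powr \<alpha> * B > 0" using c(1) B(1) by simp
  ultimately show ?thesis using that by blast
qed

lemma schwartz_seminorms_shift_le:
  assumes "\<phi> \<in> test_functions" "finite F" "F \<subseteq> {0..} \<times> UNIV"
  obtains D a where "1 \<le> D" "0 \<le> a"
    "\<And>\<alpha> \<beta> n. (\<alpha>, \<beta>) \<in> F \<Longrightarrow> schwartz_seminorm \<alpha> \<beta> (\<lambda>x. \<phi> (x - of_int n)) \<le> D * (1 + \<bar>of_int n\<bar>) powr a"
proof -
  define \<alpha>' where "\<alpha>' = Max (insert 0 (fst ` F))"
  have \<alpha>': "0 \<le> \<alpha>'" "\<And>\<alpha> \<beta>. (\<alpha>, \<beta>) \<in> F \<Longrightarrow> \<alpha> \<le> \<alpha>'"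
    using assms(2) by (auto simp: \<alpha>'_def intro!: Max_ge image_eqI)
  have "\<exists>C>0. \<forall>n::int. schwartz_seminorm (fst ab) (snd ab) (\<lambda>x. \<phi> (x - of_int n)) \<le> C * (1 + \<bar>of_int n\<bar>) powr fst ab"
    if "ab \<in> F" for ab
  proof -
    have "fst ab \<ge> 0" using assms(3) that by auto
    from schwartz_seminorm_shift_le[OF assms(1) this, of "snd ab"] show ?thesis by blast
  qed
  then have "\<forall>ab\<in>F. \<exists>C. C > 0 \<and> (\<forall>n::int. schwartz_seminorm (fst ab) (snd ab) (\<lambda>x. \<phi> (x - of_int n)) \<le> C * (1 + \<bar>of_int n\<bar>) powr fst ab)"
    by blast
  from bchoice[OF this] obtain C where C': "\<And>ab. ab \<in> F \<Longrightarrow> C ab > 0 \<and>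
    (\<forall>n::int. schwartz_seminorm (fst ab) (snd ab) (\<lambda>x. \<phi> (x - of_int n)) \<le> C ab * (1 + \<bar>of_int n\<bar>) powr fst ab)"
    by blast
  have C: "C (\<alpha>, \<beta>) > 0 \<and>
    (\<forall>n::int. schwartz_seminorm \<alpha> \<beta> (\<lambda>x. \<phi> (x - of_int n)) \<le> C (\<alpha>, \<beta>) * (1 + \<bar>of_int n\<bar>) powr \<alpha>)"
    if "(\<alpha>, \<beta>) \<in> F" for \<alpha> \<beta>
    using C'[OF that] by simp
  define D where "D = Max (insert 1 (C ` F))"
  have D: "1 \<le> D" "\<And>\<alpha> \<beta>. (\<alpha>, \<beta>) \<in> F \<Longrightarrow> C (\<alpha>, \<beta>) \<le> D"
    using assms(2) by (auto simp: D_def intro!: Max_ge)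
  have "schwartz_seminorm \<alpha> \<beta> (\<lambda>x. \<phi> (x - of_int n)) \<le> D * (1 + \<bar>of_int n\<bar>) powr \<alpha>'"
    if ab: "(\<alpha>, \<beta>) \<in> F" for \<alpha> \<beta> n
  proof -
    have "C (\<alpha>, \<beta>) * (1 + \<bar>of_int n\<bar>) powr \<alpha> \<le> D * (1 + \<bar>of_int n\<bar>) powr \<alpha>'"
      using C[OF ab] D \<alpha>' ab by (intro mult_mono powr_mono) auto
    then show ?thesis using C[OF ab] by (meson order_trans)
  qed
  then show ?thesis using that D(1) \<alpha>'(1) by blast
qed

text \<open>Continuity at 0 bounds the functional by finitely many seminorms, and those of the translates of a
  test function grow polynomially.\<close>

lemma tempered_translates:
  assumes "T \<in> tempered_generalized_functions" "\<phi> \<in> test_functions"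
  shows "(\<lambda>n::int. T (\<lambda>x. \<phi> (x - of_int n))) \<in> tempered_sequences"
proof -
  obtain v where v: "T = restrict v test_functions" "v \<in> continuous_dual schwartz_topology"
    using assms(1) by (auto simp: tempered_generalized_functions_def)
  have lin: "v (\<lambda>x. a * f x + b * g x) = a * v f + b * v g"
    if "f \<in> schwartz_functions" "g \<in> schwartz_functions" for a b f g
    using v(2) that by (auto simp: continuous_dual_def topspace_schwartz_topology)
  have cont: "continuous_map (subtopology schwartz_topology schwartz_functions) euclidean v"
    using v(2) by (simp add: continuous_dual_def continuous_map_from_subtopology)
  have zero: "(\<lambda>x. 0) \<in> schwartz_functions"
    using test_functions_zero test_functions_subset_schwartz by blast
  obtain F r where F: "finite F" "F \<subseteq> {0..} \<times> UNIV" "r > 0"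
    "\<And>\<psi>. \<psi> \<in> schwartz_functions \<Longrightarrow> (\<And>\<alpha> \<beta>. (\<alpha>, \<beta>) \<in> F \<Longrightarrow> schwartz_seminorm \<alpha> \<beta> \<psi> < r) \<Longrightarrow> \<bar>v \<psi> - v (\<lambda>x. 0)\<bar> < 1"
    using cont[unfolded continuous_map_schwartz_iff[OF order_refl], rule_format, OF zero zero_less_one]
    by (fastforce simp: dist_real_def)
  have v0: "v (\<lambda>x. 0) = 0" using lin[OF zero zero, of 0 0] by simp
  obtain D \<alpha>' where D: "1 \<le> D" and \<alpha>': "0 \<le> \<alpha>'"
    and DF: "\<And>\<alpha> \<beta> n. (\<alpha>, \<beta>) \<in> F \<Longrightarrow> schwartz_seminorm \<alpha> \<beta> (\<lambda>x. \<phi> (x - of_int n)) \<le> D * (1 + \<bar>of_int n\<bar>) powr \<alpha>'"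
    using schwartz_seminorms_shift_le[OF assms(2) F(1,2)] by blast
  have "(1 + \<bar>real_of_int n\<bar>) powr (- \<alpha>') * \<bar>T (\<lambda>x. \<phi> (x - of_int n))\<bar> \<le> 2 * D / r" for n :: int
  proof -
    let ?w = "(1 + \<bar>real_of_int n\<bar>) powr \<alpha>'"
    define s where "s = r / (2 * D * ?w)"
    let ?\<phi> = "\<lambda>x. \<phi> (x - of_int n)"
    have w: "?w > 0" by simp
    have s: "s > 0" using F(3) D w by (simp add: s_def)
    have \<phi>n: "?\<phi> \<in> test_functions" by (intro test_functions_shift assms)
    then have \<phi>S: "?\<phi> \<in> schwartz_functions" using test_functions_subset_schwartz by blast
    have "\<bar>v (\<lambda>x. s * ?\<phi> x + 0 * ?\<phi> x) - v (\<lambda>x. 0)\<bar> < 1"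
    proof (rule F(4))
      fix \<alpha> \<beta> assume ab: "(\<alpha>, \<beta>) \<in> F"
      have "schwartz_seminorm \<alpha> \<beta> (\<lambda>x. s * ?\<phi> x + 0 * ?\<phi> x) \<le> s * schwartz_seminorm \<alpha> \<beta> ?\<phi>"
        using schwartz_seminorm_lincomb[OF \<phi>S \<phi>S, of \<alpha> \<beta> s 0] ab F(2) s by auto
      also have "\<dots> \<le> s * (D * ?w)"
        using DF[OF ab] s by (intro mult_left_mono) auto
      also have "\<dots> = r / 2" using w D by (simp add: s_def)
      also have "\<dots> < r" using F(3) by simp
      finally show "schwartz_seminorm \<alpha> \<beta> (\<lambda>x. s * ?\<phi> x + 0 * ?\<phi> x) < r" .
    qed (intro schwartz_functions_lincomb \<phi>S)
    then have "s * \<bar>v ?\<phi>\<bar> < 1" using lin[OF \<phi>S \<phi>S, of s 0] v0 s by (simp add: abs_mult)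
    then have "\<bar>v ?\<phi>\<bar> \<le> 2 * D * ?w / r"
      using s w D F(3) by (simp add: s_def field_simps)
    then show ?thesis
      using \<phi>n w F(3) v(1) by (simp add: powr_minus divide_simps mult_ac)
  qed
  then show ?thesis
    unfolding tempered_sequences_def using \<alpha>' by (auto intro!: exI[of _ \<alpha>'] bdd_aboveI2)
qed

subsection \<open>Extension to Schwartz functions\<close>

lemma summable_inverse_squares: "summable (\<lambda>k. 1 / (real (Suc k))\<^sup>2)"
  using inverse_power_summable[of 2, where 'a=real] by (subst summable_Suc_iff) (simp add: inverse_eq_divide)

lemma power_le_weights:
  assumes "x \<in> {of_int n..of_int n + (2::real)}"
  shows "(1 + \<bar>of_int n\<bar>) ^ b \<le> 6 ^ b * (schwartz_weight 0 x + schwartz_weight (real b) x)"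
proof -
  have "(1 + \<bar>real_of_int n\<bar>) ^ b \<le> (2 * max 3 \<bar>x\<bar>) ^ b"
    using assms by (intro power_mono) (auto simp: max_def)
  also have "\<dots> \<le> 6 ^ b * (1 + \<bar>x\<bar> ^ b)"
  proof (cases "\<bar>x\<bar> \<le> 3")
    case False
    have "(2::real) ^ b * \<bar>x\<bar> ^ b \<le> 6 ^ b * (1 + \<bar>x\<bar> ^ b)" by (intro mult_mono power_mono) auto
    then show ?thesis using False by (simp add: max_def power_mult_distrib)
  next
    case True
    then have "2 * max 3 \<bar>x\<bar> = 6" by (simp add: max_def)
    then show ?thesis by simp
  qed
  also have "\<bar>x\<bar> ^ b \<le> schwartz_weight (real b) x"
    by (cases "x = 0"; cases "b = 0") (auto simp: schwartz_weight_def powr_realpow power_0_left)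
  finally show ?thesis by (simp add: schwartz_weight_def)
qed

text \<open>The extension of \<open>T\<close> to a Schwartz function \<open>\<phi>\<close> is the sum of the values of \<open>T\<close> on the pieces
  \<open>\<phi> \<cdot> unit_partition n\<close>. The seminorms of \<open>\<phi>\<close> with weight of degree \<open>a + 2\<close> beat the growth \<open>\<bar>n\<bar> ^ a\<close> of
  the local bounds by a summable factor, which gives both convergence and continuity.\<close>

lemma tempered_if_local_bounds:
  assumes T: "T \<in> generalized_functions"
    and bound: "\<And>n f B. f \<in> test_functions_on {of_int n..of_int n + 2} \<Longrightarrow>
      (\<And>\<beta> x. \<beta> \<le> m \<Longrightarrow> \<bar>(deriv ^^ \<beta>) f x\<bar> \<le> B) \<Longrightarrow> \<bar>T f\<bar> \<le> C * (1 + \<bar>of_int n\<bar>) ^ a * B"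
    and C: "C \<ge> 0"
  shows "T \<in> tempered_generalized_functions"
proof -
  define q where "q \<phi> = (\<Sum>i\<le>m. schwartz_seminorm 0 i \<phi> + schwartz_seminorm (real (a + 2)) i \<phi>)" for \<phi>
  obtain A where A: "A > 0" "\<And>i x. i \<le> m \<Longrightarrow> \<bar>(deriv ^^ i) (unit_partition 0) x\<bar> \<le> A"
    using test_higher_deriv_bounded_upto[OF unit_partition_test] by metis
  have part: "\<bar>(deriv ^^ i) (unit_partition n) x\<bar> \<le> A" if "i \<le> m" for i n x
    using A(2)[OF that, of "x - n"]
    by (subst unit_partition_shift, subst higher_deriv_shift[OF test_smooth[OF unit_partition_test]])
  have prod_test: "(\<lambda>x. \<phi> x * unit_partition n x) \<in> test_functions_on {of_int n..of_int n + 2}"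
    if "smooth \<phi>" for \<phi> n
    by (rule test_functions_onI)
       (auto intro!: smooth_mult that test_smooth[OF unit_partition_test] simp: unit_partition_zero)
  define D where "D = C * (6 ^ (a + 2) * 2 ^ m * A)"
  have D: "D \<ge> 0" using C A(1) by (simp add: D_def)
  have local: "\<bar>T (\<lambda>x. \<phi> x * unit_partition n x)\<bar> \<le> D * q \<phi> / (1 + \<bar>of_int n\<bar>)\<^sup>2"
    if \<phi>: "\<phi> \<in> schwartz_functions" for \<phi> n
  proof -
    let ?w = "1 + \<bar>real_of_int n\<bar>"
    define E where "E = 6 ^ (a + 2) * q \<phi> / ?w ^ (a + 2)"
    have q_ge: "schwartz_seminorm 0 i \<phi> + schwartz_seminorm (real (a + 2)) i \<phi> \<le> q \<phi>" if "i \<le> m" for i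
      unfolding q_def using that schwartz_seminorm_nonneg[OF \<phi>]
      by (intro member_le_sum[of i "{..m}" "\<lambda>i. schwartz_seminorm 0 i \<phi> + schwartz_seminorm (real (a + 2)) i \<phi>"])
         (auto intro!: add_nonneg_nonneg)
    have "q \<phi> \<ge> 0" unfolding q_def
      using schwartz_seminorm_nonneg[OF \<phi>] by (intro sum_nonneg add_nonneg_nonneg) auto
    then have E: "E \<ge> 0" by (simp add: E_def)
    have "\<bar>(deriv ^^ i) \<phi> x\<bar> \<le> E" if x: "x \<in> {of_int n..of_int n + 2}" and i: "i \<le> m" for x i
    proof -
      have "?w ^ (a + 2) * \<bar>(deriv ^^ i) \<phi> x\<bar> \<le>
          6 ^ (a + 2) * (schwartz_weight 0 x + schwartz_weight (real (a + 2)) x) * \<bar>(deriv ^^ i) \<phi> x\<bar>"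
        by (intro mult_right_mono power_le_weights x) auto
      also have "\<dots> = 6 ^ (a + 2) * (schwartz_weight 0 x * \<bar>(deriv ^^ i) \<phi> x\<bar> +
          schwartz_weight (real (a + 2)) x * \<bar>(deriv ^^ i) \<phi> x\<bar>)" by (simp add: algebra_simps)
      also have "\<dots> \<le> 6 ^ (a + 2) * (schwartz_seminorm 0 i \<phi> + schwartz_seminorm (real (a + 2)) i \<phi>)"
        by (intro mult_left_mono add_mono schwartz_seminorm_upper \<phi>) auto
      also have "\<dots> \<le> 6 ^ (a + 2) * q \<phi>" using q_ge[OF i] by simp
      finally show ?thesis unfolding E_def by (subst pos_le_divide_eq) (simp_all add: mult.commute del: power_Suc power_add)
    qed
    note \<phi>_bound = this
    have prod_bound: "\<bar>(deriv ^^ \<beta>) (\<lambda>x. \<phi> x * unit_partition n x) x\<bar> \<le> 2 ^ m * (E * A)" if \<beta>: "\<beta> \<le> m" for \<beta> x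
    proof (cases "x \<in> {of_int n..of_int n + 2}")
      case True
      have "\<bar>(deriv ^^ \<beta>) (\<lambda>x. \<phi> x * unit_partition n x) x\<bar> \<le> 2 ^ \<beta> * (E * A)"
        using \<beta> True by (intro higher_deriv_mult_bound schwartz_smooth[OF \<phi>] test_smooth
           unit_partition_test part \<phi>_bound) auto
      also have "\<dots> \<le> 2 ^ m * (E * A)" using \<beta> E A(1) by (intro mult_right_mono power_increasing) auto
      finally show ?thesis .
    next
      case False
      have "(deriv ^^ \<beta>) (\<lambda>x. \<phi> x * unit_partition n x) x = 0"
        by (rule higher_deriv_zero_outside[OF _ _ False]) (auto simp: unit_partition_zero)
      then show ?thesis using E A(1) by simp
    qed
    have "\<bar>T (\<lambda>x. \<phi> x * unit_partition n x)\<bar> \<le> C * ?w ^ a * (2 ^ m * (E * A))"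
      by (rule bound[OF prod_test[OF schwartz_smooth[OF \<phi>]] prod_bound])
    also have "\<dots> = D * q \<phi> / ?w\<^sup>2"
    proof -
      have *: "C * y * (2 ^ m * (6 ^ (a + 2) * q \<phi> / (y * z) * A)) = C * (6 ^ (a + 2) * 2 ^ m * A) * q \<phi> / z"
        if "y > 0" "z > 0" for y z :: real using that by (simp add: field_simps)
      have w: "?w ^ a > 0" "?w\<^sup>2 > 0" by (simp_all add: zero_less_power)
      from *[OF w] show ?thesis
        by (simp only: E_def D_def power_add[of ?w a 2])
    qed
    finally show ?thesis .
  qed
  define u where "u k \<phi> = T (\<lambda>x. \<phi> x * unit_partition (int k) x) + T (\<lambda>x. \<phi> x * unit_partition (- 1 - int k) x)" for k \<phi>
  have u_bound: "norm (u k \<phi>) \<le> 2 * D * q \<phi> * (1 / (real (Suc k))\<^sup>2)" if \<phi>: "\<phi> \<in> schwartz_functions" for k \<phi>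
  proof -
    have "q \<phi> \<ge> 0" unfolding q_def
      using schwartz_seminorm_nonneg[OF \<phi>] by (intro sum_nonneg add_nonneg_nonneg) auto
    then have "D * q \<phi> / (1 + \<bar>of_int (- 1 - int k)\<bar>)\<^sup>2 \<le> D * q \<phi> / (real (Suc k))\<^sup>2"
      using D by (intro divide_left_mono power_mono mult_pos_pos) auto
    moreover have "D * q \<phi> / (1 + \<bar>of_int (int k)\<bar>)\<^sup>2 = D * q \<phi> / (real (Suc k))\<^sup>2" by (simp add: add.commute)
    moreover have "\<bar>u k \<phi>\<bar> \<le> \<bar>T (\<lambda>x. \<phi> x * unit_partition (int k) x)\<bar> + \<bar>T (\<lambda>x. \<phi> x * unit_partition (- 1 - int k) x)\<bar>"
      unfolding u_def by (rule abs_triangle_ineq)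
    ultimately have "\<bar>u k \<phi>\<bar> \<le> D * q \<phi> / (real (Suc k))\<^sup>2 + D * q \<phi> / (real (Suc k))\<^sup>2"
      using local[OF \<phi>, of "int k"] local[OF \<phi>, of "- 1 - int k"] by linarith
    then show ?thesis by simp
  qed
  note sq = summable_inverse_squares
  have u_summable: "summable (\<lambda>k. u k \<phi>)" if "\<phi> \<in> schwartz_functions" for \<phi>
    using u_bound[OF that] by (rule summable_comparison_test'[OF summable_mult[OF sq]])
  define S where "S = (\<Sum>k. 1 / (real (Suc k))\<^sup>2)"
  define v where "v = restrict (\<lambda>\<phi>. \<Sum>k. u k \<phi>) schwartz_functions"
  have v_bound: "\<bar>v \<phi>\<bar> \<le> 2 * D * S * q \<phi>" if "\<phi> \<in> schwartz_functions" for \<phi>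
  proof -
    have "norm (\<Sum>k. u k \<phi>) \<le> (\<Sum>k. 2 * D * q \<phi> * (1 / (real (Suc k))\<^sup>2))"
      by (rule norm_suminf_le[OF u_bound[OF that] summable_mult[OF sq]])
    also have "\<dots> = 2 * D * q \<phi> * S" unfolding S_def by (rule suminf_mult[OF sq])
    finally show ?thesis using that by (simp add: v_def mult_ac)
  qed
  have test_prod: "(\<lambda>x. \<phi> x * unit_partition n x) \<in> test_functions" if "\<phi> \<in> schwartz_functions" for \<phi> n
    using test_functions_mult[OF unit_partition_test schwartz_smooth[OF that]] .
  have lin: "v (\<lambda>x. b * f x + c * g x) = b * v f + c * v g"
    if fg: "f \<in> schwartz_functions" "g \<in> schwartz_functions" for b c f g
  proof -
    have *: "T (\<lambda>x. (b * f x + c * g x) * unit_partition n x) =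
        b * T (\<lambda>x. f x * unit_partition n x) + c * T (\<lambda>x. g x * unit_partition n x)" for n
      using generalized_function_lincomb[OF T test_prod[OF fg(1)] test_prod[OF fg(2)], of b n c n]
      by (simp add: algebra_simps)
    have "u k (\<lambda>x. b * f x + c * g x) = b * u k f + c * u k g" for k
      unfolding u_def * by (simp add: algebra_simps)
    then have "(\<Sum>k. u k (\<lambda>x. b * f x + c * g x)) = b * (\<Sum>k. u k f) + c * (\<Sum>k. u k g)"
      using u_summable[OF fg(1)] u_summable[OF fg(2)]
      by (simp add: suminf_add[symmetric] suminf_mult summable_mult)
    then show ?thesis using fg schwartz_functions_lincomb[OF fg] by (simp add: v_def)
  qed
  have "continuous_map (subtopology schwartz_topology schwartz_functions) euclidean v"
    unfolding continuous_map_schwartz_iff[OF order_refl]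
  proof (intro ballI allI impI)
    fix \<phi> e assume \<phi>: "\<phi> \<in> schwartz_functions" and e: "(e::real) > 0"
    define F where "F = {0, real (a + 2)} \<times> {..m}"
    have S0: "S \<ge> 0" unfolding S_def by (intro suminf_nonneg sq) auto
    define K where "K = 2 * D * S * (2 * (real m + 1))"
    have K: "K \<ge> 0" using D S0 by (simp add: K_def)
    define r where "r = e / (K + 1)"
    have r: "r > 0" using e K by (simp add: r_def)
    have "dist (v \<psi>) (v \<phi>) < e" if \<psi>: "\<psi> \<in> schwartz_functions"
      and small: "\<forall>(\<alpha>, \<beta>)\<in>F. schwartz_seminorm \<alpha> \<beta> (\<lambda>x. \<psi> x - \<phi> x) < r" for \<psi>
    proof -
      have "q (\<lambda>x. \<psi> x - \<phi> x) \<le> (\<Sum>i\<le>m. r + r)" unfolding q_def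
        using small by (intro sum_mono add_mono) (auto simp: F_def less_imp_le)
      also have "\<dots> = 2 * (real m + 1) * r" by (simp add: algebra_simps)
      finally have "2 * D * S * q (\<lambda>x. \<psi> x - \<phi> x) \<le> 2 * D * S * (2 * (real m + 1) * r)"
        using D S0 by (intro mult_left_mono) auto
      moreover have "\<bar>v (\<lambda>x. \<psi> x - \<phi> x)\<bar> \<le> 2 * D * S * q (\<lambda>x. \<psi> x - \<phi> x)"
        by (intro v_bound schwartz_functions_diff \<psi> \<phi>)
      moreover have "v (\<lambda>x. \<psi> x - \<phi> x) = v \<psi> - v \<phi>" using lin[OF \<psi> \<phi>, of 1 "-1"] by simp
      ultimately have "\<bar>v \<psi> - v \<phi>\<bar> \<le> K * r" by (simp add: K_def mult_ac)
      also have "\<dots> < (K + 1) * r" using r by simp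
      also have "\<dots> = e" using K by (simp add: r_def)
      finally show ?thesis by (simp add: dist_real_def)
    qed
    moreover have "finite F" "F \<subseteq> {0..} \<times> UNIV" by (auto simp: F_def)
    ultimately show "\<exists>F r. finite F \<and> F \<subseteq> {0..} \<times> UNIV \<and> r > 0 \<and>
       (\<forall>\<psi>\<in>schwartz_functions. (\<forall>(\<alpha>, \<beta>)\<in>F. schwartz_seminorm \<alpha> \<beta> (\<lambda>x. \<psi> x - \<phi> x) < r) \<longrightarrow> dist (v \<psi>) (v \<phi>) < e)"
      using r by blast
  qed
  then have "continuous_map schwartz_topology euclideanreal v"
    by (metis subtopology_topspace topspace_schwartz_topology)
  then have "v \<in> continuous_dual schwartz_topology"
    using lin by (auto simp: continuous_dual_def topspace_schwartz_topology v_def)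
  moreover have "T = restrict v test_functions"
  proof
    fix \<phi>
    show "T \<phi> = restrict v test_functions \<phi>"
    proof (cases "\<phi> \<in> test_functions")
      case True
      then have \<phi>: "\<phi> \<in> schwartz_functions" using test_functions_subset_schwartz by blast
      obtain c where c: "c > 0" "\<And>x. x \<notin> {-c..c} \<Longrightarrow> \<phi> x = 0"
        using True by (rule test_functionsE) blast
      obtain N where N: "c + 1 \<le> real N" using real_arch_simple by blast
      have "(\<Sum>k<M. u k \<phi>) = T \<phi>" if "N \<le> M" for M
      proof -
        have "(\<Sum>k<M. u k \<phi>) = T (\<lambda>x. \<Sum>k<M. \<phi> x * unit_partition (int k) x + \<phi> x * unit_partition (- 1 - int k) x)"
          unfolding u_def
          by (subst generalized_function_sum[OF T])
             (auto intro!: test_functions_add test_prod \<phi> sum.cong simp: generalized_function_add[OF T test_prod test_prod] \<phi>)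
        also have "(\<lambda>x. \<Sum>k<M. \<phi> x * unit_partition (int k) x + \<phi> x * unit_partition (- 1 - int k) x) = \<phi>"
        proof
          fix x
          have "(\<Sum>k<M. \<phi> x * unit_partition (int k) x + \<phi> x * unit_partition (- 1 - int k) x)
            = \<phi> x * (\<Sum>k<M. unit_partition (int k) x + unit_partition (- 1 - int k) x)"
            by (simp add: sum_distrib_left distrib_left)
          also have "\<dots> = \<phi> x"
          proof (cases "\<bar>x\<bar> \<le> c")
            case True
            then show ?thesis using N that by (subst unit_partition_sum) auto
          next
            case False
            then have "\<phi> x = 0" by (intro c(2)) auto
            then show ?thesis by simp
          qed
          finally show "(\<Sum>k<M. \<phi> x * unit_partition (int k) x + \<phi> x * unit_partition (- 1 - int k) x) = \<phi> x" .
        qed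
        finally show ?thesis .
      qed
      then have "(\<lambda>M. \<Sum>k<M. u k \<phi>) \<longlonglongrightarrow> T \<phi>"
        by (intro tendsto_eventually) (auto simp: eventually_sequentially)
      then have "(\<Sum>k. u k \<phi>) = T \<phi>" by (simp add: sums_def sums_unique[symmetric])
      then show ?thesis using True \<phi> by (simp add: v_def)
    next
      case False
      then show ?thesis
        using T by (simp add: generalized_functions_def continuous_dual_def topspace_test_topology extensional_def)
    qed
  qed
  ultimately show ?thesis by (auto simp: tempered_generalized_functions_def)
qed

section \<open>Fourier series of test functions\<close>

lemma cis_affine_vector_derivative:
  "((\<lambda>y. cis (m * (y - t))) has_vector_derivative \<i> * of_real m * cis (m * (x - t))) (at x)"
proof -
  have "((\<lambda>y. m * (y - t)) has_vector_derivative m) (at x)"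
    unfolding has_real_derivative_iff_has_vector_derivative[symmetric]
    by (auto intro!: derivative_eq_intros)
  from vector_diff_chain_at[OF this has_vector_derivative_iexp]
  show ?thesis by (simp add: o_def cis_conv_exp scaleR_conv_of_real mult_ac)
qed

lemma integral_cis_period:
  "((\<lambda>y. cis (of_int m * (y - t))) has_integral (if m = 0 then of_real (2 * pi) else 0)) {a..a + 2 * pi}"
proof (cases "m = 0")
  case True
  then show ?thesis using has_integral_const_real[of "1::complex" a "a + 2 * pi"] by (simp add: scaleR_conv_of_real)
next
  case False
  have "((\<lambda>y. cis (of_int m * (y - t))) has_integral
      (cis (of_int m * (a + 2 * pi - t)) / (\<i> * of_int m) - cis (of_int m * (a - t)) / (\<i> * of_int m))) {a..a + 2 * pi}"
  proof (rule fundamental_theorem_of_calculus)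
    fix x :: real
    have "((\<lambda>y. cis (of_int m * (y - t)) / (\<i> * of_int m)) has_vector_derivative
        (\<i> * of_real (of_int m) * cis (of_int m * (x - t))) / (\<i> * of_int m)) (at x)"
      by (rule has_vector_derivative_divide[OF cis_affine_vector_derivative])
    then show "((\<lambda>y. cis (of_int m * (y - t)) / (\<i> * of_int m)) has_vector_derivative
       cis (of_int m * (x - t))) (at x within {a..a + 2 * pi})"
      using False by (auto intro: has_vector_derivative_at_within)
  qed simp
  moreover have "cis (of_int m * (a + 2 * pi - t)) = cis (of_int m * (a - t))"
  proof -
    have "of_int m * (a + 2 * pi - t) = of_int m * (a - t) + 2 * pi * of_int m" by (simp add: algebra_simps)
    then show ?thesis by (simp add: cis_mult[symmetric] cis_multiple_2pi)
  qed
  ultimately show ?thesis using False by simp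
qed

lemma bessel_inequality:
  fixes g :: "real \<Rightarrow> complex" and c :: "int \<Rightarrow> complex" and a t :: real
  assumes g: "continuous_on {a..a + 2 * pi} g" and "finite A"
  defines "c \<equiv> \<lambda>k. integral {a..a + 2 * pi} (\<lambda>y. g y * cis (- (of_int k * (y - t))))"
  shows "(\<Sum>k\<in>A. (cmod (c k))\<^sup>2) \<le> 2 * pi * integral {a..a + 2 * pi} (\<lambda>y. (cmod (g y))\<^sup>2)"
proof -
  let ?I = "{a..a + 2 * pi}"
  let ?e = "\<lambda>k y. cis (of_int k * (y - t))"
  have e: "continuous_on ?I (?e k)" for k by (intro continuous_intros)
  have cnj_e: "cnj (?e k y) = cis (- (of_int k * (y - t)))" for k y by (simp add: cis_cnj)
  \<comment> \<open>The orthogonal projection of \<open>g\<close>; the claim is that its norm is at most that of \<open>g\<close>.\<close>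
  define S where "S y = (\<Sum>k\<in>A. c k * ?e k y) / (2 * pi)" for y
  have cnjS: "cnj (S y) = (\<Sum>k\<in>A. cnj (c k) * cnj (?e k y)) / (2 * pi)" for y
    by (simp add: S_def)
  have S: "continuous_on ?I S" unfolding S_def by (intro continuous_intros) simp
  define B where "B = (\<Sum>k\<in>A. (cmod (c k))\<^sup>2) / (2 * pi)"
  have c: "((\<lambda>y. g y * cnj (?e k y)) has_integral c k) ?I" for k
    unfolding c_def cnj_e
    by (intro integrable_integral integrable_continuous_real continuous_intros g)
  have "((\<lambda>y. (\<Sum>k\<in>A. cnj (c k) * (g y * cnj (?e k y))) / (2 * pi)) has_integral (\<Sum>k\<in>A. cnj (c k) * c k) / (2 * pi)) ?I"
    by (intro has_integral_divide has_integral_sum has_integral_mult_right c assms(2))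
  moreover have "(\<Sum>k\<in>A. cnj (c k) * (g y * cnj (?e k y))) / (2 * pi) = g y * cnj (S y)" for y
    unfolding cnjS by (simp add: sum_distrib_left mult_ac)
  moreover have B: "(\<Sum>k\<in>A. cnj (c k) * c k) / (2 * pi) = of_real B"
    by (simp add: B_def complex_norm_square[symmetric] mult.commute[of "cnj _"])
  ultimately have gS: "((\<lambda>y. g y * cnj (S y)) has_integral of_real B) ?I" by simp
  have Se: "((\<lambda>y. S y * cnj (?e k y)) has_integral c k) ?I" if "k \<in> A" for k
  proof -
    have "((\<lambda>y. (\<Sum>j\<in>A. c j * cis (of_int (j - k) * (y - t))) / (2 * pi)) has_integral
       (\<Sum>j\<in>A. c j * (if j - k = 0 then of_real (2 * pi) else 0)) / (2 * pi)) ?I"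
      by (intro has_integral_divide has_integral_sum has_integral_mult_right integral_cis_period assms(2))
    moreover have "(\<Sum>j\<in>A. c j * (if j - k = 0 then of_real (2 * pi) else 0)) / (2 * pi) = c k"
      using that assms(2) by (simp add: if_distrib[of "\<lambda>x. _ * x"] sum.delta cong: if_cong)
    moreover have "(\<Sum>j\<in>A. c j * cis (of_int (j - k) * (y - t))) / (2 * pi) = S y * cnj (?e k y)" for y
    proof -
      have "cis (of_int (j - k) * (y - t)) = ?e j y * cnj (?e k y)" for j
        unfolding cnj_e cis_mult by (simp add: algebra_simps)
      then show ?thesis by (simp add: S_def sum_distrib_left mult_ac)
    qed
    ultimately show ?thesis by simp
  qed
  have "((\<lambda>y. (\<Sum>k\<in>A. cnj (c k) * (S y * cnj (?e k y))) / (2 * pi)) has_integral (\<Sum>k\<in>A. cnj (c k) * c k) / (2 * pi)) ?I"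
    by (intro has_integral_divide has_integral_sum has_integral_mult_right Se assms(2))
  moreover have "(\<Sum>k\<in>A. cnj (c k) * (S y * cnj (?e k y))) / (2 * pi) = S y * cnj (S y)" for y
    unfolding cnjS by (simp add: sum_distrib_left mult_ac)
  ultimately have SS: "((\<lambda>y. S y * cnj (S y)) has_integral of_real B) ?I" using B by simp
  have Re_gS: "((\<lambda>y. Re (g y * cnj (S y))) has_integral B) ?I"
    using has_integral_Re[OF gS] by simp
  have Re_SS: "((\<lambda>y. Re (S y * cnj (S y))) has_integral B) ?I"
    using has_integral_Re[OF SS] by simp
  have gg: "((\<lambda>y. (cmod (g y))\<^sup>2) has_integral integral ?I (\<lambda>y. (cmod (g y))\<^sup>2)) ?I"
    by (intro integrable_integral integrable_continuous_real continuous_intros g)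
  have "((\<lambda>y. (cmod (g y))\<^sup>2 - 2 * Re (g y * cnj (S y)) + Re (S y * cnj (S y))) has_integral
     (integral ?I (\<lambda>y. (cmod (g y))\<^sup>2) - 2 * B + B)) ?I"
    by (intro has_integral_add has_integral_diff has_integral_mult_right gg Re_gS Re_SS)
  moreover have "(cmod (g y))\<^sup>2 - 2 * Re (g y * cnj (S y)) + Re (S y * cnj (S y)) \<ge> 0" for y
  proof -
    have "(cmod (g y))\<^sup>2 - 2 * Re (g y * cnj (S y)) + Re (S y * cnj (S y)) = (cmod (g y - S y))\<^sup>2"
      unfolding cmod_power2 by (simp add: power2_eq_square algebra_simps)
    then show ?thesis by simp
  qed
  ultimately have "0 \<le> integral ?I (\<lambda>y. (cmod (g y))\<^sup>2) - 2 * B + B"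
    by (rule has_integral_nonneg)
  then have "B \<le> integral ?I (\<lambda>y. (cmod (g y))\<^sup>2)" by simp
  then show ?thesis using pi_gt_zero by (simp add: B_def field_simps)
qed

text \<open>Bessel's inequality makes the squares of the coefficients along any injective sequence of
  frequencies summable.\<close>

lemma riemann_lebesgue:
  fixes g :: "real \<Rightarrow> complex"
  assumes g: "continuous_on {a..a + 2 * pi} g" and h: "inj (h :: nat \<Rightarrow> int)"
  shows "(\<lambda>j. integral {a..a + 2 * pi} (\<lambda>y. g y * cis (- (of_int (h j) * (y - t))))) \<longlonglongrightarrow> 0"
proof -
  define c where "c k = integral {a..a + 2 * pi} (\<lambda>y. g y * cis (- (of_int k * (y - t))))" for k
  have "summable (\<lambda>j. (cmod (c (h j)))\<^sup>2)"
  proof (rule bounded_imp_summable)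
    fix N
    have "(\<Sum>j\<le>N. (cmod (c (h j)))\<^sup>2) = (\<Sum>k\<in>h ` {..N}. (cmod (c k))\<^sup>2)"
      using h by (subst sum.reindex) (auto intro: inj_on_subset)
    also have "\<dots> \<le> 2 * pi * integral {a..a + 2 * pi} (\<lambda>y. (cmod (g y))\<^sup>2)"
      unfolding c_def by (rule bessel_inequality[OF g]) simp
    finally show "(\<Sum>j\<le>N. (cmod (c (h j)))\<^sup>2) \<le> 2 * pi * integral {a..a + 2 * pi} (\<lambda>y. (cmod (g y))\<^sup>2)" .
  qed simp
  then have "(\<lambda>j. (cmod (c (h j)))\<^sup>2) \<longlonglongrightarrow> 0" by (rule summable_LIMSEQ_zero)
  then have "(\<lambda>j. sqrt ((cmod (c (h j)))\<^sup>2)) \<longlonglongrightarrow> sqrt 0" by (rule tendsto_real_sqrt)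
  then have "(\<lambda>j. c (h j)) \<longlonglongrightarrow> 0" by (simp add: tendsto_norm_zero_iff)
  then show ?thesis by (simp add: c_def)
qed

text \<open>The sum of the terms with frequencies \<open>k\<close> and \<open>- k\<close> of the complex Fourier series on an interval of
  length \<open>2 * pi\<close> that begins at \<open>a\<close>.\<close>

definition fourier_term :: "real \<Rightarrow> nat \<Rightarrow> (real \<Rightarrow> real) \<Rightarrow> real \<Rightarrow> real" where
  "fourier_term a k f x = (if k = 0 then 1 / (2 * pi) else 1 / pi) *
     integral {a..a + 2 * pi} (\<lambda>y. f y * cos (real k * (y - x)))"

text \<open>Chernoff's proof. Write \<open>f y = f x + (cis (y - x) - 1) * g y\<close> with \<open>g\<close> continuous. Multiplication by
  \<open>cis (y - x) - 1\<close> turns the Fourier coefficients of \<open>g\<close> into differences of consecutive ones, so the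
  partial sums telescope to \<open>f x\<close> plus two coefficients of \<open>g\<close>, and these tend to 0 by the
  Riemann-Lebesgue lemma.\<close>

lemma fourier_inversion:
  assumes f: "smooth f" and x: "x \<in> {a<..<a + 2 * pi}"
  shows "(\<lambda>N. \<Sum>k\<le>N. fourier_term a k f x) \<longlonglongrightarrow> f x"
proof -
  let ?I = "{a..a + 2 * pi}"
  let ?e = "\<lambda>k y. cis (- (of_int k * (y - x)))"
  \<comment> \<open>The quotient is continuous because \<open>x\<close> is the only zero of the denominator in the interval.\<close>
  define g where "g y = (if y = x then of_real (deriv f x) / \<i> else of_real (f y - f x) / (cis (y - x) - 1))" for y
  have den: "cis (y - x) - 1 \<noteq> 0" if "y \<in> ?I" "y \<noteq> x" for y
  proof
    assume "cis (y - x) - 1 = 0"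
    then have "cos (y - x) = 1" by (simp add: complex_eq_iff)
    then obtain n :: int where n: "y - x = of_int n * 2 * pi" using cos_one_2pi_int by blast
    have "\<bar>y - x\<bar> < 2 * pi" using that(1) x by auto
    then have "\<bar>of_int n\<bar> < (1::real)" unfolding n by (simp add: abs_mult)
    then have "n = 0" by linarith
    then show False using n that(2) by simp
  qed
  have "((\<lambda>y. g y) \<longlongrightarrow> g x) (at x)"
  proof -
    have "((\<lambda>y. (f y - f x) / (y - x)) \<longlongrightarrow> deriv f x) (at x)"
      using smooth_DERIV0[OF f, of x] by (simp add: has_field_derivative_iff)
    then have 1: "((\<lambda>y. complex_of_real ((f y - f x) / (y - x))) \<longlongrightarrow> of_real (deriv f x)) (at x)"
      by (rule tendsto_of_real)
    have exp0: "((\<lambda>w::complex. (exp w - 1) / w) \<longlongrightarrow> 1) (at 0)"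
      using DERIV_exp[of "0::complex"] by (simp add: has_field_derivative_iff)
    have "filterlim (\<lambda>y. \<i> * complex_of_real (y - x)) (at 0) (at x)"
      unfolding filterlim_at
    proof (intro conjI)
      show "\<forall>\<^sub>F y in at x. \<i> * complex_of_real (y - x) \<in> UNIV \<and> \<i> * complex_of_real (y - x) \<noteq> 0"
        by (auto simp: eventually_at_filter)
      show "((\<lambda>y. \<i> * complex_of_real (y - x)) \<longlongrightarrow> 0) (at x)"
        by (auto intro!: tendsto_eq_intros)
    qed
    from filterlim_compose[OF exp0 this]
    have "((\<lambda>y. (cis (y - x) - 1) / (\<i> * of_real (y - x))) \<longlongrightarrow> 1) (at x)"
      by (simp add: cis_conv_exp)
    from tendsto_mult[OF tendsto_const[of "\<i>"] this]
    have 2: "((\<lambda>y. (cis (y - x) - 1) / of_real (y - x)) \<longlongrightarrow> \<i>) (at x)"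
      by simp
    have "((\<lambda>y. complex_of_real ((f y - f x) / (y - x)) / ((cis (y - x) - 1) / of_real (y - x))) \<longlongrightarrow> of_real (deriv f x) / \<i>) (at x)"
      by (intro tendsto_divide 1 2) simp
    moreover have "eventually (\<lambda>y. complex_of_real ((f y - f x) / (y - x)) / ((cis (y - x) - 1) / of_real (y - x)) = g y) (at x)"
      by (auto simp: g_def eventually_at_filter)
    ultimately show ?thesis unfolding g_def[of x] by (simp add: tendsto_cong)
  qed
  then have gx: "continuous (at x) g" by (simp add: continuous_at)
  have g: "continuous_on ?I g"
  proof (rule continuous_at_imp_continuous_on, rule ballI)
    fix y assume y: "y \<in> ?I"
    show "isCont g y"
    proof (cases "y = x")
      case True
      then show ?thesis using gx by simp
    next
      case False
      have "isCont f y" using DERIV_isCont[OF smooth_DERIV0[OF f]] .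
      then have "isCont (\<lambda>y. complex_of_real (f y - f x) / (cis (y - x) - 1)) y"
        using den[OF y False] has_vector_derivative_continuous[OF cis_affine_vector_derivative[of 1 x y]]
        by (intro continuous_intros) auto
      moreover have "eventually (\<lambda>z. z \<in> - {x}) (nhds y)"
        using False by (intro eventually_nhds_in_open) auto
      then have "eventually (\<lambda>z. complex_of_real (f z - f x) / (cis (z - x) - 1) = g z) (nhds y)"
        by eventually_elim (simp add: g_def)
      ultimately show ?thesis by (rule isCont_cong[THEN iffD1, rotated])
    qed
  qed
  define G where "G k = integral ?I (\<lambda>y. g y * ?e k y)" for k
  have G: "((\<lambda>y. g y * ?e k y) has_integral G k) ?I" for k
    unfolding G_def by (intro integrable_integral integrable_continuous_real continuous_intros g)
  have fe: "((\<lambda>y. of_real (f y) * ?e k y) has_integral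
     (of_real (f x) * (if k = 0 then of_real (2 * pi) else 0) + (G (k - 1) - G k))) ?I" for k
  proof -
    have "((\<lambda>y. of_real (f x) * cis (of_int (- k) * (y - x)) + (g y * ?e (k - 1) y - g y * ?e k y)) has_integral
       (of_real (f x) * (if - k = 0 then of_real (2 * pi) else 0) + (G (k - 1) - G k))) ?I"
      by (intro has_integral_add has_integral_diff has_integral_mult_right integral_cis_period G)
    moreover have "of_real (f x) * cis (of_int (- k) * (y - x)) + (g y * ?e (k - 1) y - g y * ?e k y) = of_real (f y) * ?e k y"
      if "y \<in> ?I" for y
    proof -
      have "?e (k - 1) y = cis (y - x) * ?e k y" by (simp add: cis_mult algebra_simps)
      then have "g y * ?e (k - 1) y - g y * ?e k y = g y * (cis (y - x) - 1) * ?e k y" by (simp add: algebra_simps)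
      also have "g y * (cis (y - x) - 1) = of_real (f y - f x)"
        using den[OF that] by (auto simp: g_def)
      finally show ?thesis by (simp add: algebra_simps)
    qed
    ultimately have "((\<lambda>y. of_real (f y) * ?e k y) has_integral
       (of_real (f x) * (if - k = 0 then of_real (2 * pi) else 0) + (G (k - 1) - G k))) ?I"
      by (rule has_integral_eq[rotated])
    then show ?thesis by simp
  qed
  have fc: "integral ?I (\<lambda>y. f y * cos (real k * (y - x))) = Re (of_real (f x) * (if k = 0 then of_real (2 * pi) else 0) + (G (j - 1) - G j))"
    if "\<bar>j\<bar> = int k" for j k
  proof -
    have "cos (of_int j * (y - x)) = cos (real k * (y - x))" for y
    proof (cases "j \<ge> 0")
      case True then show ?thesis using that by simp
    next
      case False
      then have "real_of_int j = - real k" using that by linarith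
      then show ?thesis by simp
    qed
    then have "((\<lambda>y. f y * cos (real k * (y - x))) has_integral
        Re (of_real (f x) * (if j = 0 then of_real (2 * pi) else 0) + (G (j - 1) - G j))) ?I"
      using has_integral_Re[OF fe[of j]] by simp
    moreover have iff: "j = 0 \<longleftrightarrow> k = 0" using that by auto
    ultimately show ?thesis unfolding iff by (intro integral_unique)
  qed
  have sum: "(\<Sum>k\<le>N. fourier_term a k f x) = f x + Re (G (- int N - 1) - G (int N)) / (2 * pi)" for N
  proof (induction N)
    case 0
    show ?case using fc[of 0 0] by (simp add: fourier_term_def field_simps)
  next
    case (Suc N)
    have idx: "int (Suc N) - 1 = int N" "int (Suc N) = int N + 1" "- int (Suc N) - 1 = - int N - 2" "- int (Suc N) = - int N - 1"
      by auto
    have "integral ?I (\<lambda>y. f y * cos (real (Suc N) * (y - x))) = Re (G (int N) - G (int N + 1))"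
      using fc[of "int (Suc N)" "Suc N", unfolded idx(1)] idx(2) by (simp del: of_nat_Suc)
    moreover have "integral ?I (\<lambda>y. f y * cos (real (Suc N) * (y - x))) = Re (G (- int N - 2) - G (- int N - 1))"
      using fc[of "- int (Suc N)" "Suc N", unfolded idx(3)] idx(4) by (simp del: of_nat_Suc)
    ultimately have "2 * integral ?I (\<lambda>y. f y * cos (real (Suc N) * (y - x))) =
        Re (G (int N) - G (int N + 1) + (G (- int N - 2) - G (- int N - 1)))"
      by simp
    then have "fourier_term a (Suc N) f x = Re (G (int N) - G (int N + 1) + (G (- int N - 2) - G (- int N - 1))) / (2 * pi)"
      by (simp add: fourier_term_def field_simps)
    then show ?case using Suc.IH by (simp add: field_simps)
  qed
  have "(\<lambda>N. G (int N)) \<longlonglongrightarrow> 0"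
    unfolding G_def by (rule riemann_lebesgue[OF g]) (simp add: inj_def)
  moreover have "(\<lambda>N. G (- int N - 1)) \<longlonglongrightarrow> 0"
    unfolding G_def by (rule riemann_lebesgue[OF g]) (simp add: inj_def)
  ultimately have "(\<lambda>N. f x + Re (G (- int N - 1) - G (int N)) / (2 * pi)) \<longlonglongrightarrow> f x + Re (0 - 0) / (2 * pi)"
    by (intro tendsto_intros) auto
  then show ?thesis by (simp add: sum)
qed


text \<open>If all derivatives vanish at both ends of the interval, integration by parts has no boundary terms:
  the coefficients decay faster than any power of the frequency, and the Fourier series may be
  differentiated term by term.\<close>

context
  fixes a :: real and f :: "real \<Rightarrow> real"
  assumes f: "smooth f"
    and vanish: "\<And>k. (deriv ^^ k) f a = 0" "\<And>k. (deriv ^^ k) f (a + 2 * pi) = 0"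
begin

abbreviation cos_coeff where
  "cos_coeff j k \<equiv> integral {a..a + 2 * pi} (\<lambda>y. (deriv ^^ j) f y * cos (real k * y))"

abbreviation sin_coeff where
  "sin_coeff j k \<equiv> integral {a..a + 2 * pi} (\<lambda>y. (deriv ^^ j) f y * sin (real k * y))"

lemma fourier_coeff_integrable:
  "(\<lambda>y. (deriv ^^ j) f y * cos (real k * y)) integrable_on {a..a + 2 * pi}"
  "(\<lambda>y. (deriv ^^ j) f y * sin (real k * y)) integrable_on {a..a + 2 * pi}"
  by (intro integrable_continuous_real continuous_intros smooth_continuous f)+

lemma integral_deriv_mult:
  assumes t: "\<And>y. (t has_real_derivative t' y) (at y)" and t': "continuous_on UNIV t'"
  shows "integral {a..a + 2 * pi} (\<lambda>y. (deriv ^^ Suc j) f y * t y) = - integral {a..a + 2 * pi} (\<lambda>y. (deriv ^^ j) f y * t' y)"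
proof -
  let ?I = "{a..a + 2 * pi}"
  have "continuous_on UNIV t" using DERIV_isCont[OF t] by (simp add: continuous_at_imp_continuous_on)
  then have ct: "continuous_on ?I t" by (rule continuous_on_subset) simp
  have ct': "continuous_on ?I t'" using t' by (rule continuous_on_subset) simp
  note int = integrable_continuous_real[OF continuous_on_mult[OF smooth_continuous[OF f, of _ "Suc j"] ct]]
    integrable_continuous_real[OF continuous_on_mult[OF smooth_continuous[OF f, of _ j] ct']]
  have "((\<lambda>y. (deriv ^^ Suc j) f y * t y + (deriv ^^ j) f y * t' y) has_integral
      ((deriv ^^ j) f (a + 2 * pi) * t (a + 2 * pi) - (deriv ^^ j) f a * t a)) ?I"
  proof (rule fundamental_theorem_of_calculus)
    show "((\<lambda>y. (deriv ^^ j) f y * t y) has_vector_derivative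
        (deriv ^^ Suc j) f y * t y + (deriv ^^ j) f y * t' y) (at y within ?I)" for y
      unfolding has_real_derivative_iff_has_vector_derivative[symmetric]
      using DERIV_mult[OF smooth_DERIV[OF f] t]
      by (rule has_field_derivative_at_within[OF DERIV_cong]) (simp del: funpow.simps)
  qed simp
  then have "integral ?I (\<lambda>y. (deriv ^^ Suc j) f y * t y + (deriv ^^ j) f y * t' y) = 0"
    unfolding vanish by (intro integral_unique) (simp del: funpow.simps)
  then show ?thesis unfolding integral_add[OF int] by (simp del: funpow.simps)
qed

lemma cos_coeff_deriv: "cos_coeff (Suc j) k = real k * sin_coeff j k"
proof -
  have "cos_coeff (Suc j) k = - integral {a..a + 2 * pi} (\<lambda>y. (deriv ^^ j) f y * - (real k * sin (real k * y)))"
    by (rule integral_deriv_mult) (auto intro!: derivative_eq_intros continuous_intros)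
  then show ?thesis by (simp add: mult.left_commute del: funpow.simps)
qed

lemma sin_coeff_deriv: "sin_coeff (Suc j) k = - real k * cos_coeff j k"
proof -
  have "sin_coeff (Suc j) k = - integral {a..a + 2 * pi} (\<lambda>y. (deriv ^^ j) f y * (real k * cos (real k * y)))"
    by (rule integral_deriv_mult) (auto intro!: derivative_eq_intros continuous_intros)
  then show ?thesis by (simp add: mult.left_commute del: funpow.simps)
qed

lemma fourier_coeff_bound:
  assumes "\<And>y. \<bar>(deriv ^^ (j + m)) f y\<bar> \<le> B"
  shows "real k ^ m * \<bar>cos_coeff j k\<bar> \<le> 2 * pi * B \<and> real k ^ m * \<bar>sin_coeff j k\<bar> \<le> 2 * pi * B"
  using assms
proof (induction m arbitrary: j)
  case 0
  have B: "0 \<le> B" using 0[of 0] by linarith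
  have "norm (integral {a..a + 2 * pi} (\<lambda>y. (deriv ^^ j) f y * t y)) \<le> B * (a + 2 * pi - a)"
    if "\<And>y. \<bar>t y\<bar> \<le> 1" "continuous_on UNIV t" for t
  proof (rule integral_bound)
    show "norm ((deriv ^^ j) f y * t y) \<le> B" for y
      using mult_mono[OF _ that(1), of "\<bar>(deriv ^^ j) f y\<bar>" B y] 0[of y] B by (simp add: abs_mult)
  qed (use continuous_on_subset[OF that(2)] in \<open>auto intro!: continuous_on_mult smooth_continuous f\<close>)
  from this[of "\<lambda>y. cos (real k * y)"] this[of "\<lambda>y. sin (real k * y)"] show ?case
    by (simp add: mult.commute continuous_intros)
next
  case (Suc m)
  have "real k ^ m * \<bar>cos_coeff (Suc j) k\<bar> \<le> 2 * pi * B \<and> real k ^ m * \<bar>sin_coeff (Suc j) k\<bar> \<le> 2 * pi * B"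
    using Suc.prems by (intro Suc.IH) (simp del: funpow.simps)
  then show ?case unfolding cos_coeff_deriv sin_coeff_deriv by (simp add: abs_mult mult_ac)
qed

lemma fourier_term_eq:
  "fourier_term a k ((deriv ^^ j) f) x =
     (if k = 0 then 1 / (2 * pi) else 1 / pi) * (cos_coeff j k * cos (real k * x) + sin_coeff j k * sin (real k * x))"
proof -
  have "integral {a..a + 2 * pi} (\<lambda>y. (deriv ^^ j) f y * cos (real k * (y - x))) =
      integral {a..a + 2 * pi} (\<lambda>y. (deriv ^^ j) f y * cos (real k * y) * cos (real k * x) + (deriv ^^ j) f y * sin (real k * y) * sin (real k * x))"
    by (simp add: right_diff_distrib cos_diff distrib_left mult.assoc)
  also have "\<dots> = cos_coeff j k * cos (real k * x) + sin_coeff j k * sin (real k * x)"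
    using fourier_coeff_integrable[of j k]
    by (subst integral_add) (auto intro: integrable_on_mult_left)
  finally show ?thesis by (simp add: fourier_term_def)
qed

lemma fourier_term_bound:
  assumes "\<And>y. \<bar>(deriv ^^ (j + 2)) f y\<bar> \<le> B" "k \<noteq> 0"
  shows "\<bar>fourier_term a k ((deriv ^^ j) f) x\<bar> \<le> 4 * B / (real k)\<^sup>2"
proof -
  have c: "(real k)\<^sup>2 * \<bar>cos_coeff j k\<bar> \<le> 2 * pi * B" "(real k)\<^sup>2 * \<bar>sin_coeff j k\<bar> \<le> 2 * pi * B"
    using fourier_coeff_bound[of j 2 B k] assms(1) by auto
  have "\<bar>cos_coeff j k * cos (real k * x) + sin_coeff j k * sin (real k * x)\<bar> \<le> \<bar>cos_coeff j k\<bar> + \<bar>sin_coeff j k\<bar>"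
    using mult_left_mono[OF abs_cos_le_one[of "real k * x"], of "\<bar>cos_coeff j k\<bar>"]
      mult_left_mono[OF abs_sin_le_one[of "real k * x"], of "\<bar>sin_coeff j k\<bar>"]
    by (intro order_trans[OF abs_triangle_ineq] add_mono) (auto simp: abs_mult)
  then have "(real k)\<^sup>2 * \<bar>cos_coeff j k * cos (real k * x) + sin_coeff j k * sin (real k * x)\<bar> \<le>
      (real k)\<^sup>2 * (\<bar>cos_coeff j k\<bar> + \<bar>sin_coeff j k\<bar>)" by (intro mult_left_mono) auto
  also have "\<dots> \<le> 4 * pi * B" using c by (simp add: distrib_left)
  finally show ?thesis
    using assms(2) by (simp add: fourier_term_eq abs_mult field_simps)
qed

text \<open>The remainder is uniform in \<open>x\<close>: the tail of \<open>1 / k\<^sup>2\<close> is dominated by the telescoping sum of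
  \<open>1 / (k - 1) - 1 / k\<close>.\<close>

lemma fourier_partial_sum_error:
  assumes "\<And>y. \<bar>(deriv ^^ (j + 2)) f y\<bar> \<le> B" "x \<in> {a<..<a + 2 * pi}" "N \<ge> 1"
  shows "\<bar>(deriv ^^ j) f x - (\<Sum>k\<le>N. fourier_term a k ((deriv ^^ j) f) x)\<bar> \<le> 4 * B / real N"
proof -
  let ?s = "\<lambda>N. \<Sum>k\<le>N. fourier_term a k ((deriv ^^ j) f) x"
  have B: "0 \<le> B" using assms(1)[of 0] by linarith
  have "\<bar>?s (N + M) - ?s N\<bar> \<le> 4 * B * (1 / real N - 1 / real (N + M))" for M
  proof (induction M)
    case (Suc M)
    have "\<bar>fourier_term a (Suc (N + M)) ((deriv ^^ j) f) x\<bar> \<le> 4 * B / (real (Suc (N + M)))\<^sup>2"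
      using fourier_term_bound[OF assms(1)] by blast
    also have "\<dots> \<le> 4 * B * (1 / real (N + M) - 1 / real (N + Suc M))"
    proof -
      have "1 / (real (Suc (N + M)))\<^sup>2 \<le> 1 / real (N + M) - 1 / real (N + Suc M)"
      proof -
        define q where "q = real (N + M)"
        have q: "q > 0" using assms(3) by (simp add: q_def)
        have "1 / (q + 1)\<^sup>2 \<le> 1 / (q * (q + 1))"
          using q by (intro divide_left_mono) (auto simp: power2_eq_square)
        also have "\<dots> = 1 / q - 1 / (q + 1)" using q by (simp add: field_simps)
        finally show ?thesis by (simp add: q_def add.commute add.left_commute)
      qed
      from mult_left_mono[OF this, of "4 * B"] B show ?thesis by simp
    qed
    finally show ?case using Suc.IH by (simp add: algebra_simps)
  qed simp
  also have "4 * B * (1 / real N - 1 / real (N + M)) \<le> 4 * B * (1 / real N)" for M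
    using B by (intro mult_left_mono) auto
  finally have le: "\<bar>?s (N + M) - ?s N\<bar> \<le> 4 * B / real N" for M
    by simp
  have "(\<lambda>M. \<bar>?s (M + N) - ?s N\<bar>) \<longlonglongrightarrow> \<bar>(deriv ^^ j) f x - ?s N\<bar>"
    by (intro tendsto_intros LIMSEQ_ignore_initial_segment[OF fourier_inversion[OF smooth_higher_deriv[OF f] assms(2)]])
  then show ?thesis
    by (rule Lim_bounded[where M = 0]) (use le in \<open>auto simp: add.commute\<close>)
qed

lemma higher_deriv_fourier_term:
  "smooth (fourier_term a k f) \<and> (deriv ^^ j) (fourier_term a k f) = fourier_term a k ((deriv ^^ j) f)"
proof -
  have eq: "fourier_term a k ((deriv ^^ j) f) = (\<lambda>x. ((if k = 0 then 1 / (2 * pi) else 1 / pi) * cos_coeff j k) * cos (real k * x)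
      + ((if k = 0 then 1 / (2 * pi) else 1 / pi) * sin_coeff j k) * sin (real k * x))" for j
    by (simp add: fun_eq_iff fourier_term_eq distrib_left mult.assoc)
  have "smooth (fourier_term a k f)"
    using eq[of 0] by (simp add: smooth_lincomb smooth_cos smooth_sin)
  moreover have "(deriv ^^ j) (fourier_term a k f) = fourier_term a k ((deriv ^^ j) f)"
  proof (induction j)
    case (Suc j)
    have "(fourier_term a k ((deriv ^^ j) f) has_real_derivative fourier_term a k ((deriv ^^ Suc j) f) x) (at x)" for x
      unfolding eq cos_coeff_deriv sin_coeff_deriv
      by (rule derivative_eq_intros refl)+ (simp add: algebra_simps)
    then have "deriv (fourier_term a k ((deriv ^^ j) f)) = fourier_term a k ((deriv ^^ Suc j) f)"
      by (intro ext DERIV_imp_deriv)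
    then show ?case using Suc.IH by simp
  qed simp
  ultimately show ?thesis by blast
qed

end

subsection \<open>Temperedness from Fourier modes\<close>

text \<open>A test function supported in \<open>[n, n + 2]\<close> equals its Fourier series multiplied by the plateau, with
  convergence in the space of test functions supported in \<open>[n - 1, n + 3]\<close>. Polynomial bounds on the
  values of \<open>T\<close> at the modes are summed against the rapidly decreasing coefficients, which are
  controlled by finitely many derivatives of the function.\<close>

lemma tempered_if_trig_bounds:
  assumes T: "T \<in> generalized_functions" and C: "C \<ge> 0"
    and cosb: "\<And>n k. \<bar>T (\<lambda>x. cos (real k * x) * plateau n x)\<bar> \<le> C * (1 + \<bar>of_int n\<bar>) ^ p * (1 + real k) ^ p"
    and sinb: "\<And>n k. \<bar>T (\<lambda>x. sin (real k * x) * plateau n x)\<bar> \<le> C * (1 + \<bar>of_int n\<bar>) ^ p * (1 + real k) ^ p"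
  shows "T \<in> tempered_generalized_functions"
proof -
  define S where "S = (\<Sum>k. 1 / (real (Suc k))\<^sup>2)"
  note sq = summable_inverse_squares
  have S: "S \<ge> 0" unfolding S_def by (intro suminf_nonneg sq) auto
  show ?thesis
  proof (rule tempered_if_local_bounds[OF T])
    show "0 \<le> 2 ^ (p + 4) * C * S" using C S by simp
    fix n :: int and f B
    assume fK: "f \<in> test_functions_on {of_int n..of_int n + 2}"
      and B: "\<And>\<beta> x. \<beta> \<le> p + 2 \<Longrightarrow> \<bar>(deriv ^^ \<beta>) f x\<bar> \<le> B"
    have ft: "f \<in> test_functions" using fK by (simp add: test_functions_on_def)
    have f: "smooth f" by (rule test_smooth[OF ft])
    have f0: "f x = 0" if "x \<notin> {of_int n..of_int n + 2}" for x
      using fK that by (auto simp: test_functions_on_def)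
    \<comment> \<open>The interval of length \<open>2 * pi > 6\<close> that begins here has \<open>[n - 1, n + 3]\<close> in its interior.\<close>
    define a where "a = real_of_int n - 3 / 2"
    have van: "(deriv ^^ k) f a = 0" "(deriv ^^ k) f (a + 2 * pi) = 0" for k
    proof -
      have z: "(deriv ^^ k) f x = 0" if "x \<notin> {of_int n..of_int n + 2}" for x
        by (rule higher_deriv_zero_outside[OF closed_atLeastAtMost _ that]) (rule f0)
      show "(deriv ^^ k) f a = 0" by (rule z) (auto simp: a_def)
      show "(deriv ^^ k) f (a + 2 * pi) = 0" by (rule z) (use pi_gt3 in \<open>auto simp: a_def\<close>)
    qed
    have inside: "x \<in> {a<..<a + 2 * pi}" if "x \<in> {of_int n - 1..of_int n + 3}" for x
      using that pi_gt3 by (auto simp: a_def)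
    note four = f van
    let ?t = "\<lambda>k. fourier_term a k f"
    have t_smooth: "smooth (?t k)" for k using higher_deriv_fourier_term[OF four] by blast
    have t_deriv: "(deriv ^^ j) (?t k) = fourier_term a k ((deriv ^^ j) f)" for j k
      using higher_deriv_fourier_term[OF four] by blast
    define s where "s N x = (\<Sum>k\<le>N. ?t k x)" for N x
    have s_smooth: "smooth (s N)" for N unfolding s_def by (intro smooth_sum t_smooth)
    have s_deriv: "(deriv ^^ j) (s N) x = (\<Sum>k\<le>N. fourier_term a k ((deriv ^^ j) f) x)" for N j x
      unfolding s_def by (simp add: higher_deriv_sum t_smooth t_deriv)
    define g where "g N x = s N x * plateau n x" for N x
    let ?K = "{real_of_int n - 1..of_int n + 3}"
    have g_on: "g N \<in> test_functions_on ?K" for N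
      unfolding g_def by (rule test_functions_onI)
        (auto intro!: smooth_mult s_smooth test_smooth[OF plateau_test] simp: plateau_zero)
    have f_on: "f \<in> test_functions_on ?K"
      using fK by (auto simp: test_functions_on_def)
    have diff_eq: "(\<lambda>x. g N x - f x) = (\<lambda>x. (s N x - f x) * plateau n x)" for N
      using f0 plateau_one[of _ n] by (fastforce simp: g_def fun_eq_iff algebra_simps)
    have lim: "(\<lambda>N. schwartz_seminorm 0 \<beta> (\<lambda>x. g N x - f x)) \<longlonglongrightarrow> 0" for \<beta>
    proof -
      obtain D where D: "D > 0" "\<And>i x. i \<le> \<beta> + 2 \<Longrightarrow> \<bar>(deriv ^^ i) f x\<bar> \<le> D"
        using test_higher_deriv_bounded_upto[OF ft] by metis
      obtain A where A: "A > 0" "\<And>i x. i \<le> \<beta> \<Longrightarrow> \<bar>(deriv ^^ i) (plateau n) x\<bar> \<le> A"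
        using test_higher_deriv_bounded_upto[OF plateau_test] by metis
      have bound: "\<bar>(deriv ^^ \<beta>) (\<lambda>x. g N x - f x) x\<bar> \<le> 2 ^ \<beta> * (4 * D / real N * A)" if N: "N \<ge> 1" for N x
      proof (cases "x \<in> ?K")
        case True
        show ?thesis unfolding diff_eq
        proof (rule higher_deriv_mult_bound)
          fix i assume i: "i \<le> \<beta>"
          have "(deriv ^^ i) (\<lambda>x. s N x - f x) x = (\<Sum>k\<le>N. fourier_term a k ((deriv ^^ i) f) x) - (deriv ^^ i) f x"
            by (simp add: higher_deriv_diff s_smooth f s_deriv)
          moreover have "\<bar>(deriv ^^ i) f x - (\<Sum>k\<le>N. fourier_term a k ((deriv ^^ i) f) x)\<bar> \<le> 4 * D / real N"
            using D(2)[of "i + 2"] i by (intro fourier_partial_sum_error[OF four _ inside[OF True] N]) simp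
          ultimately show "\<bar>(deriv ^^ i) (\<lambda>x. s N x - f x) x\<bar> \<le> 4 * D / real N" by (simp add: abs_minus_commute)
          show "\<bar>(deriv ^^ i) (plateau n) x\<bar> \<le> A" by (rule A(2)[OF i])
        qed (intro smooth_diff s_smooth f test_smooth[OF plateau_test])+
      next
        case False
        have "(deriv ^^ \<beta>) (\<lambda>x. g N x - f x) x = 0"
          unfolding diff_eq by (rule higher_deriv_zero_outside[OF _ _ False]) (simp_all add: plateau_zero)
        then show ?thesis using D(1) A(1) by simp
      qed
      have "(\<lambda>N. 2 ^ \<beta> * (4 * D / real N * A)) \<longlonglongrightarrow> 2 ^ \<beta> * (0 * A)"
        by (intro tendsto_intros lim_const_over_n)
      then have upper: "(\<lambda>N. 2 ^ \<beta> * (4 * D / real N * A)) \<longlonglongrightarrow> 0" by simp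
      have le: "eventually (\<lambda>N. schwartz_seminorm 0 \<beta> (\<lambda>x. g N x - f x) \<le> 2 ^ \<beta> * (4 * D / real N * A)) sequentially"
        using eventually_ge_at_top[of 1]
        by eventually_elim (rule schwartz_seminorm_le, use bound in \<open>simp add: schwartz_weight_def\<close>)
      have "g N \<in> schwartz_functions" "f \<in> schwartz_functions" for N
        using g_on[of N] ft test_functions_subset_schwartz by (auto simp: test_functions_on_def)
      then have ge: "eventually (\<lambda>N. 0 \<le> schwartz_seminorm 0 \<beta> (\<lambda>x. g N x - f x)) sequentially"
        by (intro always_eventually allI schwartz_seminorm_nonneg schwartz_functions_diff) auto
      show ?thesis by (rule real_tendsto_sandwich[OF ge le tendsto_const upper])
    qed
    have Tg: "(\<lambda>N. T (g N)) \<longlonglongrightarrow> T f"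
      by (rule generalized_function_LIMSEQ[OF T compact_Icc g_on f_on lim])
    have B0: "0 \<le> B" using B[of 0 0] by simp
    let ?w = "1 + \<bar>real_of_int n\<bar>"
    have cs_test: "(\<lambda>x. cos (real k * x) * plateau n x) \<in> test_functions"
      "(\<lambda>x. sin (real k * x) * plateau n x) \<in> test_functions" for k
      by (intro test_functions_mult plateau_test smooth_cos smooth_sin)+
    have summand: "\<bar>T (\<lambda>x. ?t k x * plateau n x)\<bar> \<le> 2 ^ (p + 4) * C * ?w ^ p * B * (1 / (real (Suc k))\<^sup>2)" for k
    proof -
      define w where "w = (if k = 0 then 1 / (2 * pi) else 1 / pi)"
      have w: "0 \<le> w" "w \<le> 1 / pi" by (auto simp: w_def field_simps)
      define A where "A = integral {a..a + 2 * pi} (\<lambda>y. (deriv ^^ 0) f y * cos (real k * y))"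
      define A' where "A' = integral {a..a + 2 * pi} (\<lambda>y. (deriv ^^ 0) f y * sin (real k * y))"
      have "real k ^ (p + 2) * \<bar>A\<bar> \<le> 2 * pi * B \<and> real k ^ (p + 2) * \<bar>A'\<bar> \<le> 2 * pi * B"
        unfolding A_def A'_def using B[of "p + 2"] by (intro fourier_coeff_bound[OF four]) simp
      moreover have "real k ^ 0 * \<bar>A\<bar> \<le> 2 * pi * B \<and> real k ^ 0 * \<bar>A'\<bar> \<le> 2 * pi * B"
        unfolding A_def A'_def using B[of 0] by (intro fourier_coeff_bound[OF four]) simp
      moreover have "(1 + real k) ^ (p + 2) * X \<le> 2 ^ (p + 2) * (2 * pi * B)"
        if "0 \<le> X" "real k ^ (p + 2) * X \<le> 2 * pi * B" "real k ^ 0 * X \<le> 2 * pi * B" for X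
      proof (cases "k = 0")
        case True
        have "1 * X \<le> 2 ^ (p + 2) * (2 * pi * B)"
          using that by (intro mult_mono one_le_power) auto
        then show ?thesis using True by simp
      next
        case False
        have "(1 + real k) ^ (p + 2) \<le> 2 ^ (p + 2) * real k ^ (p + 2)"
          unfolding power_mult_distrib[symmetric] using False by (intro power_mono) auto
        from mult_right_mono[OF this that(1)]
        have "(1 + real k) ^ (p + 2) * X \<le> 2 ^ (p + 2) * (real k ^ (p + 2) * X)" by (simp add: mult.assoc)
        also have "\<dots> \<le> 2 ^ (p + 2) * (2 * pi * B)" using that(2) by (intro mult_left_mono) auto
        finally show ?thesis .
      qed
      ultimately have AA: "(1 + real k) ^ (p + 2) * \<bar>A\<bar> \<le> 2 ^ (p + 2) * (2 * pi * B)"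
        "(1 + real k) ^ (p + 2) * \<bar>A'\<bar> \<le> 2 ^ (p + 2) * (2 * pi * B)" by auto
      have "(\<lambda>x. ?t k x * plateau n x) =
          (\<lambda>x. (w * A) * (cos (real k * x) * plateau n x) + (w * A') * (sin (real k * x) * plateau n x))"
        using fourier_term_eq[OF four, of k 0] by (simp add: fun_eq_iff w_def A_def A'_def algebra_simps)
      then have "T (\<lambda>x. ?t k x * plateau n x) =
          (w * A) * T (\<lambda>x. cos (real k * x) * plateau n x) + (w * A') * T (\<lambda>x. sin (real k * x) * plateau n x)"
        using generalized_function_lincomb[OF T cs_test[of k]] by simp
      also have "\<bar>\<dots>\<bar> \<le> w * \<bar>A\<bar> * (C * ?w ^ p * (1 + real k) ^ p) + w * \<bar>A'\<bar> * (C * ?w ^ p * (1 + real k) ^ p)"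
        using mult_left_mono[OF cosb[of k n], of "w * \<bar>A\<bar>"] mult_left_mono[OF sinb[of k n], of "w * \<bar>A'\<bar>"] w(1)
        by (intro order_trans[OF abs_triangle_ineq] add_mono) (auto simp: abs_mult)
      also have "\<dots> = w * (C * ?w ^ p * (((1 + real k) ^ (p + 2) * \<bar>A\<bar> + (1 + real k) ^ (p + 2) * \<bar>A'\<bar>) / (1 + real k)\<^sup>2))"
      proof -
        have "1 + real k \<noteq> 0" by linarith
        then have *: "(1 + real k) ^ p = (1 + real k) ^ (p + 2) / (1 + real k)\<^sup>2"
          by (simp add: power_add power2_eq_square)
        have "w * X * (c * (Y / Z)) + w * X' * (c * (Y / Z)) = w * (c * ((Y * X + Y * X') / Z))" for X X' Y Z c :: real
          by (simp add: algebra_simps add_divide_distrib)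
        then show ?thesis unfolding * by blast
      qed
      also have "\<dots> \<le> (1 / pi) * (C * ?w ^ p * ((2 ^ (p + 2) * (2 * pi * B) + 2 ^ (p + 2) * (2 * pi * B)) / (1 + real k)\<^sup>2))"
      proof (rule mult_mono[OF w(2) mult_left_mono[OF divide_right_mono[OF add_mono[OF AA]]]])
        show "0 \<le> C * ?w ^ p * (((1 + real k) ^ (p + 2) * \<bar>A\<bar> + (1 + real k) ^ (p + 2) * \<bar>A'\<bar>) / (1 + real k)\<^sup>2)"
          using C by (intro mult_nonneg_nonneg divide_nonneg_nonneg add_nonneg_nonneg) auto
      qed (use C in auto)
      also have "\<dots> = 2 ^ (p + 4) * C * ?w ^ p * B * (1 / (real (Suc k))\<^sup>2)"
        by (simp add: power_add add.commute)
      finally show ?thesis .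
    qed
    have "\<bar>T (g N)\<bar> \<le> 2 ^ (p + 4) * C * S * ?w ^ p * B" for N
    proof -
      have "T (g N) = (\<Sum>k\<le>N. T (\<lambda>x. ?t k x * plateau n x))"
      proof -
        have "g N = (\<lambda>x. \<Sum>k\<le>N. ?t k x * plateau n x)" by (simp add: g_def s_def sum_distrib_right fun_eq_iff)
        then show ?thesis
          by (simp add: generalized_function_sum[OF T] test_functions_mult plateau_test t_smooth)
      qed
      also have "\<bar>\<dots>\<bar> \<le> (\<Sum>k\<le>N. 2 ^ (p + 4) * C * ?w ^ p * B * (1 / (real (Suc k))\<^sup>2))"
        by (intro order_trans[OF sum_abs] sum_mono summand)
      also have "\<dots> = 2 ^ (p + 4) * C * ?w ^ p * B * (\<Sum>k\<le>N. 1 / (real (Suc k))\<^sup>2)"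
        by (simp add: sum_distrib_left)
      also have "\<dots> \<le> 2 ^ (p + 4) * C * ?w ^ p * B * S"
        unfolding S_def using C B0 by (intro mult_left_mono sum_le_suminf sq) auto
      finally show ?thesis by (simp add: mult_ac)
    qed
    moreover have "(\<lambda>N. \<bar>T (g N)\<bar>) \<longlonglongrightarrow> \<bar>T f\<bar>" by (intro tendsto_intros Tg)
    ultimately show "\<bar>T f\<bar> \<le> 2 ^ (p + 4) * C * S * ?w ^ p * B"
      by (intro Lim_bounded[where M = 0]) auto
  qed
qed

section \<open>Dyadic shells and fractional moments\<close>

lemma dyadic_shell_exists:
  assumes "1 \<le> (y::real)"
  obtains k :: nat where "2 ^ k \<le> y" "y < 2 ^ Suc k"
proof -
  obtain n where n: "y < 2 ^ n" using real_arch_pow[of 2 y] by auto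
  define m where "m = (LEAST n. y < 2 ^ n)"
  have m: "y < 2 ^ m" unfolding m_def by (rule LeastI[of "\<lambda>n. y < 2 ^ n", OF n])
  then obtain k where k: "m = Suc k" using assms by (cases m) auto
  have "\<not> y < 2 ^ k" using not_less_Least[of k "\<lambda>n. y < 2 ^ n"] k by (simp add: m_def)
  then show ?thesis using that[of k] m k by simp
qed

text \<open>Moments are read off from the masses of dyadic shells. The bound is explicit because the moments
  of infinitely many random variables have to be bounded simultaneously.\<close>

lemma nn_integral_powr_dyadic:
  fixes f :: "'a \<Rightarrow> real"
  assumes f[measurable]: "f \<in> borel_measurable m" and D: "D \<ge> 0" and eps: "\<epsilon> < \<eta>" "0 \<le> \<epsilon>"
    and shell: "\<And>k. emeasure m {x \<in> space m. 2 ^ k \<le> \<bar>f x\<bar> \<and> \<bar>f x\<bar> < 2 ^ Suc k} \<le> ennreal (D * 2 powr (- (real k * \<eta>)))"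
  shows "(\<integral>\<^sup>+x\<in>{x. 1 \<le> \<bar>f x\<bar>}. ennreal (\<bar>f x\<bar> powr \<epsilon>) \<partial>m) \<le> ennreal (D * 2 powr \<epsilon> / (1 - 2 powr (\<epsilon> - \<eta>)))"
proof -
  define E where "E k = {x \<in> space m. 2 ^ k \<le> \<bar>f x\<bar> \<and> \<bar>f x\<bar> < 2 ^ Suc k}" for k :: nat
  have E[measurable]: "E k \<in> sets m" for k unfolding E_def by measurable
  have "(\<integral>\<^sup>+x\<in>{x. 1 \<le> \<bar>f x\<bar>}. ennreal (\<bar>f x\<bar> powr \<epsilon>) \<partial>m) \<le>
      (\<integral>\<^sup>+x. (\<Sum>k. ennreal (2 powr (real (Suc k) * \<epsilon>)) * indicator (E k) x) \<partial>m)"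
  proof (rule nn_integral_mono)
    fix x assume x: "x \<in> space m"
    show "ennreal (\<bar>f x\<bar> powr \<epsilon>) * indicator {x. 1 \<le> \<bar>f x\<bar>} x \<le> (\<Sum>k. ennreal (2 powr (real (Suc k) * \<epsilon>)) * indicator (E k) x)"
    proof (cases "1 \<le> \<bar>f x\<bar>")
      case True
      then obtain k where k: "2 ^ k \<le> \<bar>f x\<bar>" "\<bar>f x\<bar> < 2 ^ Suc k" by (rule dyadic_shell_exists)
      have "\<bar>f x\<bar> powr \<epsilon> \<le> (2 powr real (Suc k)) powr \<epsilon>"
        using k eps by (intro powr_mono2) (simp_all add: powr_realpow del: power_Suc of_nat_Suc)
      then have "ennreal (\<bar>f x\<bar> powr \<epsilon>) * indicator {x. 1 \<le> \<bar>f x\<bar>} x \<le> ennreal (2 powr (real (Suc k) * \<epsilon>)) * indicator (E k) x"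
        using True x k by (simp add: E_def powr_powr ennreal_leI del: of_nat_Suc)
      also have "\<dots> \<le> (\<Sum>k. ennreal (2 powr (real (Suc k) * \<epsilon>)) * indicator (E k) x)"
      proof -
        have "sum g {k} \<le> suminf g" for g :: "nat \<Rightarrow> ennreal" by (rule sum_le_suminf) auto
        then show ?thesis by (simp only: sum.insert finite.emptyI sum.empty empty_iff if_False not_False_eq_True add_0_right)
      qed
      finally show ?thesis .
    qed simp
  qed
  also have "\<dots> = (\<Sum>k. ennreal (2 powr (real (Suc k) * \<epsilon>)) * emeasure m (E k))"
    by (subst nn_integral_suminf) (auto simp: nn_integral_cmult_indicator)
  also have "\<dots> \<le> (\<Sum>k. ennreal (2 powr (real (Suc k) * \<epsilon>) * (D * 2 powr (- (real k * \<eta>)))))"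
    using shell by (intro suminf_le) (auto simp: E_def ennreal_mult D intro!: mult_left_mono)
  also have "\<dots> = (\<Sum>k. ennreal (D * 2 powr \<epsilon> * (2 powr (\<epsilon> - \<eta>)) ^ k))"
  proof -
    have "2 powr (real (Suc k) * \<epsilon>) * (D * 2 powr (- (real k * \<eta>))) = D * 2 powr \<epsilon> * (2 powr (\<epsilon> - \<eta>)) ^ k" for k
    proof -
      have "(2 powr (\<epsilon> - \<eta>)) ^ k = 2 powr (real k * (\<epsilon> - \<eta>))"
        by (simp add: powr_realpow[symmetric] powr_powr mult.commute)
      moreover have "2 powr (real (Suc k) * \<epsilon>) * 2 powr (- (real k * \<eta>)) = 2 powr \<epsilon> * 2 powr (real k * (\<epsilon> - \<eta>))"
        by (simp add: powr_add[symmetric] algebra_simps)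
      ultimately show ?thesis by (simp add: mult_ac)
    qed
    then show ?thesis by (simp only:)
  qed
  also have "\<dots> = ennreal (\<Sum>k. D * 2 powr \<epsilon> * (2 powr (\<epsilon> - \<eta>)) ^ k)"
  proof (rule suminf_ennreal2)
    show "summable (\<lambda>k. D * 2 powr \<epsilon> * (2 powr (\<epsilon> - \<eta>)) ^ k)"
      using eps by (intro summable_mult summable_geometric) (simp add: powr_less_one)
  qed (simp add: D)
  also have "(\<Sum>k. D * 2 powr \<epsilon> * (2 powr (\<epsilon> - \<eta>)) ^ k) = D * 2 powr \<epsilon> * (1 / (1 - 2 powr (\<epsilon> - \<eta>)))"
    using eps by (subst suminf_mult) (auto simp: suminf_geometric powr_less_one intro!: summable_geometric)
  finally show ?thesis by simp
qed

section \<open>Characteristic exponents\<close>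

lemma one_minus_cos_lower:
  assumes "3 / 4 \<le> \<bar>y\<bar>" "\<bar>y\<bar> \<le> (2::real)"
  shows "1 - cos (3 / 4) \<le> 1 - cos y"
proof -
  have "cos \<bar>y\<bar> \<le> cos (3 / 4)" using assms pi_gt3 by (intro cos_monotone_0_pi_le) auto
  then show ?thesis by simp
qed

lemma one_minus_cos_pos: "0 < 1 - cos (3 / 4 :: real)"
  using cos_monotone_0_pi[of 0 "3 / 4"] pi_gt3 by simp

definition levy_integrand :: "real \<Rightarrow> real \<Rightarrow> complex" where
  "levy_integrand \<xi> t = iexp (\<xi> * t) - 1 - \<i> * of_real (\<xi> * t * indicator {t. \<bar>t\<bar> < 1} t)"

lemma levy_khintchine_eq:
  "levy_khintchine \<mu> \<sigma> \<nu> \<xi> = \<i> * of_real (\<mu> * \<xi>) - of_real (\<sigma>\<^sup>2 * \<xi>\<^sup>2 / 2) + (LINT t|\<nu>. levy_integrand \<xi> t)"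
  by (simp add: levy_khintchine_def levy_integrand_def)

lemma cmod_iexp_minus_one_le: "cmod (iexp x - 1) \<le> \<bar>x\<bar>" "cmod (iexp x - 1) \<le> 2"
  using iexp_approx1[of x 0] iexp_approx2[of x 0] by simp_all

lemma cmod_iexp_minus_one_le_powr:
  assumes "0 \<le> \<epsilon>" "\<epsilon> \<le> 1" shows "cmod (iexp x - 1) \<le> 2 * \<bar>x\<bar> powr \<epsilon>"
proof (cases "x = 0")
  case False
  show ?thesis
  proof (cases "\<bar>x\<bar> \<le> 1")
    case True
    have "\<bar>x\<bar> = \<bar>x\<bar> powr 1" using False by simp
    also have "\<dots> \<le> \<bar>x\<bar> powr \<epsilon>" using True False assms by (intro powr_mono') auto
    finally show ?thesis using cmod_iexp_minus_one_le(1)[of x] by (smt (verit) powr_ge_zero)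
  next
    case False
    then have "1 \<le> \<bar>x\<bar> powr \<epsilon>" using assms by (intro ge_one_powr_ge_zero) auto
    then show ?thesis using cmod_iexp_minus_one_le(2)[of x] by linarith
  qed
qed simp

lemma levy_integrand_small: "\<bar>t\<bar> < 1 \<Longrightarrow> cmod (levy_integrand \<xi> t) \<le> \<xi>\<^sup>2 * t\<^sup>2"
proof -
  assume t: "\<bar>t\<bar> < 1"
  have "cmod (levy_integrand \<xi> t) \<le> \<bar>\<xi> * t\<bar>\<^sup>2 / 2"
    using iexp_approx1[of "\<xi> * t" 1] t by (simp add: levy_integrand_def algebra_simps power2_eq_square)
  also have "\<bar>\<xi> * t\<bar>\<^sup>2 / 2 \<le> \<xi>\<^sup>2 * t\<^sup>2" by (simp add: power_mult_distrib)
  finally show ?thesis .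
qed

lemma levy_integrand_large: "1 \<le> \<bar>t\<bar> \<Longrightarrow> levy_integrand \<xi> t = iexp (\<xi> * t) - 1"
  by (simp add: levy_integrand_def)

lemma levy_integrand_bound: "cmod (levy_integrand \<xi> t) \<le> (2 + \<xi>\<^sup>2) * min 1 (t\<^sup>2)"
proof (cases "\<bar>t\<bar> < 1")
  case True
  have "t\<^sup>2 \<le> 1" using True by (simp add: abs_square_le_1 less_imp_le)
  then show ?thesis using levy_integrand_small[OF True, of \<xi>]
    by (simp add: min_def distrib_right) (smt (verit) zero_le_power2)
next
  case False
  then have "1\<^sup>2 \<le> \<bar>t\<bar>\<^sup>2" by (intro power_mono) auto
  then have "1 \<le> t\<^sup>2" by simp
  then show ?thesis using False cmod_iexp_minus_one_le(2)[of "\<xi> * t"]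
    by (simp add: levy_integrand_large min_def) (smt (verit) zero_le_power2)
qed

lemma levy_integrand_measurable[measurable]: "levy_integrand \<xi> \<in> borel_measurable borel"
  unfolding levy_integrand_def[abs_def] by measurable

lemma Re_levy_integrand: "Re (levy_integrand \<xi> t) = - (1 - cos (\<xi> * t))"
  by (simp add: levy_integrand_def Re_exp)

locale levy_exponent =
  fixes \<nu> :: "real measure" and \<mu> \<sigma> :: real and \<Psi> :: "real \<Rightarrow> complex"
  assumes levy: "levy_measure \<nu>" and \<Psi>_def: "\<Psi> = levy_khintchine \<mu> \<sigma> \<nu>"
begin

abbreviation fractional_moment :: bool where
  "fractional_moment \<equiv> \<exists>\<epsilon>>0. (\<integral>\<^sup>+ t\<in>{t. 1 \<le> \<bar>t\<bar>}. ennreal (\<bar>t\<bar> powr \<epsilon>) \<partial>\<nu>) < \<infinity>"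

lemma sets_\<nu>: "sets \<nu> = sets (restrict_space borel (UNIV - {0}))"
  using levy by (simp add: levy_measure_def radon_measure_on_def)

lemma space_\<nu>: "space \<nu> = UNIV - {0}"
  using sets_eq_imp_space_eq[OF sets_\<nu>] by (simp add: space_restrict_space)

lemma measurable_\<nu>[measurable (raw)]: "f \<in> borel_measurable borel \<Longrightarrow> f \<in> borel_measurable \<nu>"
  using measurable_cong_sets[OF sets_\<nu> refl] measurable_restrict_space1 by blast

lemma sets_\<nu>I: "A \<in> sets borel \<Longrightarrow> {t \<in> space \<nu>. t \<in> A} \<in> sets \<nu>"
  unfolding sets_\<nu> space_\<nu> by (auto simp: sets_restrict_space)

lemma integrable_min: "integrable \<nu> (\<lambda>t. min 1 (t\<^sup>2))"
  using levy by (intro integrableI_bounded measurable_\<nu>) (auto simp: levy_measure_def abs_of_nonneg)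

lemma integrable_\<nu>I:
  fixes f :: "real \<Rightarrow> 'b::{banach, second_countable_topology}"
  assumes "f \<in> borel_measurable borel" "\<And>t. norm (f t) \<le> C * min 1 (t\<^sup>2)"
  shows "integrable \<nu> f"
  by (rule Bochner_Integration.integrable_bound[OF integrable_mult_right[OF integrable_min, of C] measurable_\<nu>[OF assms(1)]])
     (use assms(2) order_trans[OF _ abs_ge_self] in auto)

lemma integrable_levy: "integrable \<nu> (levy_integrand \<xi>)"
  by (rule integrable_\<nu>I[OF levy_integrand_measurable levy_integrand_bound])

lemma integrable_one_minus_cos: "integrable \<nu> (\<lambda>t. 1 - cos (\<xi> * t))"
  using integrable_Re[OF integrable_levy[of \<xi>]] Bochner_Integration.integrable_minus
  unfolding Re_levy_integrand by fastforce

lemma \<Psi>_eq: "\<Psi> \<xi> = \<i> * of_real (\<mu> * \<xi>) - of_real (\<sigma>\<^sup>2 * \<xi>\<^sup>2 / 2) + (LINT t|\<nu>. levy_integrand \<xi> t)"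
  by (simp add: \<Psi>_def levy_khintchine_eq)

lemma Re_\<Psi>: "- Re (\<Psi> \<xi>) = \<sigma>\<^sup>2 * \<xi>\<^sup>2 / 2 + (LINT t|\<nu>. 1 - cos (\<xi> * t))"
proof -
  have "Re (LINT t|\<nu>. levy_integrand \<xi> t) = (LINT t|\<nu>. - (1 - cos (\<xi> * t)))"
    using integral_Re[OF integrable_levy, of \<xi>] unfolding Re_levy_integrand by simp
  also have "\<dots> = - (LINT t|\<nu>. 1 - cos (\<xi> * t))"
    by (rule Bochner_Integration.integral_minus)
  finally show ?thesis by (simp add: \<Psi>_eq)
qed

lemma Re_\<Psi>_ge: "(LINT t|\<nu>. 1 - cos (\<xi> * t)) \<le> - Re (\<Psi> \<xi>)"
  unfolding Re_\<Psi> by simp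

lemma Re_\<Psi>_nonpos: "Re (\<Psi> \<xi>) \<le> 0"
proof -
  have "0 \<le> (LINT t|\<nu>. 1 - cos (\<xi> * t))" by (rule Bochner_Integration.integral_nonneg) simp
  then show ?thesis using Re_\<Psi>_ge[of \<xi>] by linarith
qed

lemma \<Psi>_zero: "\<Psi> 0 = 0"
  by (simp add: \<Psi>_eq levy_integrand_def)

lemma continuous_\<Psi>: "continuous_on UNIV \<Psi>"
proof -
  have "(\<lambda>n. LINT t|\<nu>. levy_integrand (x n) t) \<longlonglongrightarrow> (LINT t|\<nu>. levy_integrand a t)"
    if x: "x \<longlonglongrightarrow> a" for x :: "nat \<Rightarrow> real" and a
  proof -
    obtain K where K: "\<And>n. \<bar>x n\<bar> \<le> K"
      using convergent_imp_Bseq[OF convergentI[OF x]] by (auto simp: Bseq_def)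
    show ?thesis
    proof (rule integral_dominated_convergence[where w = "\<lambda>t. (2 + K\<^sup>2) * min 1 (t\<^sup>2)"])
      show "integrable \<nu> (\<lambda>t. (2 + K\<^sup>2) * min 1 (t\<^sup>2))" by (intro integrable_mult_right integrable_min)
      show "AE t in \<nu>. (\<lambda>n. levy_integrand (x n) t) \<longlonglongrightarrow> levy_integrand a t"
        unfolding levy_integrand_def by (intro AE_I2 tendsto_intros x)
      show "AE t in \<nu>. norm (levy_integrand (x n) t) \<le> (2 + K\<^sup>2) * min 1 (t\<^sup>2)" for n
      proof (rule AE_I2)
        fix t
        have "(x n)\<^sup>2 \<le> K\<^sup>2" using power_mono[OF K[of n], of 2] by simp
        then have "(2 + (x n)\<^sup>2) * min 1 (t\<^sup>2) \<le> (2 + K\<^sup>2) * min 1 (t\<^sup>2)" by (intro mult_right_mono) auto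
        then show "norm (levy_integrand (x n) t) \<le> (2 + K\<^sup>2) * min 1 (t\<^sup>2)"
          using levy_integrand_bound[of "x n" t] by linarith
      qed
    qed (auto intro!: measurable_\<nu> levy_integrand_measurable)
  qed
  then have "continuous_on UNIV (\<lambda>\<xi>. LINT t|\<nu>. levy_integrand \<xi> t)"
    by (auto simp: continuous_on_sequentially comp_def)
  then show ?thesis unfolding \<Psi>_eq[abs_def] by (intro continuous_intros) auto
qed

lemma \<Psi>_test_integrable:
  assumes "\<phi> \<in> test_functions"
  shows "integrable lborel (\<lambda>x. \<Psi> (\<phi> x))"
proof -
  obtain c where c: "c > 0" "\<And>x. x \<notin> {-c..c} \<Longrightarrow> \<phi> x = 0"
    using assms by (rule test_functionsE) blast
  have "continuous_on {-c..c} (\<lambda>x. \<Psi> (\<phi> x))"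
    using continuous_on_compose2[OF continuous_\<Psi> smooth_continuous0[OF test_smooth[OF assms]]] by blast
  then have "integrable lborel (\<lambda>x. indicator {-c..c} x *\<^sub>R \<Psi> (\<phi> x))"
    using borel_integrable_atLeastAtMost'[of "-c" c "\<lambda>x. \<Psi> (\<phi> x)"] by (simp add: set_integrable_def)
  moreover have "(\<lambda>x. indicator {-c..c} x *\<^sub>R \<Psi> (\<phi> x)) = (\<lambda>x. \<Psi> (\<phi> x))"
  proof
    fix x show "indicator {-c..c} x *\<^sub>R \<Psi> (\<phi> x) = \<Psi> (\<phi> x)"
      using c(2)[of x] \<Psi>_zero by (cases "x \<in> {-c..c}") auto
  qed
  ultimately show ?thesis by simp
qed

definition exponent :: "(real \<Rightarrow> real) \<Rightarrow> complex" where
  "exponent \<phi> = (LINT x|lborel. \<Psi> (\<phi> x))"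

lemma Re_exponent:
  assumes "\<phi> \<in> test_functions"
  shows "- Re (exponent \<phi>) = (LINT x|lborel. - Re (\<Psi> (\<phi> x)))"
  unfolding exponent_def using integral_Re[OF \<Psi>_test_integrable[OF assms]] by simp

lemma Re_exponent_nonpos: "\<phi> \<in> test_functions \<Longrightarrow> Re (exponent \<phi>) \<le> 0"
  using Re_exponent[of \<phi>] Bochner_Integration.integral_nonneg[of lborel "\<lambda>x. - Re (\<Psi> (\<phi> x))"] Re_\<Psi>_nonpos by simp

lemma exponent_zero: "exponent (\<lambda>x. 0) = 0"
  by (simp add: exponent_def \<Psi>_zero)

lemma exponent_add_disjoint:
  assumes "\<phi> \<in> test_functions" "\<psi> \<in> test_functions" "\<And>x. \<phi> x = 0 \<or> \<psi> x = 0"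
  shows "exponent (\<lambda>x. \<phi> x + \<psi> x) = exponent \<phi> + exponent \<psi>"
proof -
  have "\<Psi> (\<phi> x + \<psi> x) = \<Psi> (\<phi> x) + \<Psi> (\<psi> x)" for x
    using assms(3)[of x] \<Psi>_zero by auto
  then show ?thesis
    unfolding exponent_def using \<Psi>_test_integrable assms(1,2) by simp
qed

lemma exponent_shift: "exponent (\<lambda>x. \<phi> (x - b)) = exponent \<phi>"
  unfolding exponent_def
  using lborel_integral_real_affine[of 1 "\<lambda>x. \<Psi> (\<phi> (x - b))" b] by simp

subsection \<open>From small exponents to fractional moments of the Levy measure\<close>

lemma finite_tail: "emeasure \<nu> {t \<in> space \<nu>. 1 \<le> \<bar>t\<bar>} < \<infinity>"
proof -
  have [measurable]: "{t \<in> space \<nu>. 1 \<le> \<bar>t\<bar>} \<in> sets \<nu>" using sets_\<nu>I[of "{t. 1 \<le> \<bar>t\<bar>}"] by simp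
  have "emeasure \<nu> {t \<in> space \<nu>. 1 \<le> \<bar>t\<bar>} = (\<integral>\<^sup>+t. indicator {t \<in> space \<nu>. 1 \<le> \<bar>t\<bar>} t \<partial>\<nu>)" by simp
  also have "\<dots> \<le> (\<integral>\<^sup>+t. ennreal (min 1 (t\<^sup>2)) \<partial>\<nu>)"
    by (intro nn_integral_mono) (auto simp: indicator_def abs_le_square_iff[of 1, simplified] min_def)
  also have "\<dots> < \<infinity>" using levy by (simp add: levy_measure_def)
  finally show ?thesis .
qed

definition shell :: "nat \<Rightarrow> real set" where
  "shell k = {t \<in> space \<nu>. 2 ^ k \<le> \<bar>t\<bar> \<and> \<bar>t\<bar> < 2 ^ Suc k}"

lemma shell_sets[measurable]: "shell k \<in> sets \<nu>"
  using sets_\<nu>I[of "{t. 2 ^ k \<le> \<bar>t\<bar> \<and> \<bar>t\<bar> < 2 ^ Suc k}"] by (simp add: shell_def)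

lemma shell_finite: "emeasure \<nu> (shell k) \<le> emeasure \<nu> {t \<in> space \<nu>. 1 \<le> \<bar>t\<bar>}" "emeasure \<nu> (shell k) < \<infinity>"
proof -
  have "(1::real) \<le> 2 ^ k" by simp
  then show le: "emeasure \<nu> (shell k) \<le> emeasure \<nu> {t \<in> space \<nu>. 1 \<le> \<bar>t\<bar>}"
    using sets_\<nu>I[of "{t. 1 \<le> \<bar>t\<bar>}"] order_trans[of "1::real" "2 ^ k"]
    by (intro emeasure_mono) (auto simp: shell_def)
  show "emeasure \<nu> (shell k) < \<infinity>" using le finite_tail by (rule le_less_trans)
qed

text \<open>On the shell the argument of the cosine stays between \<open>3 / 4\<close> and 2, hence away from the zeros of
  \<open>1 - cos\<close>. This pointwise bound replaces the usual averaging over the frequency.\<close>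

lemma shell_le_Re_\<Psi>:
  assumes "3 / 4 \<le> \<bar>s\<bar> * 2 ^ k" "\<bar>s\<bar> * 2 ^ k \<le> 1"
  shows "(1 - cos (3 / 4 :: real)) * measure \<nu> (shell k) \<le> - Re (\<Psi> s)"
proof -
  have "(LINT t|\<nu>. (1 - cos (3 / 4 :: real)) * indicator (shell k) t) \<le> (LINT t|\<nu>. 1 - cos (s * t))"
  proof (rule integral_mono)
    show "integrable \<nu> (\<lambda>t. (1 - cos (3 / 4 :: real)) * indicator (shell k) t)"
      using shell_finite(2)[of k] by (intro integrable_mult_right integrable_real_indicator) auto
    fix t
    show "(1 - cos (3 / 4 :: real)) * indicator (shell k) t \<le> 1 - cos (s * t)"
    proof (cases "t \<in> shell k")
      case True
      then have t: "2 ^ k \<le> \<bar>t\<bar>" "\<bar>t\<bar> < 2 * 2 ^ k" by (auto simp: shell_def)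
      have "\<bar>s\<bar> * 2 ^ k \<le> \<bar>s\<bar> * \<bar>t\<bar>" "\<bar>s\<bar> * \<bar>t\<bar> \<le> \<bar>s\<bar> * (2 * 2 ^ k)"
        using t by (intro mult_left_mono; simp)+
      then have "3 / 4 \<le> \<bar>s * t\<bar>" "\<bar>s * t\<bar> \<le> 2" using assms by (auto simp: abs_mult)
      from one_minus_cos_lower[OF this] show ?thesis using True by simp
    qed simp
  qed (rule integrable_one_minus_cos)
  then show ?thesis using Re_\<Psi>_ge[of s] shell_finite(2)[of k] by simp
qed

text \<open>All converse directions end here. Near a point where \<open>\<phi>\<close> does not vanish, its values
  vary by a factor of at most \<open>4 / 3\<close>, so a single scale \<open>\<xi>\<close> makes the shell estimate applicable on a whole
  interval; a power bound for the exponent at small \<open>\<xi>\<close> then forces a power decay of the Levy measure.\<close>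

lemma fractional_moment_if_exponent_small:
  assumes \<phi>: "\<phi> \<in> test_functions" "\<phi> \<noteq> (\<lambda>x. 0)" and \<eta>: "\<eta> > 0"
    and small: "eventually (\<lambda>\<xi>. - Re (exponent (\<lambda>x. \<xi> * \<phi> x)) \<le> D * \<xi> powr \<eta>) (at_right 0)"
  shows fractional_moment
proof -
  obtain x0 where x0: "\<phi> x0 \<noteq> 0" using \<phi>(2) by blast
  define c where "c = \<bar>\<phi> x0\<bar>"
  have c: "c > 0" using x0 by (simp add: c_def)
  have "isCont \<phi> x0" using DERIV_isCont[OF smooth_DERIV0[OF test_smooth[OF \<phi>(1)]]] .
  then obtain d where d: "d > 0" "\<And>x. \<bar>x - x0\<bar> < d \<Longrightarrow> \<bar>\<phi> x - \<phi> x0\<bar> < c / 7"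
    using c unfolding continuous_at_eps_delta by (metis dist_real_def divide_pos_pos zero_less_numeral)
  define I where "I = {x0 - d / 2..x0 + d / 2}"
  have I: "6 / 7 * c \<le> \<bar>\<phi> x\<bar>" "\<bar>\<phi> x\<bar> \<le> 8 / 7 * c" if "x \<in> I" for x
  proof -
    have "\<bar>x - x0\<bar> < d" using that d(1) by (auto simp: I_def abs_less_iff)
    then have "\<bar>\<phi> x - \<phi> x0\<bar> < c / 7" by (rule d(2))
    then show "6 / 7 * c \<le> \<bar>\<phi> x\<bar>" "\<bar>\<phi> x\<bar> \<le> 8 / 7 * c" unfolding c_def by linarith+
  qed
  define \<kappa> where "\<kappa> = 1 - cos (3 / 4 :: real)"
  have \<kappa>: "\<kappa> > 0" unfolding \<kappa>_def by (rule one_minus_cos_pos)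
  \<comment> \<open>On \<open>I\<close> this scale puts \<open>\<bar>z k * \<phi> x\<bar> * 2 ^ k\<close> between \<open>3 / 4\<close> and 1.\<close>
  define z where "z k = 7 / (8 * c) * (1 / 2) ^ k" for k :: nat
  have z_pos: "z k > 0" for k using c by (simp add: z_def)
  have key: "\<kappa> * measure \<nu> (shell k) * d \<le> - Re (exponent (\<lambda>x. z k * \<phi> x))" for k
  proof -
    have int: "integrable lborel (\<lambda>x. - Re (\<Psi> (z k * \<phi> x)))"
      by (intro Bochner_Integration.integrable_minus integrable_Re \<Psi>_test_integrable[OF test_functions_cmult[OF \<phi>(1)]])
    have "(LINT x|lborel. \<kappa> * measure \<nu> (shell k) * indicator I x) \<le> (LINT x|lborel. - Re (\<Psi> (z k * \<phi> x)))"
    proof (rule integral_mono[OF _ int])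
      show "integrable lborel (\<lambda>x. \<kappa> * measure \<nu> (shell k) * indicator I x)"
        by (intro integrable_mult_right integrable_real_indicator) (auto simp: I_def emeasure_lborel_Icc_eq)
      fix x
      show "\<kappa> * measure \<nu> (shell k) * indicator I x \<le> - Re (\<Psi> (z k * \<phi> x))"
      proof (cases "x \<in> I")
        case True
        have eq: "\<bar>z k * \<phi> x\<bar> * 2 ^ k = 7 / (8 * c) * \<bar>\<phi> x\<bar>"
          using z_pos[of k] c by (simp add: z_def abs_mult power_one_over)
        have "3 / 4 \<le> \<bar>z k * \<phi> x\<bar> * 2 ^ k" "\<bar>z k * \<phi> x\<bar> * 2 ^ k \<le> 1"
          unfolding eq using I[OF True] c by (simp_all add: field_simps)
        from shell_le_Re_\<Psi>[OF this] show ?thesis using True by (simp add: \<kappa>_def)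
      next
        case False
        then show ?thesis using Re_\<Psi>_nonpos[of "z k * \<phi> x"] by simp
      qed
    qed
    moreover have "(LINT x|lborel. \<kappa> * measure \<nu> (shell k) * indicator I x) = \<kappa> * measure \<nu> (shell k) * d"
      using d(1) by (simp add: I_def)
    ultimately show ?thesis by (simp only: Re_exponent[OF test_functions_cmult[OF \<phi>(1)]])
  qed
  have "filterlim z (at_right 0) sequentially"
    unfolding filterlim_at
  proof (intro conjI)
    have "(\<lambda>k. 7 / (8 * c) * (1 / 2) ^ k) \<longlonglongrightarrow> 7 / (8 * c) * 0"
      by (intro tendsto_intros LIMSEQ_power_zero) simp
    then show "z \<longlonglongrightarrow> 0" by (simp add: z_def[abs_def])
    show "\<forall>\<^sub>F k in sequentially. z k \<in> {0<..} \<and> z k \<noteq> 0"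
      using z_pos by (auto intro!: always_eventually less_imp_neq[symmetric])
  qed
  from eventually_compose_filterlim[OF small this]
  obtain k0 where k0: "\<And>k. k \<ge> k0 \<Longrightarrow> - Re (exponent (\<lambda>x. z k * \<phi> x)) \<le> D * z k powr \<eta>"
    unfolding eventually_sequentially by blast
  define N where "N = measure \<nu> {t \<in> space \<nu>. 1 \<le> \<bar>t\<bar>}"
  \<comment> \<open>\<open>D1\<close> serves the shells from \<open>k0\<close> on, \<open>D2\<close> the finitely many before.\<close>
  define D1 where "D1 = max D 0 * (7 / (8 * c)) powr \<eta> / (\<kappa> * d)"
  define D2 where "D2 = N * 2 powr (real k0 * \<eta>)"
  have D12: "D1 \<ge> 0" "D2 \<ge> 0" using c \<kappa> d(1) by (auto simp: D1_def D2_def N_def)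
  have shell_bound: "measure \<nu> (shell k) \<le> (D1 + D2) * 2 powr (- (real k * \<eta>))" for k
  proof (cases "k \<ge> k0")
    case True
    have "\<kappa> * measure \<nu> (shell k) * d \<le> D * z k powr \<eta>" using key[of k] k0[OF True] by linarith
    also have "\<dots> \<le> max D 0 * z k powr \<eta>" by (intro mult_right_mono) auto
    also have "z k powr \<eta> = (7 / (8 * c)) powr \<eta> * 2 powr (- (real k * \<eta>))"
    proof -
      have "(1 / 2) ^ k = (2::real) powr (- real k)" by (simp add: powr_minus_divide powr_realpow power_divide)
      then have "z k powr \<eta> = (7 / (8 * c) * 2 powr (- real k)) powr \<eta>" by (simp only: z_def)
      also have "\<dots> = (7 / (8 * c)) powr \<eta> * (2 powr (- real k)) powr \<eta>" using c by (intro powr_mult)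
      finally show ?thesis by (simp add: powr_powr)
    qed
    finally have "measure \<nu> (shell k) \<le> D1 * 2 powr (- (real k * \<eta>))"
      using \<kappa> d(1) by (simp add: D1_def field_simps)
    then show ?thesis using D12 by (simp add: distrib_right) (smt (verit) mult_nonneg_nonneg powr_ge_zero)
  next
    case False
    have "measure \<nu> (shell k) \<le> N"
      unfolding N_def measure_def using shell_finite(1)[of k] finite_tail by (intro enn2real_mono) auto
    also have "N = N * 1" by simp
    also have "\<dots> \<le> N * (2 powr (real k0 * \<eta>) * 2 powr (- (real k * \<eta>)))"
    proof (rule mult_left_mono)
      have "1 \<le> 2 powr (real k0 * \<eta> - real k * \<eta>)"
        using False \<eta> by (intro ge_one_powr_ge_zero) (auto intro: mult_right_mono)
      then show "1 \<le> 2 powr (real k0 * \<eta>) * 2 powr (- (real k * \<eta>))" by (simp add: powr_add[symmetric])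
    qed (simp add: N_def)
    also have "\<dots> = D2 * 2 powr (- (real k * \<eta>))" by (simp add: D2_def)
    finally show ?thesis using D12 by (simp add: distrib_right) (smt (verit) mult_nonneg_nonneg powr_ge_zero)
  qed
  have "(\<integral>\<^sup>+t\<in>{t. 1 \<le> \<bar>t\<bar>}. ennreal (\<bar>t\<bar> powr (\<eta> / 2)) \<partial>\<nu>) \<le> ennreal ((D1 + D2) * 2 powr (\<eta> / 2) / (1 - 2 powr (\<eta> / 2 - \<eta>)))"
  proof (rule nn_integral_powr_dyadic)
    show "(\<lambda>t. t) \<in> borel_measurable \<nu>" by (rule measurable_\<nu>) simp
    show "emeasure \<nu> {x \<in> space \<nu>. 2 ^ k \<le> \<bar>x\<bar> \<and> \<bar>x\<bar> < 2 ^ Suc k} \<le> ennreal ((D1 + D2) * 2 powr (- (real k * \<eta>)))" for k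
      using shell_bound[of k] shell_finite(2)[of k]
      by (simp add: shell_def[symmetric] emeasure_eq_ennreal_measure ennreal_leI del: power_Suc)
  qed (use D12 \<eta> in auto)
  then show ?thesis using \<eta> by (intro exI[of _ "\<eta> / 2"]) (auto simp: less_top intro: le_less_trans)
qed

subsection \<open>From fractional moments to a growth bound\<close>

text \<open>Small jumps, the Gaussian part and large frequencies contribute the square, large jumps the
  fractional power. The exponent is capped at 1 so that the drift is covered as well.\<close>

lemma \<Psi>_bound_if_fractional_moment:
  assumes "\<epsilon>0 > 0" "(\<integral>\<^sup>+ t\<in>{t. 1 \<le> \<bar>t\<bar>}. ennreal (\<bar>t\<bar> powr \<epsilon>0) \<partial>\<nu>) < \<infinity>"
  obtains C \<epsilon> where "C > 0" "0 < \<epsilon>" "\<epsilon> \<le> 1" "\<And>\<xi>. cmod (\<Psi> \<xi>) \<le> C * (\<bar>\<xi>\<bar> powr \<epsilon> + \<bar>\<xi>\<bar>\<^sup>2)"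
proof -
  define \<epsilon> where "\<epsilon> = min 1 \<epsilon>0"
  have \<epsilon>: "0 < \<epsilon>" "\<epsilon> \<le> 1" "\<epsilon> \<le> \<epsilon>0" using assms(1) by (auto simp: \<epsilon>_def)
  let ?f = "\<lambda>t. \<bar>t\<bar> powr \<epsilon> * indicator {t. 1 \<le> \<bar>t\<bar>} t"
  have f: "integrable \<nu> ?f"
  proof (rule integrableI_bounded)
    show "?f \<in> borel_measurable \<nu>" by (rule measurable_\<nu>) measurable
    have "(\<integral>\<^sup>+t. ennreal (norm (?f t)) \<partial>\<nu>) \<le> (\<integral>\<^sup>+ t\<in>{t. 1 \<le> \<bar>t\<bar>}. ennreal (\<bar>t\<bar> powr \<epsilon>0) \<partial>\<nu>)"
      using \<epsilon> by (intro nn_integral_mono) (auto simp: indicator_def intro!: ennreal_leI powr_mono)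
    also have "\<dots> < \<infinity>" by (rule assms(2))
    finally show "(\<integral>\<^sup>+t. ennreal (norm (?f t)) \<partial>\<nu>) < \<infinity>" .
  qed
  define I where "I = (LINT t|\<nu>. min 1 (t\<^sup>2))"
  define J where "J = (LINT t|\<nu>. ?f t)"
  have I: "I \<ge> 0" unfolding I_def by (rule Bochner_Integration.integral_nonneg) simp
  have J: "J \<ge> 0" unfolding J_def by (rule Bochner_Integration.integral_nonneg) simp
  have le1: "\<bar>\<xi>\<bar> \<le> \<bar>\<xi>\<bar> powr \<epsilon> + \<xi>\<^sup>2" for \<xi> :: real
  proof (cases "\<bar>\<xi>\<bar> \<le> 1")
    case True
    have "\<bar>\<xi>\<bar> \<le> \<bar>\<xi>\<bar> powr \<epsilon>"
    proof (cases "\<xi> = 0")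
      case False
      have "\<bar>\<xi>\<bar> powr 1 \<le> \<bar>\<xi>\<bar> powr \<epsilon>" using True False \<epsilon> by (intro powr_mono') auto
      then show ?thesis using False by simp
    qed simp
    then show ?thesis by (smt (verit) zero_le_power2)
  next
    case False
    then have "\<bar>\<xi>\<bar> * 1 \<le> \<bar>\<xi>\<bar> * \<bar>\<xi>\<bar>" by (intro mult_left_mono) auto
    then show ?thesis by (simp add: power2_eq_square) (smt (verit) powr_ge_zero)
  qed
  define C where "C = \<bar>\<mu>\<bar> + \<sigma>\<^sup>2 / 2 + I + 2 * J + 1"
  have "cmod (\<Psi> \<xi>) \<le> C * (\<bar>\<xi>\<bar> powr \<epsilon> + \<bar>\<xi>\<bar>\<^sup>2)" for \<xi>
  proof -
    have "cmod (LINT t|\<nu>. levy_integrand \<xi> t) \<le> (LINT t|\<nu>. \<xi>\<^sup>2 * min 1 (t\<^sup>2) + 2 * \<bar>\<xi>\<bar> powr \<epsilon> * ?f t)"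
    proof (rule Bochner_Integration.integral_norm_bound_integral[OF integrable_levy])
      show "integrable \<nu> (\<lambda>t. \<xi>\<^sup>2 * min 1 (t\<^sup>2) + 2 * \<bar>\<xi>\<bar> powr \<epsilon> * ?f t)"
        by (intro Bochner_Integration.integrable_add integrable_mult_right integrable_min f)
      fix t
      show "cmod (levy_integrand \<xi> t) \<le> \<xi>\<^sup>2 * min 1 (t\<^sup>2) + 2 * \<bar>\<xi>\<bar> powr \<epsilon> * ?f t"
      proof (cases "\<bar>t\<bar> < 1")
        case True
        then have "t\<^sup>2 \<le> 1" by (simp add: abs_square_le_1 less_imp_le)
        then show ?thesis using levy_integrand_small[OF True, of \<xi>] True by (simp add: min_def)
      next
        case False
        have "cmod (levy_integrand \<xi> t) \<le> 2 * \<bar>\<xi> * t\<bar> powr \<epsilon>"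
          using False \<epsilon> cmod_iexp_minus_one_le_powr[of \<epsilon> "\<xi> * t"] by (simp add: levy_integrand_large)
        also have "\<dots> = 2 * \<bar>\<xi>\<bar> powr \<epsilon> * ?f t" using False by (simp add: abs_mult powr_mult)
        also have "\<dots> \<le> \<xi>\<^sup>2 * min 1 (t\<^sup>2) + 2 * \<bar>\<xi>\<bar> powr \<epsilon> * ?f t" by simp
        finally show ?thesis .
      qed
    qed
    also have "\<dots> = \<xi>\<^sup>2 * I + 2 * \<bar>\<xi>\<bar> powr \<epsilon> * J"
      using f integrable_min by (simp add: I_def J_def)
    finally have 1: "cmod (LINT t|\<nu>. levy_integrand \<xi> t) \<le> \<xi>\<^sup>2 * I + 2 * \<bar>\<xi>\<bar> powr \<epsilon> * J" .
    have "cmod (\<Psi> \<xi>) \<le> \<bar>\<mu> * \<xi>\<bar> + \<sigma>\<^sup>2 * \<xi>\<^sup>2 / 2 + cmod (LINT t|\<nu>. levy_integrand \<xi> t)"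
    proof -
      have "cmod (\<i> * of_real (\<mu> * \<xi>) - of_real (\<sigma>\<^sup>2 * \<xi>\<^sup>2 / 2)) \<le> \<bar>\<mu> * \<xi>\<bar> + \<sigma>\<^sup>2 * \<xi>\<^sup>2 / 2"
        by (rule order_trans[OF norm_triangle_ineq4]) (simp add: norm_mult norm_power norm_divide abs_mult)
      then show ?thesis unfolding \<Psi>_eq by (intro order_trans[OF norm_triangle_ineq] add_mono) auto
    qed
    also have "\<bar>\<mu> * \<xi>\<bar> \<le> \<bar>\<mu>\<bar> * (\<bar>\<xi>\<bar> powr \<epsilon> + \<xi>\<^sup>2)" unfolding abs_mult by (intro mult_left_mono le1) auto
    finally have "cmod (\<Psi> \<xi>) \<le> \<bar>\<mu>\<bar> * (\<bar>\<xi>\<bar> powr \<epsilon> + \<xi>\<^sup>2) + \<sigma>\<^sup>2 * \<xi>\<^sup>2 / 2 + (\<xi>\<^sup>2 * I + 2 * \<bar>\<xi>\<bar> powr \<epsilon> * J)"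
      using 1 by simp
    also have "\<dots> \<le> C * (\<bar>\<xi>\<bar> powr \<epsilon> + \<xi>\<^sup>2)"
    proof -
      define P where "P = \<bar>\<xi>\<bar> powr \<epsilon>"
      define Q where "Q = \<xi>\<^sup>2"
      have PQ: "P \<ge> 0" "Q \<ge> 0" by (auto simp: P_def Q_def)
      have "C * (P + Q) - (\<bar>\<mu>\<bar> * (P + Q) + \<sigma>\<^sup>2 * Q / 2 + (Q * I + 2 * P * J)) =
          \<sigma>\<^sup>2 / 2 * P + I * P + 2 * J * Q + P + Q"
        by (simp add: C_def algebra_simps add_divide_distrib)
      also have "\<dots> \<ge> 0" using PQ I J by (intro add_nonneg_nonneg mult_nonneg_nonneg) auto
      finally show ?thesis by (simp add: P_def Q_def)
    qed
    finally show ?thesis by simp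
  qed
  moreover have "C > 0" using I J unfolding C_def by (intro add_nonneg_pos add_nonneg_nonneg) auto
  ultimately show ?thesis using that \<epsilon> by blast
qed

end

section \<open>Levy white noises\<close>

lemma cmod_exp_minus_one_le:
  assumes "Re z \<le> 0" shows "cmod (exp z - 1) \<le> 3 * cmod z"
proof (cases "cmod z \<le> 1")
  case True
  have "cmod (exp z - 1) \<le> exp \<bar>Re z\<bar> * cmod z" using Taylor_exp[of z 0] by simp
  also have "exp \<bar>Re z\<bar> \<le> exp 1" using abs_Re_le_cmod[of z] True by simp
  also have "exp 1 \<le> (3::real)" by (rule exp_le)
  finally show ?thesis by (simp add: mult_right_mono)
next
  case False
  have "cmod (exp z - 1) \<le> cmod (exp z) + 1" using norm_triangle_ineq4[of "exp z" 1] by simp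
  also have "cmod (exp z) \<le> 1" using assms by simp
  finally show ?thesis using False by simp
qed

lemma cmod_iexp_minus_one_sq: "(cmod (iexp y - 1))\<^sup>2 = 2 * (1 - cos y)"
proof -
  have "(cmod (iexp y - 1))\<^sup>2 = (cos y)\<^sup>2 + (sin y)\<^sup>2 + 1 - 2 * cos y"
    unfolding cmod_power2 by (simp add: Re_exp Im_exp power2_eq_square algebra_simps)
  then show ?thesis by simp
qed

locale levy_noise = levy_exponent \<nu> \<mu> \<sigma> \<Psi> + prob_space M
  for \<nu> :: "real measure" and \<mu> \<sigma> :: real and \<Psi> :: "real \<Rightarrow> complex" and M :: "'w measure" +
  fixes W :: "'w \<Rightarrow> (real \<Rightarrow> real) \<Rightarrow> real"
  assumes process: "generalized_random_process M W"
    and cf_eq: "\<And>\<phi>. \<phi> \<in> test_functions \<Longrightarrow> characteristic_functional M W \<phi> = exp (exponent \<phi>)"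
begin

abbreviation cf where "cf \<equiv> characteristic_functional M W"

lemma W_generalized: "\<omega> \<in> space M \<Longrightarrow> W \<omega> \<in> generalized_functions"
  using process measurable_space[of W M cylindrical_algebra \<omega>]
  by (simp add: generalized_random_process_def cylindrical_algebra_def space_measure_of_conv)

lemma W_measurable[measurable]:
  assumes "\<phi> \<in> test_functions"
  shows "(\<lambda>\<omega>. W \<omega> \<phi>) \<in> borel_measurable M"
proof (rule borel_measurableI_less)
  fix a
  let ?A = "{f \<in> generalized_functions. f \<phi> < a}"
  have "?A \<in> sets cylindrical_algebra"
    unfolding cylindrical_algebra_def using assms by (subst sets_measure_of) auto
  then have "W -` ?A \<inter> space M \<in> sets M"
    using process by (intro measurable_sets) (auto simp: generalized_random_process_def)
  moreover have "W -` ?A \<inter> space M = {\<omega> \<in> space M. W \<omega> \<phi> < a}" using W_generalized by auto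
  ultimately show "{\<omega> \<in> space M. W \<omega> \<phi> < a} \<in> sets M" by simp
qed

lemma integrable_iexp_W: "\<phi> \<in> test_functions \<Longrightarrow> integrable M (\<lambda>\<omega>. iexp (W \<omega> \<phi>))"
  by (intro integrable_iexp W_measurable) auto

lemma cmod_cf: "\<phi> \<in> test_functions \<Longrightarrow> cmod (cf \<phi>) = exp (Re (exponent \<phi>))"
  by (simp add: cf_eq)

lemma cf_zero: "cf (\<lambda>x. 0) = 1"
  using cf_eq[OF test_functions_zero] by (simp add: exponent_zero)

lemma Re_cf: "\<phi> \<in> test_functions \<Longrightarrow> Re (cf \<phi>) = expectation (\<lambda>\<omega>. cos (W \<omega> \<phi>))"
  using integral_Re[OF integrable_iexp_W, of \<phi>] by (simp add: characteristic_functional_def Re_exp)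

lemma integrable_cos_W: "\<phi> \<in> test_functions \<Longrightarrow> integrable M (\<lambda>\<omega>. cos (W \<omega> \<phi>))"
  using integrable_Re[OF integrable_iexp_W, of \<phi>] by (simp add: Re_exp)

lemma one_minus_Re_cf:
  "\<phi> \<in> test_functions \<Longrightarrow> 1 - Re (cf \<phi>) = expectation (\<lambda>\<omega>. 1 - cos (W \<omega> \<phi>))"
  using integrable_cos_W[of \<phi>] by (simp add: Re_cf prob_space)

lemma cf_uminus: "\<phi> \<in> test_functions \<Longrightarrow> cf (\<lambda>x. (- s) * \<phi> x) = cnj (cf (\<lambda>x. s * \<phi> x))"
proof -
  assume \<phi>: "\<phi> \<in> test_functions"
  have "iexp (W \<omega> (\<lambda>x. (- s) * \<phi> x)) = cnj (iexp (W \<omega> (\<lambda>x. s * \<phi> x)))" if "\<omega> \<in> space M" for \<omega>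
    unfolding generalized_function_cmult[OF W_generalized[OF that] \<phi>] by (simp add: exp_cnj)
  then have "cf (\<lambda>x. (- s) * \<phi> x) = (LINT \<omega>|M. cnj (iexp (W \<omega> (\<lambda>x. s * \<phi> x))))"
    unfolding characteristic_functional_def by (intro Bochner_Integration.integral_cong refl)
  then show ?thesis by (simp add: characteristic_functional_def)
qed

lemma one_minus_Re_cf_le:
  assumes "\<phi> \<in> test_functions"
  shows "1 - Re (cf \<phi>) \<le> 3 * cmod (exponent \<phi>)"
proof -
  have "1 - Re (cf \<phi>) \<le> cmod (cf \<phi> - 1)" using complex_Re_le_cmod[of "1 - cf \<phi>"] by (simp add: norm_minus_commute)
  also have "\<dots> \<le> 3 * cmod (exponent \<phi>)"
    using cmod_exp_minus_one_le[OF Re_exponent_nonpos[OF assms]] by (simp add: cf_eq assms)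
  finally show ?thesis .
qed

subsection \<open>Fractional moments of the noise\<close>

lemma cmod_exponent_le:
  assumes \<phi>: "\<phi> \<in> test_functions" "\<And>x. x \<notin> {a..b} \<Longrightarrow> \<phi> x = 0" "a \<le> b"
    and K: "1 \<le> K" "\<And>x. \<bar>\<phi> x\<bar> \<le> K"
    and C: "C > 0" "0 < \<epsilon>" "\<epsilon> \<le> 1" "\<And>\<xi>. cmod (\<Psi> \<xi>) \<le> C * (\<bar>\<xi>\<bar> powr \<epsilon> + \<bar>\<xi>\<bar>\<^sup>2)"
    and \<xi>: "0 < \<xi>" "\<xi> \<le> 1"
  shows "cmod (exponent (\<lambda>x. \<xi> * \<phi> x)) \<le> 2 * C * K\<^sup>2 * (b - a) * \<xi> powr \<epsilon>"
proof -
  have \<xi>2: "\<xi>\<^sup>2 \<le> \<xi> powr \<epsilon>"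
  proof -
    have "\<xi> powr 2 \<le> \<xi> powr \<epsilon>" using \<xi> C(2,3) by (intro powr_mono') auto
    then show ?thesis using \<xi> by simp
  qed
  have pt: "cmod (\<Psi> (\<xi> * \<phi> x)) \<le> indicator {a..b} x * (2 * C * K\<^sup>2 * \<xi> powr \<epsilon>)" for x
  proof (cases "x \<in> {a..b}")
    case True
    have "\<bar>\<xi> * \<phi> x\<bar> powr \<epsilon> \<le> (\<xi> * K) powr \<epsilon>"
      using K(2)[of x] \<xi> C by (intro powr_mono2) (auto simp: abs_mult)
    also have "\<dots> = \<xi> powr \<epsilon> * K powr \<epsilon>" using \<xi> K by (simp add: powr_mult)
    also have "K powr \<epsilon> \<le> K powr 2" using K(1) C(3) by (intro powr_mono) auto
    also have "K powr 2 = K\<^sup>2" using K(1) by simp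
    finally have 1: "\<bar>\<xi> * \<phi> x\<bar> powr \<epsilon> \<le> \<xi> powr \<epsilon> * K\<^sup>2" by (simp add: mult_left_mono)
    have "\<bar>\<xi> * \<phi> x\<bar>\<^sup>2 \<le> (\<xi> * K)\<^sup>2" using K(2)[of x] \<xi> by (intro power_mono) (auto simp: abs_mult)
    also have "\<dots> \<le> \<xi> powr \<epsilon> * K\<^sup>2" using \<xi>2 by (simp add: power_mult_distrib mult_right_mono)
    finally have "C * (\<bar>\<xi> * \<phi> x\<bar> powr \<epsilon> + \<bar>\<xi> * \<phi> x\<bar>\<^sup>2) \<le> C * (\<xi> powr \<epsilon> * K\<^sup>2 + \<xi> powr \<epsilon> * K\<^sup>2)"
      using 1 C by (intro mult_left_mono add_mono) auto
    then show ?thesis using C(4)[of "\<xi> * \<phi> x"] True by (simp add: algebra_simps)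
  next
    case False
    then show ?thesis using \<phi>(2) by (simp add: \<Psi>_zero)
  qed
  have "cmod (exponent (\<lambda>x. \<xi> * \<phi> x)) \<le> (LINT x|lborel. indicator {a..b} x * (2 * C * K\<^sup>2 * \<xi> powr \<epsilon>))"
    unfolding exponent_def
    by (rule Bochner_Integration.integral_norm_bound_integral[OF \<Psi>_test_integrable[OF test_functions_cmult[OF \<phi>(1)]] _ pt])
       (intro integrable_mult_left integrable_real_indicator, auto simp: emeasure_lborel_Icc_eq)
  also have "\<dots> = 2 * C * K\<^sup>2 * (b - a) * \<xi> powr \<epsilon>" using \<phi>(3) by simp
  finally show ?thesis .
qed

text \<open>The dyadic shells of the law of \<open>W \<omega> \<phi>\<close> are charged at most in proportion to \<open>1 - Re\<close> of the
  characteristic functional at the corresponding scale.\<close>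

lemma noise_moment_bound:
  assumes \<phi>: "\<phi> \<in> test_functions" and D: "D \<ge> 0" and \<epsilon>: "0 < \<epsilon>"
    and small: "\<And>\<xi>. 0 < \<xi> \<Longrightarrow> \<xi> \<le> 1 \<Longrightarrow> 1 - Re (cf (\<lambda>x. \<xi> * \<phi> x)) \<le> D * \<xi> powr \<epsilon>"
  shows "(\<integral>\<^sup>+\<omega>. ennreal (\<bar>W \<omega> \<phi>\<bar> powr (\<epsilon> / 2)) \<partial>M) \<le>
    1 + ennreal (D / (1 - cos (3 / 4)) * 2 powr (\<epsilon> / 2) / (1 - 2 powr (\<epsilon> / 2 - \<epsilon>)))"
proof -
  let ?X = "\<lambda>\<omega>. W \<omega> \<phi>"
  have X[measurable]: "?X \<in> borel_measurable M" by (rule W_measurable[OF \<phi>])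
  define \<kappa> where "\<kappa> = 1 - cos (3 / 4 :: real)"
  have \<kappa>: "\<kappa> > 0" unfolding \<kappa>_def by (rule one_minus_cos_pos)
  have shell: "emeasure M {\<omega> \<in> space M. 2 ^ k \<le> \<bar>?X \<omega>\<bar> \<and> \<bar>?X \<omega>\<bar> < 2 ^ Suc k} \<le> ennreal (D / \<kappa> * 2 powr (- (real k * \<epsilon>)))" for k
  proof -
    let ?E = "{\<omega> \<in> space M. 2 ^ k \<le> \<bar>?X \<omega>\<bar> \<and> \<bar>?X \<omega>\<bar> < 2 ^ Suc k}"
    have E[measurable]: "?E \<in> sets M" by measurable
    define s where "s = (1 / 2 :: real) ^ k"
    have s: "0 < s" "s \<le> 1" by (auto simp: s_def power_le_one)
    have s\<phi>: "(\<lambda>x. s * \<phi> x) \<in> test_functions" by (rule test_functions_cmult[OF \<phi>])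
    have Ws: "W \<omega> (\<lambda>x. s * \<phi> x) = s * ?X \<omega>" if "\<omega> \<in> space M" for \<omega>
      by (rule generalized_function_cmult[OF W_generalized[OF that] \<phi>])
    have "expectation (\<lambda>\<omega>. \<kappa> * indicator ?E \<omega>) \<le> expectation (\<lambda>\<omega>. 1 - cos (W \<omega> (\<lambda>x. s * \<phi> x)))"
    proof (rule integral_mono)
      show "integrable M (\<lambda>\<omega>. \<kappa> * indicator ?E \<omega>)"
        by (intro integrable_mult_right integrable_real_indicator E) (simp add: less_top[symmetric])
      show "integrable M (\<lambda>\<omega>. 1 - cos (W \<omega> (\<lambda>x. s * \<phi> x)))"
        by (intro Bochner_Integration.integrable_diff integrable_cos_W s\<phi>) simp
      fix \<omega> assume \<omega>: "\<omega> \<in> space M"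
      show "\<kappa> * indicator ?E \<omega> \<le> 1 - cos (W \<omega> (\<lambda>x. s * \<phi> x))"
      proof (cases "\<omega> \<in> ?E")
        case True
        have eq: "s * 2 ^ k = 1" "s * 2 ^ Suc k = 2" by (simp_all add: s_def power_divide)
        have "s * 2 ^ k \<le> s * \<bar>?X \<omega>\<bar>" "s * \<bar>?X \<omega>\<bar> \<le> s * 2 ^ Suc k"
          using s True by (auto intro!: mult_left_mono simp del: power_Suc)
        then have "1 \<le> s * \<bar>?X \<omega>\<bar>" "s * \<bar>?X \<omega>\<bar> \<le> 2" unfolding eq .
        then have "3 / 4 \<le> \<bar>s * ?X \<omega>\<bar>" "\<bar>s * ?X \<omega>\<bar> \<le> 2" using s by (auto simp: abs_mult)
        from one_minus_cos_lower[OF this] show ?thesis using True by (simp add: Ws[OF \<omega>] \<kappa>_def)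
      qed simp
    qed
    then have "\<kappa> * prob ?E \<le> 1 - Re (cf (\<lambda>x. s * \<phi> x))"
      unfolding one_minus_Re_cf[OF s\<phi>] using E by simp
    also have "\<dots> \<le> D * s powr \<epsilon>" by (rule small[OF s])
    also have "s powr \<epsilon> = 2 powr (- (real k * \<epsilon>))"
    proof -
      have "s = 2 powr (- real k)" by (simp add: s_def powr_minus_divide powr_realpow power_divide)
      then show ?thesis by (simp add: powr_powr)
    qed
    finally have "prob ?E \<le> D / \<kappa> * 2 powr (- (real k * \<epsilon>))" using \<kappa> by (simp add: field_simps)
    then show ?thesis unfolding emeasure_eq_measure by (rule ennreal_leI)
  qed
  have "(\<integral>\<^sup>+\<omega>. ennreal (\<bar>?X \<omega>\<bar> powr (\<epsilon> / 2)) \<partial>M) \<le>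
      (\<integral>\<^sup>+\<omega>. 1 + ennreal (\<bar>?X \<omega>\<bar> powr (\<epsilon> / 2)) * indicator {\<omega>. 1 \<le> \<bar>?X \<omega>\<bar>} \<omega> \<partial>M)"
  proof (rule nn_integral_mono)
    fix \<omega>
    show "ennreal (\<bar>?X \<omega>\<bar> powr (\<epsilon> / 2)) \<le> 1 + ennreal (\<bar>?X \<omega>\<bar> powr (\<epsilon> / 2)) * indicator {\<omega>. 1 \<le> \<bar>?X \<omega>\<bar>} \<omega>"
    proof (cases "1 \<le> \<bar>?X \<omega>\<bar>")
      case False
      then have "\<bar>?X \<omega>\<bar> powr (\<epsilon> / 2) \<le> 1" using \<epsilon> by (intro powr_le1) auto
      then show ?thesis using False by simp
    qed simp
  qed
  also have "\<dots> = 1 + (\<integral>\<^sup>+\<omega>\<in>{\<omega>. 1 \<le> \<bar>?X \<omega>\<bar>}. ennreal (\<bar>?X \<omega>\<bar> powr (\<epsilon> / 2)) \<partial>M)"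
    by (subst nn_integral_add) (auto simp: emeasure_space_1)
  also have "(\<integral>\<^sup>+\<omega>\<in>{\<omega>. 1 \<le> \<bar>?X \<omega>\<bar>}. ennreal (\<bar>?X \<omega>\<bar> powr (\<epsilon> / 2)) \<partial>M)
      \<le> ennreal (D / \<kappa> * 2 powr (\<epsilon> / 2) / (1 - 2 powr (\<epsilon> / 2 - \<epsilon>)))"
    using D \<kappa> \<epsilon> by (intro nn_integral_powr_dyadic[OF X _ _ _ shell]) auto
  finally show ?thesis by (simp add: \<kappa>_def)
qed

lemma noise_moment_bound_if_growth:
  assumes \<phi>: "\<phi> \<in> test_functions" "\<And>x. x \<notin> {a..b} \<Longrightarrow> \<phi> x = 0" "a \<le> b"
    and K: "1 \<le> K" "\<And>x. \<bar>\<phi> x\<bar> \<le> K"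
    and C: "C > 0" "0 < \<epsilon>" "\<epsilon> \<le> 1" "\<And>\<xi>. cmod (\<Psi> \<xi>) \<le> C * (\<bar>\<xi>\<bar> powr \<epsilon> + \<bar>\<xi>\<bar>\<^sup>2)"
  shows "(\<integral>\<^sup>+\<omega>. ennreal (\<bar>W \<omega> \<phi>\<bar> powr (\<epsilon> / 2)) \<partial>M) \<le>
    1 + ennreal (6 * C * K\<^sup>2 * (b - a) / (1 - cos (3 / 4)) * 2 powr (\<epsilon> / 2) / (1 - 2 powr (\<epsilon> / 2 - \<epsilon>)))"
proof (rule noise_moment_bound[OF \<phi>(1) _ C(2)])
  show "0 \<le> 6 * C * K\<^sup>2 * (b - a)" using C(1) \<phi>(3) by simp
  fix \<xi> :: real assume \<xi>: "0 < \<xi>" "\<xi> \<le> 1"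
  show "1 - Re (cf (\<lambda>x. \<xi> * \<phi> x)) \<le> 6 * C * K\<^sup>2 * (b - a) * \<xi> powr \<epsilon>"
    using one_minus_Re_cf_le[OF test_functions_cmult[OF \<phi>(1)], of \<xi>] cmod_exponent_le[OF \<phi> K C \<xi>] by linarith
qed

lemma noise_moments_finite:
  assumes C: "C > 0" "0 < \<epsilon>" "\<epsilon> \<le> 1" "\<And>\<xi>. cmod (\<Psi> \<xi>) \<le> C * (\<bar>\<xi>\<bar> powr \<epsilon> + \<bar>\<xi>\<bar>\<^sup>2)"
    and \<phi>: "\<phi> \<in> test_functions"
  shows "(\<integral>\<^sup>+\<omega>. ennreal (\<bar>W \<omega> \<phi>\<bar> powr (\<epsilon> / 2)) \<partial>M) < \<infinity>"
proof -
  obtain c where c: "c > 0" "\<And>x. x \<notin> {-c..c} \<Longrightarrow> \<phi> x = 0"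
    using \<phi> by (rule test_functionsE) blast
  obtain B where B: "\<And>x. \<bar>(deriv ^^ 0) \<phi> x\<bar> \<le> B" using test_higher_deriv_bounded[OF \<phi>] by metis
  have "\<bar>\<phi> x\<bar> \<le> max 1 B" for x using B[of x] by simp
  then have "(\<integral>\<^sup>+\<omega>. ennreal (\<bar>W \<omega> \<phi>\<bar> powr (\<epsilon> / 2)) \<partial>M) \<le>
    1 + ennreal (6 * C * (max 1 B)\<^sup>2 * (c - - c) / (1 - cos (3 / 4)) * 2 powr (\<epsilon> / 2) / (1 - 2 powr (\<epsilon> / 2 - \<epsilon>)))"
    using c(1) by (intro noise_moment_bound_if_growth[OF \<phi> c(2) _ _ _ C]) auto
  also have "\<dots> < \<infinity>" by (simp add: ennreal_add_eq_top less_top[symmetric])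
  finally show ?thesis .
qed

subsection \<open>Temperedness from a growth bound\<close>

text \<open>The random series \<open>\<Sum>i. \<bar>X i\<bar> powr \<delta> / (i + 1)\<^sup>2\<close> has finite expectation, hence is almost surely finite,
  and bounds each of its terms.\<close>

lemma AE_polynomial_growth:
  fixes X :: "nat \<Rightarrow> 'w \<Rightarrow> real"
  assumes X[measurable]: "\<And>i. X i \<in> borel_measurable M" and \<delta>: "\<delta> > 0" and B: "B < \<infinity>"
    and moment: "\<And>i. (\<integral>\<^sup>+\<omega>. ennreal (\<bar>X i \<omega>\<bar> powr \<delta>) \<partial>M) \<le> B"
    and q: "2 / \<delta> \<le> real q"
  shows "AE \<omega> in M. \<exists>S\<ge>0. \<forall>i. \<bar>X i \<omega>\<bar> \<le> S * (1 + real i) ^ q"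
proof -
  define Y where "Y \<omega> = (\<Sum>i. ennreal (1 / (real (Suc i))\<^sup>2) * ennreal (\<bar>X i \<omega>\<bar> powr \<delta>))" for \<omega>
  have Y[measurable]: "Y \<in> borel_measurable M" unfolding Y_def by measurable
  note sq = summable_inverse_squares
  have "(\<integral>\<^sup>+\<omega>. Y \<omega> \<partial>M) = (\<Sum>i. ennreal (1 / (real (Suc i))\<^sup>2) * (\<integral>\<^sup>+\<omega>. ennreal (\<bar>X i \<omega>\<bar> powr \<delta>) \<partial>M))"
    unfolding Y_def by (subst nn_integral_suminf) (auto simp: nn_integral_cmult)
  also have "\<dots> \<le> (\<Sum>i. ennreal (1 / (real (Suc i))\<^sup>2) * B)"
    using moment by (intro suminf_le mult_left_mono) auto
  also have "\<dots> = (\<Sum>i. ennreal (1 / (real (Suc i))\<^sup>2)) * B" by (rule ennreal_suminf_multc)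
  also have "(\<Sum>i. ennreal (1 / (real (Suc i))\<^sup>2)) = ennreal (\<Sum>i. 1 / (real (Suc i))\<^sup>2)"
    by (rule suminf_ennreal2[OF _ sq]) simp
  also have "\<dots> * B < \<infinity>" using B by (simp add: ennreal_mult_less_top)
  finally have "(\<integral>\<^sup>+\<omega>. Y \<omega> \<partial>M) \<noteq> \<infinity>" by simp
  from nn_integral_PInf_AE[OF Y this] show ?thesis
  proof eventually_elim
    case (elim \<omega>)
    define y where "y = enn2real (Y \<omega>)"
    have Yy: "Y \<omega> = ennreal y" using elim by (simp add: y_def less_top)
    have y: "y \<ge> 0" by (simp add: y_def)
    have "\<bar>X i \<omega>\<bar> \<le> y powr (1 / \<delta>) * (1 + real i) ^ q" for i
    proof -
      have "sum (\<lambda>i. ennreal (1 / (real (Suc i))\<^sup>2) * ennreal (\<bar>X i \<omega>\<bar> powr \<delta>)) {i} \<le> Y \<omega>"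
        unfolding Y_def by (rule sum_le_suminf) auto
      then have "ennreal (1 / (real (Suc i))\<^sup>2 * \<bar>X i \<omega>\<bar> powr \<delta>) \<le> ennreal y"
        by (subst ennreal_mult) (simp_all add: Yy del: of_nat_Suc)
      then have "1 / (real (Suc i))\<^sup>2 * \<bar>X i \<omega>\<bar> powr \<delta> \<le> y" using y by (simp del: of_nat_Suc)
      then have le: "\<bar>X i \<omega>\<bar> powr \<delta> \<le> y * (real (Suc i))\<^sup>2" by (simp add: field_simps del: of_nat_Suc)
      have "\<bar>X i \<omega>\<bar> = (\<bar>X i \<omega>\<bar> powr \<delta>) powr (1 / \<delta>)" using \<delta> by (simp add: powr_powr)
      also have "\<dots> \<le> (y * (real (Suc i))\<^sup>2) powr (1 / \<delta>)" using le \<delta> by (intro powr_mono2) auto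
      also have "\<dots> = y powr (1 / \<delta>) * (real (Suc i)) powr (2 / \<delta>)"
      proof -
        have "((real (Suc i))\<^sup>2) powr (1 / \<delta>) = (real (Suc i) powr 2) powr (1 / \<delta>)"
          by (simp del: of_nat_Suc)
        also have "\<dots> = real (Suc i) powr (2 / \<delta>)" unfolding powr_powr by simp
        finally show ?thesis using y by (simp add: powr_mult del: of_nat_Suc)
      qed
      also have "(real (Suc i)) powr (2 / \<delta>) \<le> real (Suc i) powr real q" using q by (intro powr_mono) auto
      also have "\<dots> = (1 + real i) ^ q" by (subst powr_realpow) (auto simp: add.commute)
      finally show ?thesis by (simp add: mult_left_mono)
    qed
    then show ?case by (intro exI[of _ "y powr (1 / \<delta>)"]) auto
  qed
qed

text \<open>Enumerating pairs of a translation and a frequency costs only a polynomial factor.\<close>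

lemma pair_index_bound:
  "1 + real (prod_encode (int_encode n, k)) \<le> 5 * ((1 + \<bar>real_of_int n\<bar>) * (1 + real k))\<^sup>2"
proof -
  have "int_encode n \<le> 2 * nat \<bar>n\<bar> + 1" by (auto simp: int_encode_def sum_encode_def)
  then have ie: "real (int_encode n) \<le> 2 * \<bar>real_of_int n\<bar> + 1" by linarith
  have tri: "triangle m \<le> m * m" for m by (induction m) auto
  define s where "s = int_encode n + k"
  have "prod_encode (int_encode n, k) \<le> s * s + s"
    using tri[of s] by (simp add: prod_encode_def s_def)
  then have "real (prod_encode (int_encode n, k)) \<le> real (s * s + s)" by (simp only: of_nat_le_iff)
  then have "1 + real (prod_encode (int_encode n, k)) \<le> (real s + 1)\<^sup>2"
    by (simp add: power2_eq_square algebra_simps)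
  also have "\<dots> \<le> (2 * ((1 + \<bar>real_of_int n\<bar>) * (1 + real k)))\<^sup>2"
  proof (rule power_mono)
    have "real s + 1 \<le> 2 * \<bar>real_of_int n\<bar> + 2 + real k" using ie by (simp add: s_def)
    also have "\<dots> \<le> 2 * ((1 + \<bar>real_of_int n\<bar>) * (1 + real k))" by (simp add: algebra_simps)
    finally show "real s + 1 \<le> 2 * ((1 + \<bar>real_of_int n\<bar>) * (1 + real k))" .
  qed simp
  also have "\<dots> \<le> 5 * ((1 + \<bar>real_of_int n\<bar>) * (1 + real k))\<^sup>2" unfolding power_mult_distrib[of 2] by simp
  finally show ?thesis .
qed

lemma AE_polynomial_growth_pairs:
  fixes X :: "int \<Rightarrow> nat \<Rightarrow> 'w \<Rightarrow> real"
  assumes X: "\<And>n k. X n k \<in> borel_measurable M" and "\<delta> > 0" "B < \<infinity>"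
    and "\<And>n k. (\<integral>\<^sup>+\<omega>. ennreal (\<bar>X n k \<omega>\<bar> powr \<delta>) \<partial>M) \<le> B" and "2 / \<delta> \<le> real q"
  shows "AE \<omega> in M. \<exists>S\<ge>0. \<forall>n k. \<bar>X n k \<omega>\<bar> \<le> S * (1 + \<bar>of_int n\<bar>) ^ (2 * q) * (1 + real k) ^ (2 * q)"
proof -
  let ?X = "\<lambda>i. X (int_decode (fst (prod_decode i))) (snd (prod_decode i))"
  have "AE \<omega> in M. \<exists>S\<ge>0. \<forall>i. \<bar>?X i \<omega>\<bar> \<le> S * (1 + real i) ^ q"
    using assms by (intro AE_polynomial_growth[of ?X \<delta> B q]) auto
  then show ?thesis
  proof eventually_elim
    case (elim \<omega>)
    then obtain S where S: "S \<ge> 0" "\<And>i. \<bar>?X i \<omega>\<bar> \<le> S * (1 + real i) ^ q" by blast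
    have "\<bar>X n k \<omega>\<bar> \<le> (S * 5 ^ q) * (1 + \<bar>of_int n\<bar>) ^ (2 * q) * (1 + real k) ^ (2 * q)" for n k
    proof -
      have "\<bar>X n k \<omega>\<bar> \<le> S * (1 + real (prod_encode (int_encode n, k))) ^ q"
        using S(2)[of "prod_encode (int_encode n, k)"] by simp
      also have "\<dots> \<le> S * (5 * ((1 + \<bar>real_of_int n\<bar>) * (1 + real k))\<^sup>2) ^ q"
        using S(1) by (intro mult_left_mono power_mono pair_index_bound) auto
      finally show ?thesis unfolding power_mult power_mult_distrib by (simp add: mult_ac)
    qed
    then show ?case using S(1) by (intro exI[of _ "S * 5 ^ q"]) auto
  qed
qed

text \<open>The Fourier modes, cut off by translates of one plateau, are all bounded by 1 and supported in
  intervals of length 4. Their moments are therefore bounded uniformly in translation and frequency,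
  and almost surely the noise grows at most polynomially along them.\<close>

lemma AE_tempered_if_bound:
  assumes C: "C > 0" "0 < \<epsilon>" "\<epsilon> \<le> 1" "\<And>\<xi>. cmod (\<Psi> \<xi>) \<le> C * (\<bar>\<xi>\<bar> powr \<epsilon> + \<bar>\<xi>\<bar>\<^sup>2)"
  shows "AE \<omega> in M. W \<omega> \<in> tempered_generalized_functions"
proof -
  define B where "B = 1 + ennreal (6 * C * 1\<^sup>2 * 4 / (1 - cos (3 / 4)) * 2 powr (\<epsilon> / 2) / (1 - 2 powr (\<epsilon> / 2 - \<epsilon>)))"
  have B: "B < \<infinity>" by (simp add: B_def ennreal_add_eq_top less_top[symmetric])
  obtain q :: nat where q: "2 / (\<epsilon> / 2) \<le> real q" using real_arch_simple by blast
  have growth: "AE \<omega> in M. \<exists>S\<ge>0. \<forall>n k. \<bar>W \<omega> (\<lambda>x. e k x * plateau n x)\<bar> \<le> S * (1 + \<bar>of_int n\<bar>) ^ (2 * q) * (1 + real k) ^ (2 * q)"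
    if e: "\<And>k. smooth (e k)" "\<And>k x. \<bar>e k x\<bar> \<le> 1" for e :: "nat \<Rightarrow> real \<Rightarrow> real"
  proof (rule AE_polynomial_growth_pairs[OF _ _ B _ q])
    fix n :: int and k :: nat
    let ?\<phi> = "\<lambda>x. e k x * plateau n x"
    have test: "?\<phi> \<in> test_functions" by (intro test_functions_mult plateau_test e)
    show "(\<lambda>\<omega>. W \<omega> ?\<phi>) \<in> borel_measurable M" by (rule W_measurable[OF test])
    have "\<bar>?\<phi> x\<bar> \<le> 1" for x
      unfolding abs_mult using e(2)[of k x] plateau_abs_le[of n x] by (intro mult_le_one) auto
    then have "(\<integral>\<^sup>+\<omega>. ennreal (\<bar>W \<omega> ?\<phi>\<bar> powr (\<epsilon> / 2)) \<partial>M) \<le>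
       1 + ennreal (6 * C * 1\<^sup>2 * ((of_int n + 3) - (of_int n - 1)) / (1 - cos (3 / 4)) * 2 powr (\<epsilon> / 2) / (1 - 2 powr (\<epsilon> / 2 - \<epsilon>)))"
      by (intro noise_moment_bound_if_growth[OF test _ _ _ _ C]) (auto simp: plateau_zero)
    then show "(\<integral>\<^sup>+\<omega>. ennreal (\<bar>W \<omega> ?\<phi>\<bar> powr (\<epsilon> / 2)) \<partial>M) \<le> B" by (simp add: B_def)
  qed (use C in auto)
  have "AE \<omega> in M. \<exists>S\<ge>0. \<forall>n k. \<bar>W \<omega> (\<lambda>x. cos (real k * x) * plateau n x)\<bar> \<le> S * (1 + \<bar>of_int n\<bar>) ^ (2 * q) * (1 + real k) ^ (2 * q)"
    by (rule growth[of "\<lambda>k x. cos (real k * x)"]) (auto intro: smooth_cos)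
  moreover have "AE \<omega> in M. \<exists>S\<ge>0. \<forall>n k. \<bar>W \<omega> (\<lambda>x. sin (real k * x) * plateau n x)\<bar> \<le> S * (1 + \<bar>of_int n\<bar>) ^ (2 * q) * (1 + real k) ^ (2 * q)"
    by (rule growth[of "\<lambda>k x. sin (real k * x)"]) (auto intro: smooth_sin)
  ultimately show ?thesis using AE_space
  proof eventually_elim
    case (elim \<omega>)
    obtain S where S: "S \<ge> 0" "\<And>n k. \<bar>W \<omega> (\<lambda>x. cos (real k * x) * plateau n x)\<bar> \<le> S * (1 + \<bar>of_int n\<bar>) ^ (2 * q) * (1 + real k) ^ (2 * q)"
      using elim(1) by blast
    obtain S' where S': "S' \<ge> 0" "\<And>n k. \<bar>W \<omega> (\<lambda>x. sin (real k * x) * plateau n x)\<bar> \<le> S' * (1 + \<bar>of_int n\<bar>) ^ (2 * q) * (1 + real k) ^ (2 * q)"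
      using elim(2) by blast
    have mono: "R * (1 + \<bar>of_int n\<bar>) ^ (2 * q) * (1 + real k) ^ (2 * q) \<le> max S S' * (1 + \<bar>of_int n\<bar>) ^ (2 * q) * (1 + real k) ^ (2 * q)"
      if "R \<le> max S S'" for R :: real and n :: int and k :: nat
      using that by (intro mult_right_mono) auto
    show ?case
      by (rule tempered_if_trig_bounds[OF W_generalized[OF elim(3)], of "max S S'" "2 * q"])
         (use S(1) order_trans[OF S(2) mono] order_trans[OF S'(2) mono] in auto)
  qed
qed

end

section \<open>Polynomial rates along the integers\<close>

text \<open>A bound \<open>K / N\<close> that holds as soon as \<open>\<xi>\<close> is below a negative power of \<open>N\<close> is a power bound in \<open>\<xi>\<close>:
  take for \<open>N\<close> the largest admissible integer.\<close>

lemma eventually_powr_bound_if_rate: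
  fixes f :: "real \<Rightarrow> real"
  assumes c: "c > 0" and b: "b > 0" and K: "K \<ge> 0"
    and rate: "\<And>N \<xi>. 1 \<le> N \<Longrightarrow> 0 < \<xi> \<Longrightarrow> \<xi> \<le> c / real N powr b \<Longrightarrow> f \<xi> \<le> K / real N"
  shows "eventually (\<lambda>\<xi>. f \<xi> \<le> 2 * K * c powr (- (1 / b)) * \<xi> powr (1 / b)) (at_right 0)"
proof -
  have "f \<xi> \<le> 2 * K * c powr (- (1 / b)) * \<xi> powr (1 / b)" if \<xi>: "0 < \<xi>" "\<xi> < c" for \<xi>
  proof -
    define y where "y = (c / \<xi>) powr (1 / b)"
    have y: "1 \<le> y" unfolding y_def using \<xi> b by (intro ge_one_powr_ge_zero) auto
    define N where "N = nat \<lfloor>y\<rfloor>"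
    have N: "1 \<le> N" "real N \<le> y" "y < real N + 1" using y by (simp_all add: N_def le_nat_floor)
    have "real N powr b \<le> y powr b" using N b by (intro powr_mono2) auto
    also have "\<dots> = c / \<xi>" using \<xi> c b by (simp add: y_def powr_powr)
    finally have "\<xi> \<le> c / real N powr b" using \<xi> N by (simp add: field_simps)
    from rate[OF N(1) \<xi>(1) this] have "f \<xi> \<le> K / real N" .
    also have "\<dots> \<le> K / (y / 2)" using K y N by (intro divide_left_mono mult_pos_pos) auto
    also have "\<dots> = 2 * K * c powr (- (1 / b)) * \<xi> powr (1 / b)"
      using \<xi> c by (simp add: y_def powr_divide powr_minus field_simps)
    finally show ?thesis .
  qed
  then show ?thesis using c by (auto simp: eventually_at_right_field)
qed

lemma exp_minus_lower_imp_le: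
  assumes "1 - t \<le> exp (- u)" "t \<le> 1 / 2" "0 \<le> t"
  shows "u \<le> 2 * (t::real)"
proof -
  have "exp (- (2 * t)) \<le> 1 / (1 + 2 * t)"
    using exp_ge_add_one_self[of "2 * t"] assms(3) by (simp add: exp_minus inverse_eq_divide frac_le)
  also have "\<dots> \<le> 1 - t"
  proof -
    have "0 \<le> t * (1 - 2 * t)" using assms by (intro mult_nonneg_nonneg) auto
    then have "1 \<le> (1 - t) * (1 + 2 * t)" by (simp add: algebra_simps)
    then show ?thesis using assms(3) by (simp add: divide_le_eq)
  qed
  finally show ?thesis using assms(1) by (meson exp_le_cancel_iff neg_le_iff_le order_trans)
qed

lemma half_one_plus_cos_ge: "1 - y\<^sup>2 / 4 \<le> (1 + cos y) / (2::real)"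
proof -
  have "(sin (y / 2))\<^sup>2 \<le> (y / 2)\<^sup>2" using abs_sin_x_le_abs_x[of "y / 2"] by (rule abs_le_square_iff[THEN iffD1])
  moreover have "cos y = 1 - 2 * (sin (y / 2))\<^sup>2" using cos_double_sin[of "y / 2"] by simp
  ultimately show ?thesis by (simp add: power_divide)
qed

lemma half_one_plus_cos_range: "0 \<le> (1 + cos y) / 2" "(1 + cos y) / 2 \<le> (1::real)"
proof -
  have "0 \<le> (1 + c) / 2 \<and> (1 + c) / 2 \<le> 1" if "- 1 \<le> c" "c \<le> 1" for c :: real
    using that by simp
  from this[OF cos_ge_minus_one cos_le_one] show "0 \<le> (1 + cos y) / 2" "(1 + cos y) / 2 \<le> (1::real)" by blast+
qed

lemma bump_shift_zero: "x \<notin> {b<..<b + 1} \<Longrightarrow> bump (x - b) = 0"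
  by (rule bump_zero) auto

context levy_noise
begin

text \<open>The modulus of the characteristic functional is the exponential of the real part of the exponent,
  so closeness of the functional to 1 bounds that real part.\<close>

lemma fractional_moment_if_cf_small:
  assumes \<phi>: "\<phi> \<in> test_functions" "\<phi> \<noteq> (\<lambda>x. 0)" and \<eta>: "\<eta> > 0"
    and small: "eventually (\<lambda>\<xi>. 1 - Re (cf (\<lambda>x. \<xi> * \<phi> x)) \<le> D * \<xi> powr \<eta>) (at_right 0)"
  shows fractional_moment
proof (rule fractional_moment_if_exponent_small[OF \<phi> \<eta>])
  have "((\<lambda>\<xi>. max D 0 * \<xi> powr \<eta>) \<longlongrightarrow> max D 0 * 0 powr \<eta>) (at_right 0)"
    using \<eta> by (intro tendsto_intros tendsto_powr2) (auto simp: eventually_at_filter)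
  then have "((\<lambda>\<xi>. max D 0 * \<xi> powr \<eta>) \<longlongrightarrow> 0) (at_right 0)" by simp
  then have "eventually (\<lambda>\<xi>. max D 0 * \<xi> powr \<eta> < 1 / 2) (at_right 0)"
    by (rule order_tendstoD(2)) simp
  with small show "eventually (\<lambda>\<xi>. - Re (exponent (\<lambda>x. \<xi> * \<phi> x)) \<le> (2 * max D 0) * \<xi> powr \<eta>) (at_right 0)"
  proof eventually_elim
    case (elim \<xi>)
    have "D * \<xi> powr \<eta> \<le> max D 0 * \<xi> powr \<eta>" by (intro mult_right_mono) auto
    then have "1 - max D 0 * \<xi> powr \<eta> \<le> Re (cf (\<lambda>x. \<xi> * \<phi> x))" using elim(1) by linarith
    also have "\<dots> \<le> exp (- (- Re (exponent (\<lambda>x. \<xi> * \<phi> x))))"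
      using complex_Re_le_cmod[of "cf (\<lambda>x. \<xi> * \<phi> x)"] cmod_cf[OF test_functions_cmult[OF \<phi>(1)]] by simp
    finally have "- Re (exponent (\<lambda>x. \<xi> * \<phi> x)) \<le> 2 * (max D 0 * \<xi> powr \<eta>)"
      using elim(2) by (intro exp_minus_lower_imp_le) auto
    then show ?case by simp
  qed
qed

lemma fractional_moment_if_noise_moment:
  assumes \<phi>: "\<phi> \<in> test_functions" "\<phi> \<noteq> (\<lambda>x. 0)" and \<epsilon>: "\<epsilon> > 0"
    and moment: "(\<integral>\<^sup>+\<omega>. ennreal (\<bar>W \<omega> \<phi>\<bar> powr \<epsilon>) \<partial>M) < \<infinity>"
  shows fractional_moment
proof -
  let ?X = "\<lambda>\<omega>. W \<omega> \<phi>"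
  have X[measurable]: "?X \<in> borel_measurable M" by (rule W_measurable[OF \<phi>(1)])
  define \<delta> where "\<delta> = min 1 \<epsilon>"
  have \<delta>: "0 < \<delta>" "\<delta> \<le> 1" "\<delta> \<le> \<epsilon>" using \<epsilon> by (auto simp: \<delta>_def)
  have int: "integrable M (\<lambda>\<omega>. \<bar>?X \<omega>\<bar> powr \<delta>)"
  proof (rule integrableI_bounded)
    have "(\<integral>\<^sup>+\<omega>. ennreal (norm (\<bar>?X \<omega>\<bar> powr \<delta>)) \<partial>M) \<le> (\<integral>\<^sup>+\<omega>. 1 + ennreal (\<bar>?X \<omega>\<bar> powr \<epsilon>) \<partial>M)"
    proof (rule nn_integral_mono)
      fix \<omega>
      have "\<bar>?X \<omega>\<bar> powr \<delta> \<le> 1 + \<bar>?X \<omega>\<bar> powr \<epsilon>"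
      proof (cases "\<bar>?X \<omega>\<bar> \<le> 1")
        case True
        then have "\<bar>?X \<omega>\<bar> powr \<delta> \<le> 1" using \<delta> by (intro powr_le1) auto
        then show ?thesis by (smt (verit) powr_ge_zero)
      next
        case False
        then have "\<bar>?X \<omega>\<bar> powr \<delta> \<le> \<bar>?X \<omega>\<bar> powr \<epsilon>" using \<delta> by (intro powr_mono) auto
        then show ?thesis by simp
      qed
      then have "ennreal (\<bar>?X \<omega>\<bar> powr \<delta>) \<le> ennreal (1 + \<bar>?X \<omega>\<bar> powr \<epsilon>)" by (rule ennreal_leI)
      then show "ennreal (norm (\<bar>?X \<omega>\<bar> powr \<delta>)) \<le> 1 + ennreal (\<bar>?X \<omega>\<bar> powr \<epsilon>)" by simp
    qed
    also have "\<dots> = 1 + (\<integral>\<^sup>+\<omega>. ennreal (\<bar>?X \<omega>\<bar> powr \<epsilon>) \<partial>M)"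
      by (subst nn_integral_add) (auto simp: emeasure_space_1)
    also have "\<dots> < \<infinity>" using moment by (simp add: ennreal_add_eq_top less_top[symmetric])
    finally show "(\<integral>\<^sup>+\<omega>. ennreal (norm (\<bar>?X \<omega>\<bar> powr \<delta>)) \<partial>M) < \<infinity>" .
  qed measurable
  define D where "D = 2 * expectation (\<lambda>\<omega>. \<bar>?X \<omega>\<bar> powr \<delta>)"
  show ?thesis
  proof (rule fractional_moment_if_cf_small[OF \<phi> \<delta>(1)])
    have "1 - Re (cf (\<lambda>x. \<xi> * \<phi> x)) \<le> D * \<xi> powr \<delta>" if \<xi>: "\<xi> > 0" for \<xi>
    proof -
      have test: "(\<lambda>x. \<xi> * \<phi> x) \<in> test_functions" by (rule test_functions_cmult[OF \<phi>(1)])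
      have "expectation (\<lambda>\<omega>. 1 - cos (W \<omega> (\<lambda>x. \<xi> * \<phi> x))) \<le> expectation (\<lambda>\<omega>. (2 * \<xi> powr \<delta>) * \<bar>?X \<omega>\<bar> powr \<delta>)"
      proof (rule integral_mono)
        show "integrable M (\<lambda>\<omega>. 1 - cos (W \<omega> (\<lambda>x. \<xi> * \<phi> x)))"
          by (intro Bochner_Integration.integrable_diff integrable_cos_W test) simp
        fix \<omega> assume \<omega>: "\<omega> \<in> space M"
        have "1 - cos (\<xi> * ?X \<omega>) \<le> cmod (iexp (\<xi> * ?X \<omega>) - 1)"
          using complex_Re_le_cmod[of "1 - iexp (\<xi> * ?X \<omega>)"] by (simp add: norm_minus_commute Re_exp)
        also have "\<dots> \<le> 2 * \<bar>\<xi> * ?X \<omega>\<bar> powr \<delta>" using \<delta> by (intro cmod_iexp_minus_one_le_powr) auto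
        also have "\<dots> = (2 * \<xi> powr \<delta>) * \<bar>?X \<omega>\<bar> powr \<delta>" using \<xi> by (simp add: abs_mult powr_mult)
        finally show "1 - cos (W \<omega> (\<lambda>x. \<xi> * \<phi> x)) \<le> (2 * \<xi> powr \<delta>) * \<bar>?X \<omega>\<bar> powr \<delta>"
          by (simp add: generalized_function_cmult[OF W_generalized[OF \<omega>] \<phi>(1)])
      qed (intro integrable_mult_right int)
      then show ?thesis by (simp add: one_minus_Re_cf[OF test] D_def mult_ac)
    qed
    then show "eventually (\<lambda>\<xi>. 1 - Re (cf (\<lambda>x. \<xi> * \<phi> x)) \<le> D * \<xi> powr \<delta>) (at_right 0)"
      by (auto simp: eventually_at_right_field intro: exI[of _ 1])
  qed
qed

subsection \<open>Continuity of the characteristic functional\<close>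

text \<open>Positive definiteness in quantitative form: continuity of the characteristic functional everywhere
  reduces to continuity at 0. The parameter \<open>\<delta>\<close> avoids a square root.\<close>

lemma cf_diff_le:
  assumes \<phi>: "\<phi> \<in> test_functions" "\<psi> \<in> test_functions" and \<delta>: "\<delta> > 0"
  shows "cmod (cf \<psi> - cf \<phi>) \<le> \<delta> + 2 * (1 - Re (cf (\<lambda>x. \<psi> x - \<phi> x))) / \<delta>"
proof -
  let ?d = "\<lambda>x. \<psi> x - \<phi> x"
  have d: "?d \<in> test_functions" by (rule test_functions_diff[OF \<phi>(2,1)])
  have "cf \<psi> - cf \<phi> = (LINT \<omega>|M. iexp (W \<omega> \<psi>) - iexp (W \<omega> \<phi>))"
    unfolding characteristic_functional_def using integrable_iexp_W[OF \<phi>(1)] integrable_iexp_W[OF \<phi>(2)] by simp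
  also have "cmod \<dots> \<le> expectation (\<lambda>\<omega>. cmod (iexp (W \<omega> \<psi>) - iexp (W \<omega> \<phi>)))"
    by (rule integral_norm_bound)
  also have "\<dots> \<le> expectation (\<lambda>\<omega>. \<delta> + 2 * (1 - cos (W \<omega> ?d)) / \<delta>)"
  proof (rule integral_mono)
    show "integrable M (\<lambda>\<omega>. cmod (iexp (W \<omega> \<psi>) - iexp (W \<omega> \<phi>)))"
      by (intro integrable_norm Bochner_Integration.integrable_diff integrable_iexp_W \<phi>)
    show "integrable M (\<lambda>\<omega>. \<delta> + 2 * (1 - cos (W \<omega> ?d)) / \<delta>)"
      using integrable_cos_W[OF d] by simp
    fix \<omega> assume \<omega>: "\<omega> \<in> space M"
    define y where "y = W \<omega> ?d"
    have "W \<omega> \<psi> = W \<omega> \<phi> + y"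
      using generalized_function_diff[OF W_generalized[OF \<omega>] \<phi>(2,1)] by (simp add: y_def)
    then have "iexp (W \<omega> \<psi>) - iexp (W \<omega> \<phi>) = iexp (W \<omega> \<phi>) * (iexp y - 1)"
      by (simp add: algebra_simps exp_add)
    then have "cmod (iexp (W \<omega> \<psi>) - iexp (W \<omega> \<phi>)) = cmod (iexp y - 1)" by (simp add: norm_mult)
    also have "\<dots> \<le> \<delta> + (cmod (iexp y - 1))\<^sup>2 / \<delta>"
    proof (cases "cmod (iexp y - 1) \<le> \<delta>")
      case True
      then show ?thesis using \<delta> by (simp add: add_increasing2)
    next
      case False
      then have "cmod (iexp y - 1) * \<delta> \<le> (cmod (iexp y - 1))\<^sup>2"
        unfolding power2_eq_square by (intro mult_left_mono) auto
      then have "cmod (iexp y - 1) \<le> (cmod (iexp y - 1))\<^sup>2 / \<delta>" using \<delta> by (simp add: pos_le_divide_eq)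
      then show ?thesis using \<delta> by simp
    qed
    also have "\<dots> = \<delta> + 2 * (1 - cos y) / \<delta>" by (simp only: cmod_iexp_minus_one_sq)
    finally show "cmod (iexp (W \<omega> \<psi>) - iexp (W \<omega> \<phi>)) \<le> \<delta> + 2 * (1 - cos (W \<omega> ?d)) / \<delta>"
      by (simp add: y_def)
  qed
  also have "\<dots> = \<delta> + 2 * expectation (\<lambda>\<omega>. 1 - cos (W \<omega> ?d)) / \<delta>"
    using integrable_cos_W[OF d] by (simp add: prob_space)
  also have "\<dots> = \<delta> + 2 * (1 - Re (cf ?d)) / \<delta>" by (simp only: one_minus_Re_cf[OF d])
  finally show ?thesis .
qed

text \<open>The exponent \<open>2 / \<epsilon>\<close> of the weight is chosen so that the power \<open>\<epsilon>\<close> of the decay is \<open>1 / x\<^sup>2\<close>, which is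
  integrable.\<close>

lemma exponent_le_if_decay:
  assumes \<phi>: "\<phi> \<in> test_functions" and r: "0 < r"
    and C: "C > 0" "0 < \<epsilon>" "\<And>\<xi>. cmod (\<Psi> \<xi>) \<le> C * (\<bar>\<xi>\<bar> powr \<epsilon> + \<bar>\<xi>\<bar>\<^sup>2)"
    and decay: "\<And>x. \<bar>\<phi> x\<bar> \<le> r" "\<And>x. \<bar>x\<bar> * \<bar>\<phi> x\<bar> \<le> r" "\<And>x. \<bar>x\<bar> powr (2 / \<epsilon>) * \<bar>\<phi> x\<bar> \<le> r"
  shows "cmod (exponent \<phi>) \<le> C * (2 * r powr \<epsilon> + 2 * r\<^sup>2) * (LINT x|lborel. inverse (1 + x\<^sup>2))"
proof -
  have J: "integrable lborel (\<lambda>x::real. inverse (1 + x\<^sup>2))"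
    using integrable_inverse_1_plus_square by (simp add: set_integrable_def)
  have pt: "cmod (\<Psi> (\<phi> x)) \<le> C * (2 * r powr \<epsilon> + 2 * r\<^sup>2) * inverse (1 + x\<^sup>2)" for x
  proof -
    have pos: "1 + x\<^sup>2 > 0" by (simp add: add_pos_nonneg)
    have "x\<^sup>2 * \<bar>\<phi> x\<bar> powr \<epsilon> = (\<bar>x\<bar> powr (2 / \<epsilon>) * \<bar>\<phi> x\<bar>) powr \<epsilon>"
      using C(2) by (cases "x = 0") (simp_all add: powr_mult powr_powr)
    also have "\<dots> \<le> r powr \<epsilon>" using decay(3) C(2) by (intro powr_mono2) auto
    finally have 1: "x\<^sup>2 * \<bar>\<phi> x\<bar> powr \<epsilon> \<le> r powr \<epsilon>" .
    have 2: "\<bar>\<phi> x\<bar> powr \<epsilon> \<le> r powr \<epsilon>" using decay(1) C(2) by (intro powr_mono2) auto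
    have 3: "\<bar>\<phi> x\<bar>\<^sup>2 \<le> r\<^sup>2" using decay(1) by (intro power_mono) auto
    have "(\<bar>x\<bar> * \<bar>\<phi> x\<bar>)\<^sup>2 \<le> r\<^sup>2" using decay(2) by (intro power_mono) auto
    then have 4: "x\<^sup>2 * \<bar>\<phi> x\<bar>\<^sup>2 \<le> r\<^sup>2" by (simp add: power_mult_distrib)
    have "(1 + x\<^sup>2) * (\<bar>\<phi> x\<bar> powr \<epsilon> + \<bar>\<phi> x\<bar>\<^sup>2) \<le> 2 * r powr \<epsilon> + 2 * r\<^sup>2"
      using 1 2 3 4 by (simp add: algebra_simps)
    then have "\<bar>\<phi> x\<bar> powr \<epsilon> + \<bar>\<phi> x\<bar>\<^sup>2 \<le> (2 * r powr \<epsilon> + 2 * r\<^sup>2) * inverse (1 + x\<^sup>2)"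
      using pos by (simp add: field_simps)
    then have "C * (\<bar>\<phi> x\<bar> powr \<epsilon> + \<bar>\<phi> x\<bar>\<^sup>2) \<le> C * ((2 * r powr \<epsilon> + 2 * r\<^sup>2) * inverse (1 + x\<^sup>2))"
      using C(1) by (intro mult_left_mono) auto
    from order_trans[OF C(3) this] show ?thesis by (simp only: mult.assoc)
  qed
  have "cmod (exponent \<phi>) \<le> (LINT x|lborel. C * (2 * r powr \<epsilon> + 2 * r\<^sup>2) * inverse (1 + x\<^sup>2))"
    unfolding exponent_def
    by (rule Bochner_Integration.integral_norm_bound_integral[OF \<Psi>_test_integrable[OF \<phi>] _ pt])
       (intro integrable_mult_right J)
  also have "\<dots> = C * (2 * r powr \<epsilon> + 2 * r\<^sup>2) * (LINT x|lborel. inverse (1 + x\<^sup>2))" by simp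
  finally show ?thesis .
qed

lemma cf_continuous_if_bound:
  assumes C: "C > 0" "0 < \<epsilon>" "\<And>\<xi>. cmod (\<Psi> \<xi>) \<le> C * (\<bar>\<xi>\<bar> powr \<epsilon> + \<bar>\<xi>\<bar>\<^sup>2)"
  shows "continuous_map (subtopology schwartz_topology test_functions) euclidean cf"
  unfolding continuous_map_schwartz_iff[OF test_functions_subset_schwartz]
proof (intro ballI allI impI)
  fix \<phi> e assume \<phi>: "\<phi> \<in> test_functions" and e: "(e::real) > 0"
  define J where "J = (LINT x|lborel. inverse (1 + (x::real)\<^sup>2))"
  have "((\<lambda>r. 3 * (C * (2 * r powr \<epsilon> + 2 * r\<^sup>2) * J)) \<longlongrightarrow> 3 * (C * (2 * 0 powr \<epsilon> + 2 * 0\<^sup>2) * J)) (at_right 0)"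
    using C(2) by (intro tendsto_intros tendsto_powr2) (auto simp: eventually_at_filter)
  then have "((\<lambda>r. 3 * (C * (2 * r powr \<epsilon> + 2 * r\<^sup>2) * J)) \<longlongrightarrow> 0) (at_right 0)" by simp
  then have "eventually (\<lambda>r. 3 * (C * (2 * r powr \<epsilon> + 2 * r\<^sup>2) * J) < e\<^sup>2 / 8) (at_right 0)"
    by (rule order_tendstoD(2)) (use e in simp)
  moreover have "eventually (\<lambda>r::real. r > 0) (at_right 0)" by (rule eventually_at_right_less)
  ultimately have "eventually (\<lambda>r. 3 * (C * (2 * r powr \<epsilon> + 2 * r\<^sup>2) * J) < e\<^sup>2 / 8 \<and> r > 0) (at_right 0)"
    by (rule eventually_conj)
  then obtain r where r: "3 * (C * (2 * r powr \<epsilon> + 2 * r\<^sup>2) * J) < e\<^sup>2 / 8" "r > 0"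
    using eventually_happens'[OF trivial_limit_at_right_real] by blast
  define F where "F = {(0, 0), (1, 0), (2 / \<epsilon>, 0::nat)}"
  have "dist (cf \<psi>) (cf \<phi>) < e"
    if \<psi>: "\<psi> \<in> test_functions" and small: "\<forall>(\<alpha>, \<beta>)\<in>F. schwartz_seminorm \<alpha> \<beta> (\<lambda>x. \<psi> x - \<phi> x) < r" for \<psi>
  proof -
    let ?d = "\<lambda>x. \<psi> x - \<phi> x"
    have d: "?d \<in> test_functions" by (rule test_functions_diff[OF \<psi> \<phi>])
    have le: "schwartz_weight \<alpha> x * \<bar>?d x\<bar> \<le> r" if "\<alpha> \<in> {0, 1, 2 / \<epsilon>}" for \<alpha> x
    proof -
      have "\<alpha> \<ge> 0" "schwartz_seminorm \<alpha> 0 ?d < r" using that small C(2) by (auto simp: F_def)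
      then show ?thesis
        using schwartz_seminorm_upper[of ?d \<alpha> x 0] d test_functions_subset_schwartz by force
    qed
    have "cmod (exponent ?d) \<le> C * (2 * r powr \<epsilon> + 2 * r\<^sup>2) * J"
      unfolding J_def
    proof (rule exponent_le_if_decay[OF d r(2) C])
      show "\<bar>?d x\<bar> \<le> r" for x using le[of 0 x] by (simp add: schwartz_weight_def)
      show "\<bar>x\<bar> * \<bar>?d x\<bar> \<le> r" for x using le[of 1 x] by (simp add: schwartz_weight_def)
      show "\<bar>x\<bar> powr (2 / \<epsilon>) * \<bar>?d x\<bar> \<le> r" for x using le[of "2 / \<epsilon>" x] C(2) by (simp add: schwartz_weight_def)
    qed
    then have "1 - Re (cf ?d) < e\<^sup>2 / 8" using one_minus_Re_cf_le[OF d] r(1) by linarith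
    then have "2 * (1 - Re (cf ?d)) / (e / 2) < e / 2" using e by (simp add: field_simps power2_eq_square)
    then show ?thesis using cf_diff_le[OF \<phi> \<psi> half_gt_zero[OF e]] unfolding dist_norm by linarith
  qed
  moreover have "finite F" "F \<subseteq> {0..} \<times> UNIV" using C(2) by (auto simp: F_def)
  ultimately show "\<exists>F r. finite F \<and> F \<subseteq> {0..} \<times> UNIV \<and> r > 0 \<and>
     (\<forall>\<psi>\<in>test_functions. (\<forall>(\<alpha>, \<beta>)\<in>F. schwartz_seminorm \<alpha> \<beta> (\<lambda>x. \<psi> x - \<phi> x) < r) \<longrightarrow> dist (cf \<psi>) (cf \<phi>) < e)"
    using r(2) by blast
qed

lemma bump_shift_test: "(\<lambda>x. bump (x - b)) \<in> test_functions"
  by (rule test_functions_shift[OF bump_test])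

lemma bump_nonzero: "bump \<noteq> (\<lambda>x. 0)"
  using bump_pos[of "1 / 2"] by (auto dest: fun_cong[of _ _ "1 / 2"])

lemma exponent_bump_train:
  "exponent (\<lambda>x. \<Sum>n<N. \<xi> * bump (x - real n)) = of_nat N * exponent (\<lambda>x. \<xi> * bump x)"
proof (induction N)
  case 0
  then show ?case by (simp add: exponent_zero)
next
  case (Suc N)
  have test: "(\<lambda>x. \<Sum>n<N. \<xi> * bump (x - real n)) \<in> test_functions" "(\<lambda>x. \<xi> * bump (x - real N)) \<in> test_functions"
    by (intro test_functions_sum test_functions_cmult bump_shift_test)+
  have "(\<Sum>n<N. \<xi> * bump (x - real n)) = 0 \<or> \<xi> * bump (x - real N) = 0" for x
  proof (cases "x \<in> {real N<..<real N + 1}")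
    case True
    then have "bump (x - real n) = 0" if "n < N" for n using that by (intro bump_shift_zero) auto
    then show ?thesis by simp
  qed (simp add: bump_shift_zero)
  from exponent_add_disjoint[OF test this]
  have "exponent (\<lambda>x. \<Sum>n<Suc N. \<xi> * bump (x - real n)) =
      exponent (\<lambda>x. \<Sum>n<N. \<xi> * bump (x - real n)) + exponent (\<lambda>x. \<xi> * bump (x - real N))" by simp
  then show ?case using Suc.IH exponent_shift[of "\<lambda>x. \<xi> * bump x" "real N"] by (simp add: distrib_right)
qed

text \<open>A train of \<open>N\<close> disjoint bumps of height \<open>\<xi>\<close> has exponent \<open>N\<close> times that of a single bump, while its
  seminorms grow only polynomially in \<open>N\<close>. As long as they are small, continuity at 0 keeps the exponent
  of the train bounded, so that of a single bump is of order \<open>1 / N\<close>.\<close>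

lemma fractional_moment_if_cf_continuous:
  assumes "continuous_map (subtopology schwartz_topology test_functions) euclidean cf"
  shows fractional_moment
proof -
  have "\<exists>F r. finite F \<and> F \<subseteq> {0..} \<times> UNIV \<and> r > 0 \<and>
     (\<forall>\<psi>\<in>test_functions. (\<forall>(\<alpha>, \<beta>)\<in>F. schwartz_seminorm \<alpha> \<beta> (\<lambda>x. \<psi> x - 0) < r) \<longrightarrow> dist (cf \<psi>) (cf (\<lambda>x. 0)) < 1 / 2)"
    using assms[unfolded continuous_map_schwartz_iff[OF test_functions_subset_schwartz], rule_format, OF test_functions_zero, of "1 / 2"]
    by simp
  then obtain F r where F: "finite F" "F \<subseteq> {0..} \<times> UNIV" and r: "r > 0"
    and cont: "\<forall>\<psi>\<in>test_functions. (\<forall>(\<alpha>, \<beta>)\<in>F. schwartz_seminorm \<alpha> \<beta> (\<lambda>x. \<psi> x - 0) < r) \<longrightarrow> dist (cf \<psi>) (cf (\<lambda>x. 0)) < 1 / 2"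
    by (elim exE conjE) (rule that)
  obtain D a where D: "1 \<le> D" and a: "0 \<le> a"
    and DF: "\<And>\<alpha> \<beta> n. (\<alpha>, \<beta>) \<in> F \<Longrightarrow> schwartz_seminorm \<alpha> \<beta> (\<lambda>x. bump (x - of_int n)) \<le> D * (1 + \<bar>of_int n\<bar>) powr a"
    using schwartz_seminorms_shift_le[OF bump_test F] by blast
  have rate: "- Re (exponent (\<lambda>x. \<xi> * bump x)) \<le> 1 / real N"
    if N: "1 \<le> N" and \<xi>: "0 < \<xi>" "\<xi> \<le> r / (2 * D) / real N powr (a + 1)" for N \<xi>
  proof -
    let ?\<phi> = "\<lambda>x. \<Sum>n<N. \<xi> * bump (x - real n)"
    have test: "?\<phi> \<in> test_functions" by (intro test_functions_sum test_functions_cmult bump_shift_test)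
    have "schwartz_seminorm \<alpha> \<beta> (\<lambda>x. ?\<phi> x - 0) < r" if ab: "(\<alpha>, \<beta>) \<in> F" for \<alpha> \<beta>
    proof -
      have \<alpha>: "\<alpha> \<ge> 0" using F(2) ab by auto
      have "schwartz_seminorm \<alpha> \<beta> ?\<phi> \<le> (\<Sum>n<N. \<xi> * (D * real N powr a))"
      proof (rule schwartz_seminorm_le)
        fix x
        have "(deriv ^^ \<beta>) ?\<phi> x = (\<Sum>n<N. \<xi> * (deriv ^^ \<beta>) (\<lambda>x. bump (x - real n)) x)"
          using test_smooth[OF bump_shift_test] by (simp add: higher_deriv_sum smooth_cmult higher_deriv_cmult)
        then have "schwartz_weight \<alpha> x * \<bar>(deriv ^^ \<beta>) ?\<phi> x\<bar> \<le>
            schwartz_weight \<alpha> x * (\<Sum>n<N. \<bar>\<xi> * (deriv ^^ \<beta>) (\<lambda>x. bump (x - real n)) x\<bar>)"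
          by (simp add: mult_left_mono schwartz_weight_nonneg sum_abs)
        also have "\<dots> = (\<Sum>n<N. \<xi> * (schwartz_weight \<alpha> x * \<bar>(deriv ^^ \<beta>) (\<lambda>x. bump (x - real n)) x\<bar>))"
          using \<xi>(1) by (simp add: sum_distrib_left abs_mult mult_ac)
        also have "\<dots> \<le> (\<Sum>n<N. \<xi> * (D * real N powr a))"
        proof (intro sum_mono mult_left_mono)
          fix n assume "n \<in> {..<N}"
          then have n: "1 + real n \<le> real N" by simp
          have "schwartz_weight \<alpha> x * \<bar>(deriv ^^ \<beta>) (\<lambda>x. bump (x - real n)) x\<bar> \<le> schwartz_seminorm \<alpha> \<beta> (\<lambda>x. bump (x - real n))"
            using bump_shift_test test_functions_subset_schwartz by (intro schwartz_seminorm_upper \<alpha>) auto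
          also have "\<dots> \<le> D * (1 + real n) powr a" using DF[OF ab, of "int n"] by simp
          also have "\<dots> \<le> D * real N powr a" using D a n by (intro mult_left_mono powr_mono2) auto
          finally show "schwartz_weight \<alpha> x * \<bar>(deriv ^^ \<beta>) (\<lambda>x. bump (x - real n)) x\<bar> \<le> D * real N powr a" .
        qed (use \<xi> in auto)
        finally show "schwartz_weight \<alpha> x * \<bar>(deriv ^^ \<beta>) ?\<phi> x\<bar> \<le> (\<Sum>n<N. \<xi> * (D * real N powr a))" .
      qed
      also have "\<dots> = \<xi> * D * real N powr (a + 1)" using N by (simp add: powr_add)
      also have "\<dots> \<le> (r / (2 * D) / real N powr (a + 1)) * D * real N powr (a + 1)"
        using \<xi>(2) D by (intro mult_right_mono) auto
      also have "\<dots> = r / 2" using D N by simp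
      also have "\<dots> < r" using r by simp
      finally show ?thesis by simp
    qed
    then have "dist (cf ?\<phi>) 1 < 1 / 2" using cont test by (auto simp: cf_zero)
    then have "1 / 2 \<le> cmod (cf ?\<phi>)"
      using norm_triangle_ineq2[of 1 "1 - cf ?\<phi>"] by (simp add: dist_norm norm_minus_commute)
    also have "\<dots> = exp (- (real N * (- Re (exponent (\<lambda>x. \<xi> * bump x)))))"
      unfolding cmod_cf[OF test] exponent_bump_train by simp
    finally have "1 - 1 / 2 \<le> exp (- (real N * (- Re (exponent (\<lambda>x. \<xi> * bump x)))))" by simp
    from exp_minus_lower_imp_le[OF this] have "real N * (- Re (exponent (\<lambda>x. \<xi> * bump x))) \<le> 1" by simp
    then show ?thesis using N by (simp add: field_simps)
  qed
  have "eventually (\<lambda>\<xi>. - Re (exponent (\<lambda>x. \<xi> * bump x)) \<le>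
     2 * 1 * (r / (2 * D)) powr (- (1 / (a + 1))) * \<xi> powr (1 / (a + 1))) (at_right 0)"
    by (rule eventually_powr_bound_if_rate) (use D a r rate in auto)
  from fractional_moment_if_exponent_small[OF bump_test bump_nonzero _ this] a show ?thesis by simp
qed

subsection \<open>Growth of the noise along translates\<close>

text \<open>The form in which the independence of the noise on disjoint intervals is used. Expanding each cosine
  into exponentials reduces the identity to the characteristic functional, whose exponent is additive
  for disjoint supports; the test function \<open>\<psi>\<close> absorbs the exponentials during the induction.\<close>

lemma expectation_cosine_product:
  assumes "\<psi> \<in> test_functions" "\<And>x. x \<in> {0..real N} \<Longrightarrow> \<psi> x = 0"
  shows "(LINT \<omega>|M. iexp (W \<omega> \<psi>) * of_real (\<Prod>n<N. (1 + cos (W \<omega> (\<lambda>x. s * bump (x - real n)))) / 2))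
    = cf \<psi> * of_real (((1 + Re (cf (\<lambda>x. s * bump x))) / 2) ^ N)"
  using assms
proof (induction N arbitrary: \<psi>)
  case 0
  then show ?case by (simp add: characteristic_functional_def)
next
  case (Suc N)
  define P where "P \<omega> = (\<Prod>n<N. (1 + cos (W \<omega> (\<lambda>x. s * bump (x - real n)))) / 2)" for \<omega>
  define r where "r = (1 + Re (cf (\<lambda>x. s * bump x))) / 2"
  have test: "(\<lambda>x. c * bump (x - real n)) \<in> test_functions" for c n
    by (intro test_functions_cmult bump_shift_test)
  have W_test[measurable]: "(\<lambda>\<omega>. W \<omega> (\<lambda>x. c * bump (x - real n))) \<in> borel_measurable M" for c n
    by (rule W_measurable[OF test])
  have P[measurable]: "P \<in> borel_measurable M" unfolding P_def by measurable
  have P01: "\<bar>P \<omega>\<bar> \<le> 1" for \<omega>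
  proof -
    have "\<bar>(1 + cos y) / 2\<bar> \<le> 1" for y :: real
      using half_one_plus_cos_range[of y] by (subst abs_of_nonneg)
    then show ?thesis unfolding P_def abs_prod by (intro prod_le_1 conjI abs_ge_zero)
  qed
  have int: "integrable M (\<lambda>\<omega>. iexp (W \<omega> \<theta>) * of_real (P \<omega>))" if "\<theta> \<in> test_functions" for \<theta>
  proof (rule integrable_const_bound[where B = 1])
    show "AE \<omega> in M. cmod (iexp (W \<omega> \<theta>) * of_real (P \<omega>)) \<le> 1" using P01 by (simp add: norm_mult)
    show "(\<lambda>\<omega>. iexp (W \<omega> \<theta>) * of_real (P \<omega>)) \<in> borel_measurable M"
      using W_measurable[OF that] by measurable
  qed
  let ?\<psi> = "\<lambda>c x. \<psi> x + c * bump (x - real N)"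
  have \<psi>_test: "?\<psi> c \<in> test_functions" for c by (intro test_functions_add Suc.prems(1) test)
  have \<psi>_zero: "?\<psi> c x = 0" if "x \<in> {0..real N}" for c x
    using Suc.prems(2)[of x] that bump_shift_zero[of x "real N"] by auto
  have cf_\<psi>: "cf (?\<psi> c) = cf \<psi> * cf (\<lambda>x. c * bump x)" for c
  proof -
    have "\<psi> x = 0 \<or> c * bump (x - real N) = 0" for x
    proof (cases "x \<in> {real N<..<real N + 1}")
      case True
      then show ?thesis using Suc.prems(2)[of x] by auto
    qed (simp add: bump_shift_zero)
    then have "exponent (?\<psi> c) = exponent \<psi> + exponent (\<lambda>x. c * bump (x - real N))"
      by (intro exponent_add_disjoint Suc.prems(1) test)
    then show ?thesis
      using exponent_shift[of "\<lambda>x. c * bump x" "real N"] cf_eq[OF \<psi>_test] cf_eq[OF Suc.prems(1)]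
        cf_eq[OF test_functions_cmult[OF bump_test]]
      by (simp add: exp_add)
  qed
  have IH: "(LINT \<omega>|M. iexp (W \<omega> (?\<psi> c)) * of_real (P \<omega>)) = cf \<psi> * cf (\<lambda>x. c * bump x) * of_real (r ^ N)" for c
    using Suc.IH[OF \<psi>_test \<psi>_zero] cf_\<psi> unfolding P_def r_def by simp
  have "\<And>x. x \<in> {0..real N} \<Longrightarrow> \<psi> x = 0" using Suc.prems(2) by auto
  then have IH0: "(LINT \<omega>|M. iexp (W \<omega> \<psi>) * of_real (P \<omega>)) = cf \<psi> * of_real (r ^ N)"
    using Suc.IH[OF Suc.prems(1)] unfolding P_def r_def by simp
  have pt: "iexp (W \<omega> \<psi>) * of_real (\<Prod>n<Suc N. (1 + cos (W \<omega> (\<lambda>x. s * bump (x - real n)))) / 2) =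
      iexp (W \<omega> \<psi>) * of_real (P \<omega>) / 2 + iexp (W \<omega> (?\<psi> s)) * of_real (P \<omega>) / 4 + iexp (W \<omega> (?\<psi> (- s))) * of_real (P \<omega>) / 4"
    if \<omega>: "\<omega> \<in> space M" for \<omega>
  proof -
    define y where "y = W \<omega> (\<lambda>x. s * bump (x - real N))"
    have "W \<omega> (?\<psi> s) = W \<omega> \<psi> + y"
      unfolding y_def by (rule generalized_function_add[OF W_generalized[OF \<omega>] Suc.prems(1) test])
    moreover have "W \<omega> (?\<psi> (- s)) = W \<omega> \<psi> - y"
      using generalized_function_diff[OF W_generalized[OF \<omega>] Suc.prems(1) test[of s N]] by (simp add: y_def)
    ultimately have e: "iexp (W \<omega> (?\<psi> s)) = iexp (W \<omega> \<psi>) * iexp y" "iexp (W \<omega> (?\<psi> (- s))) = iexp (W \<omega> \<psi>) * iexp (- y)"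
      by (simp_all only:) (simp_all add: exp_add[symmetric] algebra_simps)
    have c: "complex_of_real ((1 + cos y) / 2) = 1 / 2 + iexp y / 4 + iexp (- y) / 4"
      by (simp add: complex_eq_iff Re_exp Im_exp)
    have "(\<Prod>n<Suc N. (1 + cos (W \<omega> (\<lambda>x. s * bump (x - real n)))) / 2) = P \<omega> * ((1 + cos y) / 2)"
      by (simp add: P_def y_def)
    then have "iexp (W \<omega> \<psi>) * of_real (\<Prod>n<Suc N. (1 + cos (W \<omega> (\<lambda>x. s * bump (x - real n)))) / 2) =
        iexp (W \<omega> \<psi>) * of_real (P \<omega>) * complex_of_real ((1 + cos y) / 2)" by (simp only: of_real_mult mult.assoc)
    then show ?thesis unfolding c e by (simp add: algebra_simps)
  qed
  have "(LINT \<omega>|M. iexp (W \<omega> \<psi>) * of_real (\<Prod>n<Suc N. (1 + cos (W \<omega> (\<lambda>x. s * bump (x - real n)))) / 2)) =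
      (LINT \<omega>|M. iexp (W \<omega> \<psi>) * of_real (P \<omega>) / 2 + iexp (W \<omega> (?\<psi> s)) * of_real (P \<omega>) / 4 + iexp (W \<omega> (?\<psi> (- s))) * of_real (P \<omega>) / 4)"
    by (intro Bochner_Integration.integral_cong refl pt)
  also have "\<dots> = cf \<psi> * of_real (r ^ N) / 2 + cf \<psi> * cf (\<lambda>x. s * bump x) * of_real (r ^ N) / 4
      + cf \<psi> * cf (\<lambda>x. (- s) * bump x) * of_real (r ^ N) / 4"
    using int[OF Suc.prems(1)] int[OF \<psi>_test[of s]] int[OF \<psi>_test[of "- s"]] IH[of s] IH[of "- s"] IH0
    by simp
  also have "\<dots> = cf \<psi> * of_real (r ^ N) * (1 / 2 + (cf (\<lambda>x. s * bump x) + cnj (cf (\<lambda>x. s * bump x))) / 4)"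
    unfolding cf_uminus[OF bump_test] by (simp add: algebra_simps)
  also have "1 / 2 + (cf (\<lambda>x. s * bump x) + cnj (cf (\<lambda>x. s * bump x))) / 4 = of_real r"
    by (simp add: r_def complex_add_cnj)
  finally show ?case by (simp add: r_def)
qed

text \<open>With positive probability \<open>p\<close> the values of the noise on the translates obey one fixed polynomial bound.
  For frequencies \<open>s\<close> below a negative power of \<open>N\<close> the product of the first \<open>N\<close> factors
  \<open>(1 + cos (s X n)) / 2\<close> is then at least one half on that event. Its expectation is the \<open>N\<close>-th power of
  \<open>(1 + Re (cf (s bump))) / 2\<close>, so this number can differ from 1 only by a multiple of \<open>1 / N\<close>.\<close>

lemma fractional_moment_if_translates_tempered:
  assumes "\<not> (AE \<omega> in M. (\<lambda>n::int. W \<omega> (\<lambda>x. bump (x - real_of_int n))) \<notin> tempered_sequences)"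
  shows fractional_moment
proof -
  define X where "X n \<omega> = W \<omega> (\<lambda>x. bump (x - real n))" for n :: nat and \<omega>
  have X[measurable]: "X n \<in> borel_measurable M" for n
    unfolding X_def by (rule W_measurable[OF bump_shift_test])
  define A where "A m = {\<omega> \<in> space M. \<forall>n. \<bar>X n \<omega>\<bar> \<le> real (Suc m) * (1 + real n) ^ m}" for m :: nat
  have A[measurable]: "A m \<in> sets M" for m unfolding A_def by measurable
  have "\<exists>m. \<omega> \<in> A m" if \<omega>: "\<omega> \<in> space M" and T: "(\<lambda>n::int. W \<omega> (\<lambda>x. bump (x - real_of_int n))) \<in> tempered_sequences" for \<omega>
  proof -
    obtain \<alpha> B where \<alpha>: "\<alpha> \<ge> 0" and B: "\<And>n::int. (1 + \<bar>real_of_int n\<bar>) powr (- \<alpha>) * \<bar>W \<omega> (\<lambda>x. bump (x - real_of_int n))\<bar> \<le> B"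
      using T by (auto simp: tempered_sequences_def bdd_above_def)
    obtain m :: nat where m: "max \<alpha> B \<le> real m" using real_arch_simple by blast
    have "\<bar>X n \<omega>\<bar> \<le> real (Suc m) * (1 + real n) ^ m" for n
    proof -
      have "(1 + real n) powr (- \<alpha>) * \<bar>X n \<omega>\<bar> \<le> B" using B[of "int n"] by (simp add: X_def)
      then have "\<bar>X n \<omega>\<bar> \<le> B * (1 + real n) powr \<alpha>" by (simp add: powr_minus field_simps)
      also have "\<dots> \<le> real (Suc m) * (1 + real n) powr real m"
        using m \<alpha> by (intro mult_mono powr_mono) auto
      also have "(1 + real n) powr real m = (1 + real n) ^ m" by (intro powr_realpow) simp
      finally show ?thesis .
    qed
    then show ?thesis using \<omega> by (auto simp: A_def)
  qed
  note tempered_A = this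
  obtain m where "prob (A m) \<noteq> 0"
  proof (rule ccontr)
    assume "\<not> thesis"
    then have "prob (A m) = 0" for m using that by blast
    then have "AE \<omega> in M. \<omega> \<notin> A m" for m
      by (intro AE_not_in) (simp add: null_sets_def emeasure_eq_measure)
    then have "AE \<omega> in M. \<forall>m. \<omega> \<notin> A m" by (simp add: AE_all_countable)
    with AE_space have "AE \<omega> in M. (\<lambda>n::int. W \<omega> (\<lambda>x. bump (x - real_of_int n))) \<notin> tempered_sequences"
      by eventually_elim (use tempered_A in blast)
    then show False using assms by blast
  qed
  define p where "p = prob (A m)"
  have p: "0 < p" "p \<le> 1" using \<open>prob (A m) \<noteq> 0\<close> by (auto simp: p_def zero_less_measure_iff)
  define K where "K = 2 * ln (2 / p)"
  have K: "K \<ge> 0" using p by (simp add: K_def)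
  have rate: "1 - Re (cf (\<lambda>x. s * bump x)) \<le> K / real N"
    if N: "1 \<le> N" and s: "0 < s" "s \<le> 1 / real (Suc m) / real N powr (real m + 1)" for N s
  proof -
    define P where "P \<omega> = (\<Prod>n<N. (1 + cos (W \<omega> (\<lambda>x. s * bump (x - real n)))) / 2)" for \<omega>
    have P_eq: "P \<omega> = (\<Prod>n<N. (1 + cos (s * X n \<omega>)) / 2)" if "\<omega> \<in> space M" for \<omega>
      unfolding P_def X_def generalized_function_cmult[OF W_generalized[OF that] bump_shift_test] ..
    have W_test[measurable]: "(\<lambda>\<omega>. W \<omega> (\<lambda>x. s * bump (x - real n))) \<in> borel_measurable M" for n
      by (intro W_measurable test_functions_cmult bump_shift_test)
    have P[measurable]: "P \<in> borel_measurable M" unfolding P_def by measurable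
    have P01: "0 \<le> P \<omega>" "P \<omega> \<le> 1" for \<omega>
      unfolding P_def by (intro prod_nonneg prod_le_1 conjI ballI half_one_plus_cos_range)+
    have P_int: "integrable M P"
      by (rule integrable_const_bound[where B = 1]) (use P01 in auto)
    define r where "r = (1 + Re (cf (\<lambda>x. s * bump x))) / 2"
    have "complex_of_real (expectation P) = of_real (r ^ N)"
    proof -
      have "complex_of_real (expectation P) = (LINT \<omega>|M. iexp (W \<omega> (\<lambda>x. 0)) * of_real (P \<omega>))"
        unfolding integral_complex_of_real[symmetric]
        by (intro Bochner_Integration.integral_cong refl) (simp add: generalized_function_zero[OF W_generalized])
      also have "\<dots> = cf (\<lambda>x. 0) * of_real (r ^ N)"
        unfolding P_def r_def by (rule expectation_cosine_product[OF test_functions_zero]) simp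
      finally show ?thesis by (simp add: cf_zero)
    qed
    then have EP: "expectation P = r ^ N" by (simp only: of_real_eq_iff)
    have on_A: "1 / 2 \<le> P \<omega>" if "\<omega> \<in> A m" for \<omega>
    proof -
      have \<omega>: "\<omega> \<in> space M" and bound: "\<And>n. \<bar>X n \<omega>\<bar> \<le> real (Suc m) * (1 + real n) ^ m"
        using that by (auto simp: A_def)
      have "1 - 1 / (4 * real N) \<le> (1 + cos (s * X n \<omega>)) / 2" if n: "n < N" for n
      proof -
        have "\<bar>s * X n \<omega>\<bar> \<le> s * (real (Suc m) * real N ^ m)"
        proof -
          have "\<bar>X n \<omega>\<bar> \<le> real (Suc m) * real N ^ m"
            using bound[of n] n by (intro order_trans[OF bound[of n]] mult_left_mono power_mono) auto
          then show ?thesis using s(1) by (simp add: abs_mult mult_left_mono del: of_nat_Suc)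
        qed
        also have "\<dots> \<le> (1 / real (Suc m) / real N powr (real m + 1)) * (real (Suc m) * real N ^ m)"
          using s(2) by (intro mult_right_mono) auto
        also have "\<dots> = 1 / real N"
        proof -
          have "real N powr (real m + 1) = real N ^ m * real N" using N by (simp add: powr_add powr_realpow)
          then show ?thesis using N by (simp add: field_simps del: of_nat_Suc)
        qed
        finally have "\<bar>s * X n \<omega>\<bar>\<^sup>2 \<le> (1 / real N)\<^sup>2" by (intro power_mono) auto
        also have "\<dots> \<le> 1 / real N" using N by (simp add: power2_eq_square field_simps)
        finally have "(s * X n \<omega>)\<^sup>2 / 4 \<le> 1 / (4 * real N)" by simp
        then show ?thesis using half_one_plus_cos_ge[of "s * X n \<omega>"] by linarith
      qed
      then have "(\<Prod>n<N. 1 - 1 / (4 * real N)) \<le> P \<omega>"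
        unfolding P_eq[OF \<omega>] using N by (intro prod_mono) (auto simp: field_simps)
      moreover have "1 + real N * (- (1 / (4 * real N))) \<le> (1 + - (1 / (4 * real N))) ^ N"
        using N by (intro Bernoulli_inequality) (auto simp: field_simps)
      moreover have "1 + real N * (- (1 / (4 * real N))) = 3 / 4" using N by simp
      ultimately show ?thesis by simp
    qed
    have "p / 2 = expectation (\<lambda>\<omega>. (1 / 2 :: real) * indicator (A m) \<omega>)" by (simp add: p_def)
    also have "\<dots> \<le> expectation P"
    proof (rule integral_mono[OF _ P_int])
      show "integrable M (\<lambda>\<omega>. (1 / 2 :: real) * indicator (A m) \<omega>)"
        by (intro integrable_mult_right integrable_real_indicator A) (simp add: less_top[symmetric])
      show "(1 / 2 :: real) * indicator (A m) \<omega> \<le> P \<omega>" for \<omega>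
        using on_A[of \<omega>] P01[of \<omega>] by (cases "\<omega> \<in> A m") auto
    qed
    also have "\<dots> = r ^ N" by (rule EP)
    also have "\<dots> \<le> exp (- ((1 - Re (cf (\<lambda>x. s * bump x))) / 2)) ^ N"
    proof (rule power_mono)
      have r: "r = 1 + - ((1 - Re (cf (\<lambda>x. s * bump x))) / 2)" by (simp add: r_def field_simps)
      show "r \<le> exp (- ((1 - Re (cf (\<lambda>x. s * bump x))) / 2))" unfolding r by (rule exp_ge_add_one_self)
      have "exp (Re (exponent (\<lambda>x. s * bump x))) \<le> 1"
        using Re_exponent_nonpos[OF test_functions_cmult[OF bump_test]] by simp
      then have "\<bar>Re (cf (\<lambda>x. s * bump x))\<bar> \<le> 1"
        using abs_Re_le_cmod[of "cf (\<lambda>x. s * bump x)"]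
        unfolding cmod_cf[OF test_functions_cmult[OF bump_test]] by (rule order_trans[rotated])
      then show "0 \<le> r" by (simp add: r_def abs_le_iff)
    qed
    also have "\<dots> = exp (- (real N * ((1 - Re (cf (\<lambda>x. s * bump x))) / 2)))"
      by (simp add: exp_of_nat_mult[symmetric])
    finally have "ln (p / 2) \<le> - (real N * ((1 - Re (cf (\<lambda>x. s * bump x))) / 2))"
      using p by (metis exp_ln exp_le_cancel_iff half_gt_zero)
    moreover have "ln (p / 2) = - ln (2 / p)" using p by (simp add: ln_div)
    ultimately have "real N * (1 - Re (cf (\<lambda>x. s * bump x))) \<le> K" by (simp add: K_def)
    then show ?thesis using N by (simp add: field_simps)
  qed
  have "eventually (\<lambda>s. 1 - Re (cf (\<lambda>x. s * bump x)) \<le>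
     2 * K * (1 / real (Suc m)) powr (- (1 / (real m + 1))) * s powr (1 / (real m + 1))) (at_right 0)"
    by (rule eventually_powr_bound_if_rate) (use K rate in auto)
  from fractional_moment_if_cf_small[OF bump_test bump_nonzero _ this] show ?thesis by simp
qed

lemma temperedness_equivalences:
  defines "T1 \<equiv> (AE \<omega> in M. W \<omega> \<in> tempered_generalized_functions)"
    and "T2 \<equiv> continuous_map (subtopology schwartz_topology test_functions) euclidean cf"
    and "T3 \<equiv> (\<exists>C>0. \<exists>\<epsilon>>0. \<forall>\<xi>. cmod (\<Psi> \<xi>) \<le> C * (\<bar>\<xi>\<bar> powr \<epsilon> + \<bar>\<xi>\<bar>\<^sup>2))"
    and "T4 \<equiv> (\<forall>\<phi>\<in>test_functions. AE \<omega> in M. (\<lambda>n::int. W \<omega> (\<lambda>x. \<phi> (x - real_of_int n))) \<in> tempered_sequences)"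
    and "T5 \<equiv> fractional_moment"
    and "T6 \<equiv> (\<exists>\<epsilon>>0. \<forall>\<phi>\<in>test_functions. (\<integral>\<^sup>+ \<omega>. ennreal (\<bar>W \<omega> \<phi>\<bar> powr \<epsilon>) \<partial>M) < \<infinity>)"
    and "T7 \<equiv> (\<exists>\<epsilon>>0. \<exists>\<phi>\<in>test_functions - {\<lambda>x. 0}. (\<integral>\<^sup>+ \<omega>. ennreal (\<bar>W \<omega> \<phi>\<bar> powr \<epsilon>) \<partial>M) < \<infinity>)"
  shows "(T1 \<longleftrightarrow> T2) \<and> (T1 \<longleftrightarrow> T3) \<and> (T1 \<longleftrightarrow> T4) \<and> (T1 \<longleftrightarrow> T5) \<and> (T1 \<longleftrightarrow> T6) \<and> (T1 \<longleftrightarrow> T7) \<and>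
    (\<not> T1 \<longrightarrow> (AE \<omega> in M. W \<omega> \<notin> tempered_generalized_functions))"
proof -
  have growth: "\<exists>C \<epsilon>. C > 0 \<and> 0 < \<epsilon> \<and> \<epsilon> \<le> 1 \<and> (\<forall>\<xi>. cmod (\<Psi> \<xi>) \<le> C * (\<bar>\<xi>\<bar> powr \<epsilon> + \<bar>\<xi>\<bar>\<^sup>2))" if T5
    using that \<Psi>_bound_if_fractional_moment unfolding T5_def by metis
  have "T5 \<Longrightarrow> T3" using growth unfolding T3_def by blast
  moreover have "T3 \<Longrightarrow> T2" using cf_continuous_if_bound unfolding T3_def T2_def by blast
  moreover have "T2 \<Longrightarrow> T5" using fractional_moment_if_cf_continuous unfolding T2_def T5_def .
  moreover have "T5 \<Longrightarrow> T1" using growth AE_tempered_if_bound unfolding T1_def by blast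
  moreover have "T5 \<Longrightarrow> T6"
  proof -
    assume T5
    then obtain C \<epsilon> where C: "C > 0" "0 < \<epsilon>" "\<epsilon> \<le> 1" "\<And>\<xi>. cmod (\<Psi> \<xi>) \<le> C * (\<bar>\<xi>\<bar> powr \<epsilon> + \<bar>\<xi>\<bar>\<^sup>2)"
      using growth by blast
    show T6 unfolding T6_def using noise_moments_finite[OF C] C(2) by (intro exI[of _ "\<epsilon> / 2"]) auto
  qed
  moreover have "T6 \<Longrightarrow> T7" using bump_test bump_nonzero unfolding T6_def T7_def by blast
  moreover have "T7 \<Longrightarrow> T5" using fractional_moment_if_noise_moment unfolding T7_def T5_def by blast
  moreover have "T1 \<Longrightarrow> T4"
    unfolding T1_def T4_def
  proof
    fix \<phi> assume "\<phi> \<in> test_functions"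
    assume "AE \<omega> in M. W \<omega> \<in> tempered_generalized_functions"
    then show "AE \<omega> in M. (\<lambda>n::int. W \<omega> (\<lambda>x. \<phi> (x - real_of_int n))) \<in> tempered_sequences"
      by eventually_elim (rule tempered_translates[OF _ \<open>\<phi> \<in> test_functions\<close>])
  qed
  moreover have "T4 \<Longrightarrow> T5"
  proof -
    assume T4
    then have tempered: "AE \<omega> in M. (\<lambda>n::int. W \<omega> (\<lambda>x. bump (x - real_of_int n))) \<in> tempered_sequences"
      using bump_test unfolding T4_def by blast
    have "\<not> (AE \<omega> in M. (\<lambda>n::int. W \<omega> (\<lambda>x. bump (x - real_of_int n))) \<notin> tempered_sequences)"
    proof
      assume "AE \<omega> in M. (\<lambda>n::int. W \<omega> (\<lambda>x. bump (x - real_of_int n))) \<notin> tempered_sequences"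
      with tempered have "AE \<omega> in M. False" by eventually_elim simp
      then show False by simp
    qed
    then show T5 unfolding T5_def by (rule fractional_moment_if_translates_tempered)
  qed
  moreover have "AE \<omega> in M. W \<omega> \<notin> tempered_generalized_functions" if "\<not> T5"
  proof -
    have "AE \<omega> in M. (\<lambda>n::int. W \<omega> (\<lambda>x. bump (x - real_of_int n))) \<notin> tempered_sequences"
      using that fractional_moment_if_translates_tempered unfolding T5_def by blast
    then show ?thesis by eventually_elim (use tempered_translates[OF _ bump_test] in blast)
  qed
  ultimately show ?thesis by blast
qed

end

theorem theorem3:
  fixes M :: "'w measure"
    and W :: "'w \<Rightarrow> (real \<Rightarrow> real) \<Rightarrow> real"
    and \<Psi> :: "real \<Rightarrow> complex"
    and \<nu> :: "real measure"
  assumes "prob_space M"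
    and "levy_white_noise M W \<Psi> \<nu>"
  shows
    "((AE \<omega> in M. W \<omega> \<in> tempered_generalized_functions) \<longleftrightarrow>
        continuous_map (subtopology schwartz_topology test_functions) euclidean
          (characteristic_functional M W)) \<and>
     ((AE \<omega> in M. W \<omega> \<in> tempered_generalized_functions) \<longleftrightarrow>
        (\<exists>C>0. \<exists>\<epsilon>>0. \<forall>\<xi>. cmod (\<Psi> \<xi>) \<le> C * (\<bar>\<xi>\<bar> powr \<epsilon> + \<bar>\<xi>\<bar>\<^sup>2))) \<and>
     ((AE \<omega> in M. W \<omega> \<in> tempered_generalized_functions) \<longleftrightarrow>
        (\<forall>\<phi>\<in>test_functions. AE \<omega> in M.
           (\<lambda>n::int. W \<omega> (\<lambda>x. \<phi> (x - real_of_int n))) \<in> tempered_sequences)) \<and>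
     ((AE \<omega> in M. W \<omega> \<in> tempered_generalized_functions) \<longleftrightarrow>
        (\<exists>\<epsilon>>0. (\<integral>\<^sup>+ t\<in>{t. 1 \<le> \<bar>t\<bar>}. ennreal (\<bar>t\<bar> powr \<epsilon>) \<partial>\<nu>) < \<infinity>)) \<and>
     ((AE \<omega> in M. W \<omega> \<in> tempered_generalized_functions) \<longleftrightarrow>
        (\<exists>\<epsilon>>0. \<forall>\<phi>\<in>test_functions.
           (\<integral>\<^sup>+ \<omega>. ennreal (\<bar>W \<omega> \<phi>\<bar> powr \<epsilon>) \<partial>M) < \<infinity>)) \<and>
     ((AE \<omega> in M. W \<omega> \<in> tempered_generalized_functions) \<longleftrightarrow>
        (\<exists>\<epsilon>>0. \<exists>\<phi>\<in>test_functions - {\<lambda>x. 0}.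
           (\<integral>\<^sup>+ \<omega>. ennreal (\<bar>W \<omega> \<phi>\<bar> powr \<epsilon>) \<partial>M) < \<infinity>)) \<and>
     (\<not> (AE \<omega> in M. W \<omega> \<in> tempered_generalized_functions) \<longrightarrow>
        (AE \<omega> in M. W \<omega> \<notin> tempered_generalized_functions))"
proof -
  obtain \<mu> \<sigma> where "levy_measure \<nu>" "\<Psi> = levy_khintchine \<mu> \<sigma> \<nu>"
    using assms(2) by (auto simp: levy_white_noise_def characteristic_exponent_def)
  then interpret levy_exponent \<nu> \<mu> \<sigma> \<Psi> by unfold_locales
  interpret levy_noise \<nu> \<mu> \<sigma> \<Psi> M W
    using assms by (intro levy_noise.intro levy_exponent_axioms levy_noise_axioms.intro)
      (auto simp: levy_white_noise_def exponent_def)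
  show ?thesis by (rule temperedness_equivalences)
qed

end
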